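(* Let $1\le p<\infty$, $0<q<\infty$ and $\nu\in\mathcal{D}\cap\widehat{\mathcal{D}}_q$. If $f\in\mathcal{B}^{p,q}_\nu$, then there exist $f_1,f_2\in\mathcal{B}^{p,q}_\nu\cap H^\infty$ such that $f=f_1/f_2$ and $f_2$ is an outer function.
   Context: $\mathbb{D}$ is the open unit disc of $\mathbb{C}$, $\mathbb{T}$ its boundary, and $\mathcal{H}(\mathbb{D})$ the set of analytic functions in $\mathbb{D}$. For $f\in\mathcal{H}(\mathbb{D})$, $0<p<\infty$ and $0\le r<1$ let $M_p(r,f)=\left(\frac1{2\pi}\int_0^{2\pi}|f(re^{i\theta})|^p\,d\theta\right)^{1/p}$. The Hardy space $H^p$ consists of $f\in\mathcal{H}(\mathbb{D})$ with $\|f\|_{H^p}=\sup_{0\le r<1}M_p(r,f)<\infty$, and $H^\infty$ is the set of bounded functions in $\mathcal{H}(\mathbb{D})$. A weight is a function $\nu:\mathbb{D}\to[0,\infty)$ that is integrable over $\mathbb{D}$ and radial, $\nu(z)=\nu(|z|)$. Put $\widehat\nu(z)=\widehat\nu(|z|)=\int_{|z|}^1\nu(s)\,ds$; it is understood that $\widehat\nu(r)>0$ for all $0\le r<1$. Write $\nu\in\widehat{\mathcal{D}}$ if there is $C=C(\nu)>0$ with $\widehat\nu(r)\le C\,\widehat\nu\left(\frac{1+r}{2}\right)$ for all $0\le r<1$. Write $\nu\in\check{\mathcal{D}}$ if there are $K=K(\nu)>1$ and $C=C(\nu)>1$ with $\widehat\nu(r)\ge C\,\widehat\nu\left(1-\frac{1-r}{K}\right)$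 for all $0\le r<1$. Set $\mathcal{D}=\widehat{\mathcal{D}}\cap\check{\mathcal{D}}$. For $0<q<\infty$, $\widehat{\mathcal{D}}_q$ is the subclass of those $\nu\in\widehat{\mathcal{D}}$ with $$\sup_{0\le r<1}\frac{(1-r)^q}{\widehat\nu(r)}\int_0^r\frac{\nu(s)}{(1-s)^q}\,ds<\infty.$$ For $g\in\mathcal{H}(\mathbb{D})$, $\|g\|_{A^{p,q}_\nu}^q=\int_0^1M_p(r,g)^q\,\nu(r)\,dr$. The weighted Besov space $\mathcal{B}^{p,q}_\nu$ consists of those $f\in H^p$ with $\|f'\|_{A^{p,q}_\nu}<\infty$. For $0<p\le\infty$, an outer function for $H^p$ is a function of the form $O_\phi(z)=\exp\left(\frac1{2\pi}\int_0^{2\pi}\frac{e^{i\theta}+z}{e^{i\theta}-z}\log\phi(e^{i\theta})\,d\theta\right)$, $z\in\mathbb{D}$, where $\phi$ is a non-negative function in $L^p(\mathbb{T})$ with $\log\phi\in L^1(\mathbb{T})$. *)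

theory Defs
  imports "HOL-Complex_Analysis.Complex_Analysis"
begin

abbreviation unit_disc :: "complex set" ("\<bbbD>")
  where "\<bbbD> \<equiv> ball 0 1"

definition integral_mean :: "real \<Rightarrow> real \<Rightarrow> (complex \<Rightarrow> complex) \<Rightarrow> real" where
  "integral_mean p r f =
     (1 / (2 * pi) * (LINT t:{0..2 * pi}|lebesgue. cmod (f (of_real r * cis t)) powr p)) powr (1 / p)"

definition Hardy :: "real \<Rightarrow> (complex \<Rightarrow> complex) set" where
  "Hardy p = {f. f holomorphic_on \<bbbD> \<and> bdd_above ((\<lambda>r. integral_mean p r f) ` {0..<1})}"

definition Hardy_inf :: "(complex \<Rightarrow> complex) set" where
  "Hardy_inf = {f. f holomorphic_on \<bbbD> \<and> bounded (f ` \<bbbD>)}"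


text \<open>
  Tail integrals are taken in the extended non-negative reals: integrability of a radial
  \<open>\<nu>\<close> over the disc (weight \<open>s ds\<close>) does not by itself exclude that the tail integral is
  infinite at \<open>r = 0\<close>. The doubling condition below does exclude it.
\<close>

definition weight_hat :: "(complex \<Rightarrow> real) \<Rightarrow> real \<Rightarrow> ennreal" where
  "weight_hat \<nu> r = (\<integral>\<^sup>+s\<in>{r..<1}. ennreal (\<nu> (of_real s)) \<partial>lebesgue)"

definition radial_weight :: "(complex \<Rightarrow> real) \<Rightarrow> bool" where
  "radial_weight \<nu> \<longleftrightarrow>
     (\<forall>z\<in>\<bbbD>. 0 \<le> \<nu> z) \<and>
     (\<forall>z\<in>\<bbbD>. \<nu> z = \<nu> (of_real (cmod z))) \<and>
     set_integrable lebesgue \<bbbD> \<nu> \<and>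
     (\<forall>r\<in>{0..<1}. 0 < weight_hat \<nu> r)"

definition D_hat :: "(complex \<Rightarrow> real) set" where
  "D_hat = {\<nu>. radial_weight \<nu> \<and>
     (\<exists>C>0. \<forall>r\<in>{0..<1}. weight_hat \<nu> r \<le> ennreal C * weight_hat \<nu> ((1 + r) / 2))}"

definition D_check :: "(complex \<Rightarrow> real) set" where
  "D_check = {\<nu>. radial_weight \<nu> \<and>
     (\<exists>K>1. \<exists>C>1. \<forall>r\<in>{0..<1}.
        weight_hat \<nu> r \<ge> ennreal C * weight_hat \<nu> (1 - (1 - r) / K))}"

definition D_two_sided :: "(complex \<Rightarrow> real) set" where
  "D_two_sided = D_hat \<inter> D_check"

definition D_hat_sub :: "real \<Rightarrow> (complex \<Rightarrow> real) set" where
  "D_hat_sub q = {\<nu> \<in> D_hat.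
     (SUP r\<in>{0..<1}. ennreal ((1 - r) powr q) / weight_hat \<nu> r *
        (\<integral>\<^sup>+s\<in>{0..r}. ennreal (\<nu> (of_real s) / (1 - s) powr q) \<partial>lebesgue)) < \<infinity>}"


text \<open>The \<open>q\<close>-th power of the mixed norm of \<open>g\<close>.\<close>

definition mixed_norm_pow ::
  "real \<Rightarrow> real \<Rightarrow> (complex \<Rightarrow> real) \<Rightarrow> (complex \<Rightarrow> complex) \<Rightarrow> ennreal" where
  "mixed_norm_pow p q \<nu> g =
     (\<integral>\<^sup>+r\<in>{0..<1}. ennreal (integral_mean p r g powr q * \<nu> (of_real r)) \<partial>lebesgue)"

definition Besov :: "real \<Rightarrow> real \<Rightarrow> (complex \<Rightarrow> real) \<Rightarrow> (complex \<Rightarrow> complex) set" where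
  "Besov p q \<nu> = {f \<in> Hardy p. mixed_norm_pow p q \<nu> (deriv f) < \<infinity>}"


definition Lp_circle :: "ereal \<Rightarrow> (complex \<Rightarrow> real) set" where
  "Lp_circle p = {\<phi>.
     (\<lambda>t. \<phi> (cis t)) \<in> borel_measurable (lebesgue_on {0..2 * pi}) \<and>
     (if p = \<infinity> then \<exists>B. AE t in lebesgue_on {0..2 * pi}. \<bar>\<phi> (cis t)\<bar> \<le> B
      else integrable (lebesgue_on {0..2 * pi}) (\<lambda>t. \<bar>\<phi> (cis t)\<bar> powr real_of_ereal p))}"

definition outer_integral :: "(complex \<Rightarrow> real) \<Rightarrow> complex \<Rightarrow> complex" where
  "outer_integral \<phi> z =
     exp (1 / (2 * of_real pi) *
       (LINT t:{0..2 * pi}|lebesgue. (cis t + z) / (cis t - z) * of_real (ln (\<phi> (cis t)))))"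

text \<open>
  Since \<open>ln 0 = 0\<close> in HOL, integrability of \<open>ln \<phi>\<close> does not force \<open>\<phi> > 0\<close> almost everywhere;
  mathematically (\<open>log 0 = -\<infinity>\<close>) it does, so this is required explicitly.
\<close>

definition outer_function :: "ereal \<Rightarrow> (complex \<Rightarrow> complex) \<Rightarrow> bool" where
  "outer_function p F \<longleftrightarrow>
     (\<exists>\<phi>. (\<forall>w\<in>sphere 0 1. 0 \<le> \<phi> w) \<and>
          \<phi> \<in> Lp_circle p \<and>
          (AE t in lebesgue_on {0..2 * pi}. 0 < \<phi> (cis t)) \<and>
          integrable (lebesgue_on {0..2 * pi}) (\<lambda>t. ln (\<phi> (cis t))) \<and>
          (\<forall>z\<in>\<bbbD>. F z = outer_integral \<phi> z))"

end

theory Submission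
  imports Defs
begin

text \<open>
  Integrating \<open>f'\<close> along \<open>\<sigma> \<mapsto> \<sigma>\<^sup>2 z\<close> and bounding \<open>\<bar>f' (\<sigma>\<^sup>2 z)\<bar>\<close> by a Poisson integral over the circle
  of radius \<open>\<sigma>\<close> shows that \<open>\<bar>f\<bar> \<le> Re F\<close> for the Bergman-type potential
  \<open>F z = \<bar>f 0\<bar> + (1/\<pi>) \<integral> \<bar>f' w\<bar> (1 + w\<^sup>* z) / (1 - w\<^sup>* z) dA(w)\<close>, where \<open>w\<^sup>*\<close> is the conjugate of \<open>w\<close>.
  Hence \<open>f2 = exp (- F)\<close> and \<open>f1 = f exp (- F)\<close> are bounded by 1, and their derivatives by
  \<open>\<bar>f'\<bar> + \<bar>F'\<bar>\<close>. By Fubini and the Schwarz formula \<open>F\<close> is the Schwarz integral of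
  its (integrable) boundary real part, so \<open>exp (- F)\<close> is outer.

  A Schur test gives \<open>M_p(r, F') \<le> 4 \<integral> b(s) / (1 - s r) ds\<close> with \<open>b = M_p(\<cdot>, f') + 1\<close>. On the blocks
  \<open>[1 - K^{-k}, 1 - K^{-k-1})\<close> this becomes an infinite matrix which, measured in the weighted
  sequence space belonging to \<open>\<nu>\<close>, decays geometrically off the diagonal: on one side by the condition
  defining \<open>D_check\<close>, on the other by the self-improvement of the condition defining \<open>D_hat_sub q\<close>.
\<close>

subsection \<open>Poisson and Schwarz formulas on the circle\<close>

text \<open>Only derivatives enter the Besov norm, so the factors are built from a potential that is
  linear in |f'|. Since f1' = (f' - f F') exp(-F) and both exp(-F) and f exp(-F) are bounded by 1,
  no lower bound on f2 is ever needed. The square in s^2 z makes the majorant harmonic. The point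
  s^2 z = s (s z) is reached from the circle of radius s by the Poisson kernel at s z, and with w =
  s e^{it} that kernel is (1 - |w z|^2) / |1 - w^* z|^2, the real part of (1 + w^* z) / (1 - w^* z).
  The factor 2s of the chain rule becomes the polar area element. The kernel of F' has modulus
  proportional to 1 / |1 - w^* z|^2, whose integral is 2 pi / (1 - s^2 r^2) over either angle. Row
  and column masses are therefore both explicit, and one Schur test settles the angular variables.
  The 1 added to the means permits division by b and costs only the sum of the tail masses at the
  block endpoints, a convergent geometric series.\<close>

definition circ :: "real measure" where "circ = restrict_space lborel {0..2*pi}"
definition unit_int :: "real measure" where "unit_int = restrict_space lborel {0..<1}"

lemma sets_circ [measurable_cong]: "sets circ = sets (restrict_space borel {0..2*pi})"
  by (simp add: circ_def sets_restrict_space)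

lemma sets_unit_int [measurable_cong]: "sets unit_int = sets (restrict_space borel {0..<1})"
  by (simp add: unit_int_def sets_restrict_space)

lemma space_circ [simp]: "space circ = {0..2*pi}"
  by (simp add: circ_def space_restrict_space)

lemma space_unit_int [simp]: "space unit_int = {0..<1}"
  by (simp add: unit_int_def space_restrict_space)

lemma finite_measure_circ: "finite_measure circ"
  by (rule finite_measureI) (simp add: circ_def emeasure_restrict_space space_restrict_space)

lemma finite_measure_unit_int: "finite_measure unit_int"
  by (rule finite_measureI) (simp add: unit_int_def emeasure_restrict_space space_restrict_space)

interpretation circ: finite_measure circ by (rule finite_measure_circ)
interpretation unit_int: finite_measure unit_int by (rule finite_measure_unit_int)
text \<open>\<open>cu\<close> exchanges a boundary angle with a point of the disc in polar
  coordinates, \<open>cc\<close> exchanges two angles.\<close>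

interpretation cu: pair_sigma_finite circ "unit_int \<Otimes>\<^sub>M circ"
  by (intro pair_sigma_finite.intro circ.sigma_finite_measure_axioms
        sigma_finite_pair_measure unit_int.sigma_finite_measure_axioms)
interpretation cc: pair_sigma_finite circ circ ..

lemma emeasure_circ: "emeasure circ (space circ) = ennreal (2*pi)"
  by (simp add: circ_def emeasure_restrict_space space_restrict_space)

lemma nn_integral_circ: "(\<integral>\<^sup>+t. f t \<partial>circ) = (\<integral>\<^sup>+t. f t * indicator {0..2*pi} t \<partial>lborel)"
  unfolding circ_def by (subst nn_integral_restrict_space) auto

lemma nn_integral_circ_has_integral:
  assumes "(f has_integral I) {0..2*pi}" "\<And>t. t \<in> {0..2*pi} \<Longrightarrow> 0 \<le> f t"
  shows "(\<integral>\<^sup>+t. ennreal (f t) \<partial>circ) = ennreal I"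
  unfolding nn_integral_circ using assms by (intro nn_integral_has_integral_lebesgue') auto

text \<open>The given notions integrate against completed Lebesgue measure, whereas product measures
  and Fubini are used on the Borel measure \<open>circ\<close>. For Borel integrands the two
  integrals agree.\<close>

lemma set_integral_lebesgue_eq_circ:
  fixes f :: "real \<Rightarrow> 'a::{banach, second_countable_topology}"
  assumes [measurable]: "f \<in> borel_measurable borel"
  shows "set_lebesgue_integral lebesgue {0..2*pi} f = (\<integral>t. f t \<partial>circ)"
proof -
  have "set_lebesgue_integral lebesgue {0..2*pi} f = set_lebesgue_integral lborel {0..2*pi} f"
    unfolding set_lebesgue_integral_def by (rule integral_completion) measurable
  also have "\<dots> = (\<integral>t. f t \<partial>circ)"
    unfolding circ_def set_lebesgue_integral_def by (subst integral_restrict_space) auto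
  finally show ?thesis .
qed

lemma borel_measurable_circ_unit_int [measurable]:
  "(\<lambda>t. t) \<in> borel_measurable circ" "(\<lambda>t. t) \<in> borel_measurable unit_int"
  unfolding circ_def unit_int_def by (rule measurable_restrict_space1, simp)+

lemma borel_measurable_cis [measurable]: "cis \<in> borel_measurable borel"
  by (intro borel_measurable_continuous_onI continuous_intros)

lemma circle_Cauchy_formula:
  assumes "continuous_on (cball 0 1) h" "h holomorphic_on ball 0 1" "cmod z < 1"
  shows "((\<lambda>t. h (cis t) * cis t / (cis t - z)) has_integral of_real (2*pi) * h z) {0..2*pi}"
proof -
  have "((\<lambda>u. h u/(u-z)) has_contour_integral (2 * of_real pi * \<i> * h z)) (circlepath 0 1)"
    using assms by (intro Cauchy_integral_circlepath) auto
  then have "((\<lambda>t. h (cis t) / (cis t - z) * \<i> * cis t) has_integral (2 * of_real pi * \<i> * h z)) {0..2*pi}"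
    unfolding circlepath_def by (subst (asm) has_contour_integral_part_circlepath_iff) auto
  from has_integral_mult_right[OF this, of "-\<i>"] show ?thesis
    by (simp add: mult_ac)
qed

text \<open>On the circle the conjugate of \<open>cis t\<close> is its inverse, so the squared
  distance is rational in \<open>cis t\<close> and the Poisson kernel comes within reach of Cauchy's
  formula.\<close>

lemma cmod_cis_diff_eq: "of_real ((cmod (cis t - z))\<^sup>2) = (cis t - z) * (1 - cnj z * cis t) / cis t"
proof -
  have "of_real ((cmod (cis t - z))\<^sup>2) = (cis t - z) * cnj (cis t - z)"
    by (simp only: complex_norm_square)
  also have "cnj (cis t - z) = (1 - cnj z * cis t) / cis t"
    by (simp add: cis_cnj divide_simps cis_mult algebra_simps)
  finally show ?thesis by simp
qed

lemma cis_diff_nz: "cmod z < 1 \<Longrightarrow> cis t - z \<noteq> 0"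
  by (metis norm_cis eq_iff_diff_eq_0 less_irrefl)

lemma one_minus_mult_nz: "cmod a \<le> 1 \<Longrightarrow> cmod z < 1 \<Longrightarrow> 1 - a * z \<noteq> 0"
proof
  assume "cmod a \<le> 1" "cmod z < 1" "1 - a * z = 0"
  then have "cmod a * cmod z = 1"
    by (metis eq_iff_diff_eq_0 norm_mult norm_one)
  moreover have "cmod a * cmod z \<le> 1 * cmod z"
    using \<open>cmod a \<le> 1\<close> by (intro mult_right_mono) auto
  ultimately show False using \<open>cmod z < 1\<close> by simp
qed

text \<open>Cauchy's formula for h(w) / (1 - cnj z w), whose extra pole lies outside the closed
  disc; at w = z the extra factor is 1 / (1 - |z|^2).\<close>

lemma Poisson_formula:
  assumes "continuous_on (cball 0 1) h" "h holomorphic_on ball 0 1" "cmod z < 1"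
  shows "((\<lambda>t. h (cis t) / of_real ((cmod (cis t - z))\<^sup>2)) has_integral
           of_real (2*pi) * h z / of_real (1 - (cmod z)\<^sup>2)) {0..2*pi}"
proof -
  have nz: "1 - cnj z * w \<noteq> 0" if "w \<in> cball 0 1" for w
    using one_minus_mult_nz[of w "cnj z"] that assms(3) by (simp add: mult.commute)
  have "((\<lambda>t. (h (cis t) / (1 - cnj z * cis t)) * cis t / (cis t - z)) has_integral
          of_real (2*pi) * (h z / (1 - cnj z * z))) {0..2*pi}"
    using nz by (intro circle_Cauchy_formula[where h = "\<lambda>w. h w / (1 - cnj z * w)"]
        holomorphic_intros continuous_intros assms) auto
  also have "(\<lambda>t. (h (cis t) / (1 - cnj z * cis t)) * cis t / (cis t - z)) =
             (\<lambda>t. h (cis t) / of_real ((cmod (cis t - z))\<^sup>2))"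
    unfolding cmod_cis_diff_eq by (simp add: mult.commute)
  also have "1 - cnj z * z = of_real (1 - (cmod z)\<^sup>2)"
    by (simp only: mult.commute[of "cnj z" z] complex_norm_square[symmetric] of_real_diff of_real_1)
  finally show ?thesis by simp
qed

lemma Poisson_kernel_has_integral:
  assumes "cmod z < 1"
  shows "((\<lambda>t. 1 / (cmod (cis t - z))\<^sup>2) has_integral 2*pi / (1 - (cmod z)\<^sup>2)) {0..2*pi}"
proof -
  have "((\<lambda>t. complex_of_real (1 / (cmod (cis t - z))\<^sup>2)) has_integral of_real (2*pi / (1 - (cmod z)\<^sup>2))) {0..2*pi}"
    using Poisson_formula[of "\<lambda>_. 1" z] assms by simp
  from has_integral_Re[OF this] show ?thesis by (simp only: Re_complex_of_real)
qed

lemma nn_integral_Poisson_kernel: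
  assumes "cmod z < 1"
  shows "(\<integral>\<^sup>+t. ennreal (1 / (cmod (cis t - z))\<^sup>2) \<partial>circ) = ennreal (2*pi / (1 - (cmod z)\<^sup>2))"
  by (intro nn_integral_circ_has_integral Poisson_kernel_has_integral assms) auto

text \<open>The triangle inequality in Poisson's formula, that is, subharmonicity of |h|. The
  non-negative extended form is the one in which a kernel bound enters the Schur test.\<close>

lemma norm_le_Poisson:
  assumes "continuous_on (cball 0 1) h" "h holomorphic_on ball 0 1" "cmod z < 1"
  shows "ennreal (cmod (h z)) \<le> (\<integral>\<^sup>+t. ennreal ((1 - (cmod z)\<^sup>2) / (2*pi) / (cmod (cis t - z))\<^sup>2) * ennreal (cmod (h (cis t))) \<partial>circ)"
proof -
  define c where "c = 1 - (cmod z)\<^sup>2"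
  have c: "c > 0" using assms(3) by (simp add: c_def abs_square_less_1)
  define k where "k t = (cmod (cis t - z))\<^sup>2" for t
  have k: "k t > 0" for t using cis_diff_nz[OF assms(3)] by (simp add: k_def)
  have ch: "continuous_on {0..2*pi} (\<lambda>t. h (cis t))"
    by (intro continuous_on_compose2[OF assms(1)] continuous_intros) auto
  have ck: "continuous_on {0..2*pi} k" unfolding k_def by (intro continuous_intros)
  have P: "((\<lambda>t. h (cis t) / of_real (k t)) has_integral of_real (2*pi) * h z / of_real c) {0..2*pi}"
    using Poisson_formula[OF assms] by (simp add: k_def c_def)
  have "(\<lambda>t. cmod (h (cis t)) / k t) integrable_on {0..2*pi}"
    using k by (intro integrable_continuous_interval continuous_intros ch ck) (auto simp: less_le)
  then obtain J where J: "((\<lambda>t. cmod (h (cis t)) / k t) has_integral J) {0..2*pi}" by blast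
  have "cmod (of_real (2*pi) * h z / of_real c) \<le> J"
  proof -
    have "norm (integral {0..2*pi} (\<lambda>t. h (cis t) / of_real (k t))) \<le> integral {0..2*pi} (\<lambda>t. cmod (h (cis t)) / k t)"
    proof (intro integral_norm_bound_integral)
      show "(\<lambda>t. h (cis t) / of_real (k t)) integrable_on {0..2*pi}" using P by blast
      show "(\<lambda>t. cmod (h (cis t)) / k t) integrable_on {0..2*pi}" using J by blast
      show "norm (h (cis t) / of_real (k t)) \<le> cmod (h (cis t)) / k t" for t
        using k[of t] by (simp add: norm_divide)
    qed
    then show ?thesis using P J by (metis integral_unique)
  qed
  then have "2*pi * cmod (h z) / c \<le> J" using c by (simp add: norm_mult norm_divide)
  then have *: "cmod (h z) \<le> c / (2*pi) * J" using c by (simp add: field_simps)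
  have "((\<lambda>t. c / (2*pi) * (cmod (h (cis t)) / k t)) has_integral c/(2*pi) * J) {0..2*pi}"
    by (intro has_integral_mult_right J)
  then have "(\<integral>\<^sup>+t. ennreal (c / (2*pi) * (cmod (h (cis t)) / k t)) \<partial>circ) = ennreal (c/(2*pi) * J)"
    using c k by (intro nn_integral_circ_has_integral) (auto intro!: mult_nonneg_nonneg divide_nonneg_pos simp: less_imp_le)
  then have "ennreal (cmod (h z)) \<le> (\<integral>\<^sup>+t. ennreal (c / (2*pi) * (cmod (h (cis t)) / k t)) \<partial>circ)"
    using * by (simp add: ennreal_leI)
  also have "\<dots> = (\<integral>\<^sup>+t. ennreal (c / (2*pi) / k t) * ennreal (cmod (h (cis t))) \<partial>circ)"
    using c k by (intro nn_integral_cong) (simp add: ennreal_mult[symmetric] less_imp_le)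
  finally show ?thesis by (simp add: c_def k_def)
qed

text \<open>Identifies the real part of the Cayley transform with a Poisson kernel, hence shows that
  it is positive for |a| < 1.\<close>

lemma Re_Cayley: "1 - a \<noteq> 0 \<Longrightarrow> Re ((1 + a) / (1 - a)) = (1 - (cmod a)\<^sup>2) / (cmod (1 - a))\<^sup>2"
proof -
  assume nz: "1 - a \<noteq> 0"
  have "(1 + a) / (1 - a) = (1 + a) * cnj (1 - a) / of_real ((cmod (1 - a))\<^sup>2)"
    using nz by (simp only: complex_norm_square) (subst mult_divide_mult_cancel_right, auto)
  moreover have "Re ((1 + a) * cnj (1 - a)) = 1 - (cmod a)\<^sup>2"
    unfolding cmod_power2 by (simp add: algebra_simps power2_eq_square)
  ultimately show ?thesis by simp
qed

text \<open>The Schwarz integral recovers a function that is real at 0 from its boundary real part.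
  It is proved here for the Cayley transform G(w) = (1 + a w) / (1 - a w), with G(0) = 1, out of
  which \<open>F\<close> is superposed.\<close>

lemma Schwarz_formula_Cayley:
  assumes a: "cmod a < 1" and z: "cmod z < 1"
  shows "((\<lambda>t. (cis t + z) / (cis t - z) * of_real (Re ((1 + a * cis t) / (1 - a * cis t))))
           has_integral of_real (2*pi) * ((1 + a*z) / (1 - a*z))) {0..2*pi}"
proof -
  define G where "G w = (1 + a*w) / (1 - a*w)" for w
  have nz: "1 - a * w \<noteq> 0" if "w \<in> cball 0 1" for w
    using one_minus_mult_nz[of w a] that a by (simp add: mult.commute)
  have nz': "1 - cnj z * w \<noteq> 0" if "w \<in> cball 0 1" for w
    using one_minus_mult_nz[of w "cnj z"] that z by (simp add: mult.commute)
  have cG: "continuous_on (cball 0 1) G" unfolding G_def using nz by (intro continuous_intros) auto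
  have hG: "G holomorphic_on ball 0 1" unfolding G_def using nz by (intro holomorphic_intros) auto
  have 1: "((\<lambda>t. G (cis t) * cis t / (cis t - z)) has_integral of_real (2*pi) * G z) {0..2*pi}"
    by (intro circle_Cauchy_formula cG hG z)
  \<comment> \<open>Cauchy's formula at the point 0 sees only the value 1 of the integrand there, so
    the conjugated term contributes 2 pi whatever \<open>z\<close> is.\<close>
  have "((\<lambda>t. (G (cis t) / (1 - cnj z * cis t)) * cis t / (cis t - 0)) has_integral of_real (2*pi) * (G 0 / (1 - cnj z * 0))) {0..2*pi}"
    using nz' by (intro circle_Cauchy_formula[where h = "\<lambda>w. G w / (1 - cnj z * w)"] holomorphic_intros continuous_intros cG hG) auto
  then have "((\<lambda>t. G (cis t) / (1 - cnj z * cis t)) has_integral of_real (2*pi)) {0..2*pi}"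
    by (simp add: G_def)
  from has_integral_cnj[THEN iffD2, OF this]
  have 2: "((\<lambda>t. cnj (G (cis t) / (1 - cnj z * cis t))) has_integral of_real (2*pi)) {0..2*pi}"
    by (simp add: o_def)
  have "((\<lambda>t. G (cis t) * cis t / (cis t - 0)) has_integral of_real (2*pi) * G 0) {0..2*pi}"
    by (intro circle_Cauchy_formula cG hG) auto
  then have "((\<lambda>t. Re (G (cis t))) has_integral Re (of_real (2*pi))) {0..2*pi}"
    by (intro has_integral_Re) (simp add: G_def)
  then have 3: "((\<lambda>t. complex_of_real (Re (G (cis t)))) has_integral of_real (2*pi)) {0..2*pi}"
    by (drule_tac has_integral_linear[OF _ bounded_linear_of_real[where 'a = complex]]) (simp add: o_def)
  \<comment> \<open>With u = cis t the Schwarz kernel is 2 u / (u - z) - 1 and Re G is the half-sum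
    of G and its conjugate. The product splits into a Cauchy term, the conjugate of a Cauchy term
    and minus Re G; the last two integrals cancel.\<close>
  have "((\<lambda>t. G (cis t) * cis t / (cis t - z) + cnj (G (cis t) / (1 - cnj z * cis t)) - complex_of_real (Re (G (cis t))))
      has_integral of_real (2*pi) * G z + of_real (2*pi) - of_real (2*pi)) {0..2*pi}"
    by (intro has_integral_add has_integral_diff 1 2 3)
  moreover have "G (cis t) * cis t / (cis t - z) + cnj (G (cis t) / (1 - cnj z * cis t)) - complex_of_real (Re (G (cis t)))
      = (cis t + z) / (cis t - z) * of_real (Re (G (cis t)))" for t
  proof -
    have k: "cnj (1 - cnj z * cis t) = (cis t - z) / cis t"
      by (simp add: cis_cnj divide_simps cis_mult algebra_simps)
    have r: "complex_of_real (Re (G (cis t))) = (G (cis t) + cnj (G (cis t))) / 2"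
      by (simp add: complex_add_cnj)
    have *: "g * u / d + g' / (d / u) - (g + g') / 2 = (2 * u - d) / d * ((g + g') / 2)"
      if "d \<noteq> 0" "u \<noteq> 0" for g g' d u :: complex
      using that by (simp add: field_simps)
    have u: "cis t + z = 2 * cis t - (cis t - z)" by simp
    show ?thesis unfolding complex_cnj_divide k r u
      by (rule *[OF cis_diff_nz[OF z, of t] cis_neq_zero])
  qed
  ultimately show ?thesis by (simp add: G_def)
qed

subsection \<open>A Schur test for integral means\<close>

text \<open>The graph of u^p lies above its tangent at \<open>c\<close>. For p > 1 this is Young's
  inequality with exponents p and p / (p - 1).\<close>

lemma powr_tangent_le:
  fixes p u c :: real
  assumes "1 \<le> p" "0 \<le> u" "0 < c"
  shows "p * c powr (p - 1) * u \<le> u powr p + (p - 1) * c powr p"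
proof (cases "p = 1")
  case False
  with assms have p: "p > 1" by simp
  define q where "q = p / (p - 1)"
  have q: "q > 1" "1/p + 1/q = 1" using p by (auto simp: q_def field_simps)
  have "(c powr (p - 1)) powr q = c powr p"
    using p by (simp add: powr_powr q_def)
  then have "u * c powr (p - 1) \<le> u powr p / p + c powr p / q"
    using Youngs_inequality[of p q u "c powr (p - 1)"] p q assms by simp
  then have "p * (u * c powr (p - 1)) \<le> p * (u powr p / p + c powr p / q)"
    using p by (intro mult_left_mono) auto
  also have "\<dots> = u powr p + (p - 1) * c powr p"
    using p by (simp add: q_def field_simps)
  finally show ?thesis by (simp add: mult_ac)
qed (use assms in auto)

text \<open>Jensen's inequality for a weight whose mass is known only up to the bound
  \<open>A\<close>, obtained by integrating a tangent line. The right-hand side may be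
  infinite.\<close>

lemma weighted_Jensen_powr:
  fixes u :: "'a \<Rightarrow> real" and W :: "'a \<Rightarrow> ennreal"
  assumes [measurable]: "W \<in> borel_measurable M" "u \<in> borel_measurable M"
    and u: "\<And>x. x \<in> space M \<Longrightarrow> 0 \<le> u x" and p: "1 \<le> p" and A: "0 < A" and I: "0 \<le> I"
    and WA: "(\<integral>\<^sup>+x. W x \<partial>M) \<le> ennreal A"
    and WI: "ennreal I \<le> (\<integral>\<^sup>+x. W x * ennreal (u x) \<partial>M)"
  shows "ennreal (I powr p) \<le> ennreal (A powr (p - 1)) * (\<integral>\<^sup>+x. W x * ennreal (u x powr p) \<partial>M)"
proof (cases "I = 0")
  case False
  with I have I: "I > 0" by simp
  \<comment> \<open>Tangency at the mean value: then c^p A = c^(p-1) I, so the constant term of the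
    tangent removes all but one of the \<open>p\<close> copies of c^(p-1) I.\<close>
  define c where "c = I / A"
  have c: "c > 0" using I A by (simp add: c_def)
  define J where "J = (\<integral>\<^sup>+x. W x * ennreal (u x powr p) \<partial>M)"
  have "ennreal (p * c powr (p - 1) * I) \<le> ennreal (p * c powr (p - 1)) * (\<integral>\<^sup>+x. W x * ennreal (u x) \<partial>M)"
    using p I WI by (simp add: ennreal_mult mult_left_mono)
  also have "\<dots> = (\<integral>\<^sup>+x. ennreal (p * c powr (p - 1)) * (W x * ennreal (u x)) \<partial>M)"
    by (rule nn_integral_cmult[symmetric]) measurable
  also have "\<dots> \<le> (\<integral>\<^sup>+x. W x * ennreal (u x powr p) + ennreal ((p - 1) * c powr p) * W x \<partial>M)"
  proof (intro nn_integral_mono)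
    fix x assume x: "x \<in> space M"
    have "ennreal (p * c powr (p - 1)) * ennreal (u x) \<le> ennreal (u x powr p) + ennreal ((p - 1) * c powr p)"
      using powr_tangent_le[OF p u[OF x] c] p u[OF x] c by (simp add: ennreal_leI flip: ennreal_mult ennreal_plus)
    from mult_left_mono[OF this, of "W x"]
    show "ennreal (p * c powr (p - 1)) * (W x * ennreal (u x)) \<le> W x * ennreal (u x powr p) + ennreal ((p - 1) * c powr p) * W x"
      by (simp add: algebra_simps)
  qed
  also have "\<dots> = J + ennreal ((p - 1) * c powr p) * (\<integral>\<^sup>+x. W x \<partial>M)"
    unfolding J_def by (subst nn_integral_add) (auto simp: nn_integral_cmult)
  also have "\<dots> \<le> J + ennreal ((p - 1) * c powr p) * ennreal A"
    by (intro add_left_mono mult_left_mono WA) auto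
  finally have *: "ennreal (p * c powr (p - 1) * I) \<le> J + ennreal ((p - 1) * c powr p) * ennreal A" .
  show ?thesis
  proof (cases "J = top")
    case True
    then show ?thesis using A by (simp add: J_def[symmetric] ennreal_mult_top)
  next
    case False
    then obtain j where j: "J = ennreal j" "j \<ge> 0" by (cases J) auto
    have "p * c powr (p - 1) * I \<le> j + (p - 1) * c powr p * A"
      using * j p A by (simp add: ennreal_le_iff flip: ennreal_mult ennreal_plus)
    moreover have cp: "c powr p = c powr (p - 1) * c" using c by (simp add: powr_diff)
    have "c powr p * A = c powr (p - 1) * I" unfolding cp using A by (simp add: c_def)
    then have "(p - 1) * c powr p * A = (p - 1) * (c powr (p - 1) * I)" by simp
    ultimately have "c powr (p - 1) * I \<le> j" by (simp add: algebra_simps)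
    moreover have "c powr (p - 1) * I = I powr p / A powr (p - 1)"
      using I A by (simp add: c_def powr_divide powr_diff)
    ultimately have "I powr p / A powr (p - 1) \<le> j" by simp
    then have "I powr p \<le> A powr (p - 1) * j" using A by (simp add: pos_divide_le_eq mult.commute)
    then show ?thesis using j A by (simp add: J_def[symmetric] ennreal_leI flip: ennreal_mult)
  qed
qed (use p in auto)

text \<open>Jensen on each row, then Tonelli. The column masses stay under the integral because for
  the kernel of F' they depend on the radius.\<close>

lemma (in pair_sigma_finite) Schur_test_powr:
  fixes u :: "'b \<Rightarrow> real" and W :: "'a \<Rightarrow> 'b \<Rightarrow> ennreal" and h :: "'a \<Rightarrow> real"
  assumes W [measurable]: "case_prod W \<in> borel_measurable (M1 \<Otimes>\<^sub>M M2)" and [measurable]: "u \<in> borel_measurable M2"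
    and u: "\<And>x. x \<in> space M2 \<Longrightarrow> 0 \<le> u x" and p: "1 \<le> p" and A: "0 < A"
    and h: "\<And>s. s \<in> space M1 \<Longrightarrow> 0 \<le> h s"
    and WA: "\<And>s. s \<in> space M1 \<Longrightarrow> (\<integral>\<^sup>+x. W s x \<partial>M2) \<le> ennreal A"
    and Wh: "\<And>s. s \<in> space M1 \<Longrightarrow> ennreal (h s) \<le> (\<integral>\<^sup>+x. W s x * ennreal (u x) \<partial>M2)"
  shows "(\<integral>\<^sup>+s. ennreal (h s powr p) \<partial>M1) \<le>
    ennreal (A powr (p - 1)) * (\<integral>\<^sup>+x. ennreal (u x powr p) * (\<integral>\<^sup>+s. W s x \<partial>M1) \<partial>M2)"
proof -
  have "(\<integral>\<^sup>+s. ennreal (h s powr p) \<partial>M1) \<le>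
      (\<integral>\<^sup>+s. ennreal (A powr (p - 1)) * (\<integral>\<^sup>+x. W s x * ennreal (u x powr p) \<partial>M2) \<partial>M1)"
  proof (intro nn_integral_mono weighted_Jensen_powr u p A h WA Wh)
    fix s assume "s \<in> space M1"
    then show "W s \<in> borel_measurable M2"
      using measurable_compose[OF measurable_Pair1' W] by simp
  qed auto
  also have "\<dots> = ennreal (A powr (p - 1)) * (\<integral>\<^sup>+s. (\<integral>\<^sup>+x. W s x * ennreal (u x powr p) \<partial>M2) \<partial>M1)"
    by (rule nn_integral_cmult) measurable
  also have "(\<integral>\<^sup>+s. (\<integral>\<^sup>+x. W s x * ennreal (u x powr p) \<partial>M2) \<partial>M1)
      = (\<integral>\<^sup>+x. (\<integral>\<^sup>+s. W s x * ennreal (u x powr p) \<partial>M1) \<partial>M2)"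
    by (rule Fubini'[symmetric]) measurable
  also have "\<dots> = (\<integral>\<^sup>+x. ennreal (u x powr p) * (\<integral>\<^sup>+s. W s x \<partial>M1) \<partial>M2)"
    by (intro nn_integral_cong, subst nn_integral_multc) (auto simp: mult.commute)
  finally show ?thesis .
qed

lemma integral_mean_nonneg: "0 \<le> integral_mean p r h"
  by (simp add: integral_mean_def)

lemma nn_integral_powr_eq_integral_mean:
  assumes h: "continuous_on UNIV (\<lambda>t. h (of_real r * cis t))" and p: "0 < p"
  shows "(\<integral>\<^sup>+t. ennreal (cmod (h (of_real r * cis t)) powr p) \<partial>circ) = ennreal (2*pi * integral_mean p r h powr p)"
proof -
  define k where "k t = cmod (h (of_real r * cis t)) powr p" for t
  have ck: "continuous_on UNIV k" unfolding k_def using p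
    by (intro continuous_on_powr' continuous_intros h) auto
  then have [measurable]: "k \<in> borel_measurable borel" by (rule borel_measurable_continuous_onI)
  have "bounded (k ` {0..2*pi})"
    by (intro compact_imp_bounded compact_continuous_image continuous_on_subset[OF ck]) auto
  then obtain B where B: "\<And>t. t \<in> {0..2*pi} \<Longrightarrow> norm (k t) \<le> B" unfolding bounded_iff by blast
  have int: "integrable circ k"
    by (rule circ.integrable_const_bound[where B = B]) (use B in \<open>auto intro!: AE_I2 simp: circ_def space_restrict_space\<close>)
  define X where "X = (\<integral>t. k t \<partial>circ)"
  have X: "X \<ge> 0" unfolding X_def by (intro integral_nonneg_AE AE_I2) (simp add: k_def)
  have "(\<integral>\<^sup>+t. ennreal (k t) \<partial>circ) = ennreal X"
    unfolding X_def by (intro nn_integral_eq_integral int AE_I2) (simp add: k_def)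
  moreover have "integral_mean p r h powr p = X / (2*pi)"
  proof -
    have "set_lebesgue_integral lebesgue {0..2*pi} k = X"
      unfolding X_def by (rule set_integral_lebesgue_eq_circ) measurable
    then have "integral_mean p r h = (1 / (2*pi) * X) powr (1 / p)"
      unfolding integral_mean_def k_def[symmetric] by simp
    then show ?thesis using p X by (simp add: powr_powr)
  qed
  ultimately show ?thesis by (simp add: k_def)
qed

lemma integral_mean_leI:
  assumes h: "continuous_on UNIV (\<lambda>t. h (of_real r * cis t))" and p: "0 < p" and B: "0 \<le> B"
    and le: "(\<integral>\<^sup>+t. ennreal (cmod (h (of_real r * cis t)) powr p) \<partial>circ) \<le> ennreal (2*pi * B powr p)"
  shows "integral_mean p r h \<le> B"
proof -
  have "2*pi * integral_mean p r h powr p \<le> 2*pi * B powr p"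
    using le B unfolding nn_integral_powr_eq_integral_mean[OF h p] by (subst (asm) ennreal_le_iff) auto
  then have "integral_mean p r h powr p \<le> B powr p" by simp
  then show ?thesis using powr_less_mono2[of p B "integral_mean p r h"] p B by linarith
qed

lemma continuous_on_circle_of_holomorphic:
  assumes "h holomorphic_on ball 0 1" "0 \<le> r" "r < 1"
  shows "continuous_on UNIV (\<lambda>t. h (of_real r * cis t))"
  by (rule continuous_on_compose2[OF holomorphic_on_imp_continuous_on[OF assms(1)]])
    (use assms in \<open>auto simp: norm_mult intro!: continuous_intros\<close>)

text \<open>Both sides have square 1 + x^2 - 2 x cos(t - s). This symmetry turns row masses of a
  Poisson kernel into column masses.\<close>

lemma cmod_cis_diff_swap: "cmod (cis t - of_real x * cis s) = cmod (cis s - of_real x * cis t)"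
proof -
  have e: "(cmod (cis t - of_real x * cis s))\<^sup>2 = 1 + x\<^sup>2 - 2 * x * (cos t * cos s + sin t * sin s)" for t s
  proof -
    have "(cmod (cis t - of_real x * cis s))\<^sup>2 = (cos t - x * cos s)\<^sup>2 + (sin t - x * sin s)\<^sup>2"
      by (simp add: cmod_power2)
    also have "\<dots> = ((sin t)\<^sup>2 + (cos t)\<^sup>2) + x\<^sup>2 * ((sin s)\<^sup>2 + (cos s)\<^sup>2) - 2 * x * (cos t * cos s + sin t * sin s)"
      by (simp only: power2_eq_square) algebra
    finally show ?thesis by simp
  qed
  have "(cmod (cis t - of_real x * cis s))\<^sup>2 = (cmod (cis s - of_real x * cis t))\<^sup>2"
    unfolding e by (simp add: mult_ac)
  then show ?thesis by simp
qed

text \<open>For the Poisson kernel with ratio r / s all row and column masses are 1, so the Schur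
  test with \<open>A\<close> = 1 compares the two circles.\<close>

lemma integral_mean_mono:
  assumes g: "g holomorphic_on ball 0 1" and p: "1 \<le> p" and r: "0 \<le> r" "r \<le> s" "s < 1"
  shows "integral_mean p r g \<le> integral_mean p s g"
proof (cases "r = s")
  case False
  with r have s: "s > 0" "r < s" by auto
  define x where "x = r / s"
  have x: "0 \<le> x" "x < 1" "r = s * x" using s r by (auto simp: x_def)
  define W where "W \<theta> t = ennreal ((1 - x\<^sup>2) / (2*pi) / (cmod (cis t - of_real x * cis \<theta>))\<^sup>2)" for \<theta> t :: real
  have x2: "1 - x\<^sup>2 > 0" using x by (simp add: power_less_one_iff)
  have W1: "(\<integral>\<^sup>+t. W \<theta> t \<partial>circ) = 1" for \<theta>
  proof -
    have "(\<integral>\<^sup>+t. W \<theta> t \<partial>circ) = (\<integral>\<^sup>+t. ennreal ((1 - x\<^sup>2) / (2*pi)) * ennreal (1 / (cmod (cis t - of_real x * cis \<theta>))\<^sup>2) \<partial>circ)"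
      unfolding W_def using x2 by (simp flip: ennreal_mult)
    also have "\<dots> = ennreal ((1 - x\<^sup>2) / (2*pi)) * ennreal (2*pi / (1 - x\<^sup>2))"
      using nn_integral_Poisson_kernel[of "of_real x * cis \<theta>"] x by (subst nn_integral_cmult) (auto simp: norm_mult)
    also have "\<dots> = 1" using x2 by (simp flip: ennreal_mult)
    finally show ?thesis .
  qed
  have sym: "W \<theta> t = W t \<theta>" for \<theta> t
    unfolding W_def by (subst cmod_cis_diff_swap) simp
  have [measurable]: "(\<lambda>t. g (of_real s * cis t)) \<in> borel_measurable borel"
    using continuous_on_circle_of_holomorphic[OF g, of s] s r by (intro borel_measurable_continuous_onI) auto
  have [measurable]: "(\<lambda>t. g (of_real s * cis t)) \<in> borel_measurable circ"
    unfolding circ_def by measurable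
  have "(\<integral>\<^sup>+\<theta>. ennreal (cmod (g (of_real r * cis \<theta>)) powr p) \<partial>circ)
     \<le> ennreal (1 powr (p - 1)) * (\<integral>\<^sup>+t. ennreal (cmod (g (of_real s * cis t)) powr p) * (\<integral>\<^sup>+\<theta>. W \<theta> t \<partial>circ) \<partial>circ)"
  proof (intro cc.Schur_test_powr p)
    show "(\<lambda>(\<theta>, t). W \<theta> t) \<in> borel_measurable (circ \<Otimes>\<^sub>M circ)"
      unfolding W_def by measurable
    fix \<theta>
    have sw: "s * cmod w < 1" if "cmod w \<le> 1" for w
      using mult_left_le[OF that, of s] s r by linarith
    have hs: "(\<lambda>w. g (of_real s * w)) holomorphic_on ball 0 1"
      using s r by (intro holomorphic_on_compose_gen[OF _ g, unfolded o_def] holomorphic_intros)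
        (use s in \<open>auto simp: norm_mult sw\<close>)
    have cs: "continuous_on (cball 0 1) (\<lambda>w. g (of_real s * w))"
      using s r by (intro continuous_on_compose2[OF holomorphic_on_imp_continuous_on[OF g]] continuous_intros)
        (use s in \<open>auto simp: norm_mult sw\<close>)
    show "ennreal (cmod (g (of_real r * cis \<theta>))) \<le> (\<integral>\<^sup>+t. W \<theta> t * ennreal (cmod (g (of_real s * cis t))) \<partial>circ)"
      using norm_le_Poisson[OF cs hs, of "of_real x * cis \<theta>"] x by (simp add: norm_mult W_def mult.assoc)
  qed (auto simp: W1)
  also have "\<dots> = (\<integral>\<^sup>+t. ennreal (cmod (g (of_real s * cis t)) powr p) \<partial>circ)"
    by (simp add: sym[of _ "_::real"] W1)
  also have "\<dots> = ennreal (2*pi * integral_mean p s g powr p)"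
    using s r p by (intro nn_integral_powr_eq_integral_mean continuous_on_circle_of_holomorphic g) auto
  finally show ?thesis
    using s r p by (intro integral_mean_leI continuous_on_circle_of_holomorphic g integral_mean_nonneg) auto
qed auto

section \<open>Differentiating a superposition of Cayley transforms under the integral sign\<close>

lemma has_field_derivative_Cayley_integral:
  fixes k :: "'a \<Rightarrow> real" and a :: "'a \<Rightarrow> complex"
  assumes k: "integrable M k" and [measurable]: "a \<in> borel_measurable M"
    and a: "\<And>x. x \<in> space M \<Longrightarrow> cmod (a x) \<le> 1" and z: "cmod z < 1"
  shows "((\<lambda>z. \<integral>x. of_real (k x) * ((1 + a x * z) / (1 - a x * z)) \<partial>M) has_field_derivative
     (\<integral>x. of_real (k x) * (2 * a x / (1 - a x * z)\<^sup>2) \<partial>M)) (at z)"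
    and "\<And>z. cmod z < 1 \<Longrightarrow> integrable M (\<lambda>x. of_real (k x) * ((1 + a x * z) / (1 - a x * z)))"
    and "integrable M (\<lambda>x. of_real (k x) * (2 * a x / (1 - a x * z)\<^sup>2))"
proof -
  have [measurable]: "k \<in> borel_measurable M" using k by auto
  have lower: "1 - cmod w \<le> cmod (1 - a x * w)" if "x \<in> space M" for x w
  proof -
    have "cmod (a x) * cmod w \<le> 1 * cmod w" using a[OF that] by (intro mult_right_mono) auto
    then show ?thesis using norm_triangle_ineq2[of 1 "a x * w"] by (simp add: norm_mult)
  qed
  have nz: "1 - a x * w \<noteq> 0" if "x \<in> space M" "cmod w < 1" for x w
    using lower[OF that(1), of w] that by auto
  show I1: "integrable M (\<lambda>x. of_real (k x) * ((1 + a x * w) / (1 - a x * w)))" if w: "cmod w < 1" for w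
  proof (rule Bochner_Integration.integrable_bound)
    show "integrable M (\<lambda>x. 2 / (1 - cmod w) * k x)" using k by simp
    show "AE x in M. norm (of_real (k x) * ((1 + a x * w) / (1 - a x * w))) \<le> norm (2 / (1 - cmod w) * k x)"
    proof (rule AE_I2)
      fix x assume x: "x \<in> space M"
      have "cmod (a x) * cmod w \<le> 1 * 1" using a[OF x] w by (intro mult_mono) auto
      then have "cmod (1 + a x * w) \<le> 2" using norm_triangle_ineq[of 1 "a x * w"] by (simp add: norm_mult)
      then have "cmod (1 + a x * w) / cmod (1 - a x * w) \<le> 2 / (1 - cmod w)"
        using lower[OF x, of w] w by (intro frac_le) auto
      from mult_left_mono[OF this, of "\<bar>k x\<bar>"] show "norm (of_real (k x) * ((1 + a x * w) / (1 - a x * w))) \<le> norm (2 / (1 - cmod w) * k x)"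
        using w by (simp add: norm_mult norm_divide abs_mult mult.commute)
    qed
  qed measurable
  show I2: "integrable M (\<lambda>x. of_real (k x) * (2 * a x / (1 - a x * z)\<^sup>2))"
  proof (rule Bochner_Integration.integrable_bound)
    show "integrable M (\<lambda>x. 2 / (1 - cmod z)\<^sup>2 * k x)" using k by simp
    show "AE x in M. norm (of_real (k x) * (2 * a x / (1 - a x * z)\<^sup>2)) \<le> norm (2 / (1 - cmod z)\<^sup>2 * k x)"
    proof (rule AE_I2)
      fix x assume x: "x \<in> space M"
      have "2 * cmod (a x) / (cmod (1 - a x * z))\<^sup>2 \<le> 2 / (1 - cmod z)\<^sup>2"
        using lower[OF x, of z] z a[OF x] by (intro frac_le power_mono) auto
      from mult_left_mono[OF this, of "\<bar>k x\<bar>"] show "norm (of_real (k x) * (2 * a x / (1 - a x * z)\<^sup>2)) \<le> norm (2 / (1 - cmod z)\<^sup>2 * k x)"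
        by (simp add: norm_mult norm_divide norm_power abs_mult mult.commute)
    qed
  qed measurable
  define G where "G w = (\<integral>x. of_real (k x) * ((1 + a x * w) / (1 - a x * w)) \<partial>M)" for w
  define G' where "G' = (\<integral>x. of_real (k x) * (2 * a x / (1 - a x * z)\<^sup>2) \<partial>M)"
  \<comment> \<open>Half the distance of \<open>z\<close> to the circle. For |w - z| < d both 1 -
    |w| and 1 - |z| are at least d, so the denominator of the remainder is at least d^3 for all x at
    once.\<close>
  define d where "d = (1 - cmod z) / 2"
  have d: "d > 0" using z by (simp add: d_def)
  define C where "C = 2 / d^3 * (\<integral>x. \<bar>k x\<bar> \<partial>M)"
  have bound: "cmod ((G w - G z) / (w - z) - G') \<le> C * cmod (w - z)" if w: "w \<noteq> z" "dist w z < d" for w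
  proof -
    have "cmod w \<le> cmod z + d" using w norm_triangle_ineq2[of w z] by (simp add: dist_norm)
    then have wd: "1 - cmod w \<ge> d" by (simp add: d_def field_simps)
    with d have w1: "cmod w < 1" by simp
    \<comment> \<open>The Cayley transform is 2 / (1 - a z) - 1. With u = 1 - a w and v = 1 - a z
      the second-order remainder is therefore exactly 2 (v - u)^2 / (u v^2).\<close>
    define R where "R x = of_real (k x) * (2 * (a x)\<^sup>2 * (w - z)\<^sup>2 / ((1 - a x * w) * (1 - a x * z)\<^sup>2))" for x
    have R: "of_real (k x) * ((1 + a x * w) / (1 - a x * w)) - of_real (k x) * ((1 + a x * z) / (1 - a x * z))
        - (w - z) * (of_real (k x) * (2 * a x / (1 - a x * z)\<^sup>2)) = R x" if "x \<in> space M" for x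
    proof -
      define u v where "u = 1 - a x * w" and "v = 1 - a x * z"
      have uv: "u \<noteq> 0" "v \<noteq> 0" using nz[OF that w1] nz[OF that z] by (auto simp: u_def v_def)
      have 1: "1 + a x * w = 2 - u" "1 + a x * z = 2 - v" by (auto simp: u_def v_def)
      have 2: "a x * (w - z) = v - u" by (simp add: u_def v_def algebra_simps)
      have 3: "2 * (a x)\<^sup>2 * (w - z)\<^sup>2 = 2 * (v - u)\<^sup>2" unfolding 2[symmetric] by (simp add: power_mult_distrib)
      have 4: "(w - z) * (c * (2 * a x / v\<^sup>2)) = c * (2 * (v - u) / v\<^sup>2)" for c
        unfolding 2[symmetric] by simp
      show ?thesis unfolding R_def u_def[symmetric] v_def[symmetric] 1 3 4
        using uv by (simp add: field_simps power2_eq_square)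
    qed
    have RI: "integrable M R"
    proof -
      have "integrable M (\<lambda>x. of_real (k x) * ((1 + a x * w) / (1 - a x * w)) - of_real (k x) * ((1 + a x * z) / (1 - a x * z))
        - (w - z) * (of_real (k x) * (2 * a x / (1 - a x * z)\<^sup>2)))"
        by (intro Bochner_Integration.integrable_diff I1 I2 integrable_mult_right w1 z)
      then show ?thesis using R by (subst (asm) Bochner_Integration.integrable_cong[OF refl]) auto
    qed
    have "G w - G z - (w - z) * G' = (\<integral>x. of_real (k x) * ((1 + a x * w) / (1 - a x * w)) - of_real (k x) * ((1 + a x * z) / (1 - a x * z))
        - (w - z) * (of_real (k x) * (2 * a x / (1 - a x * z)\<^sup>2)) \<partial>M)"
      unfolding G_def G'_def
      by (subst Bochner_Integration.integral_diff[OF Bochner_Integration.integrable_diff[OF I1[OF w1] I1[OF z]] integrable_mult_right[OF I2]],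
          subst Bochner_Integration.integral_diff[OF I1[OF w1] I1[OF z]], subst integral_mult_right_zero, rule refl)
    also have "\<dots> = (\<integral>x. R x \<partial>M)" by (intro Bochner_Integration.integral_cong R refl)
    finally have "cmod (G w - G z - (w - z) * G') = cmod (\<integral>x. R x \<partial>M)" by simp
    also have "\<dots> \<le> (\<integral>x. 2 / d^3 * (cmod (w - z))\<^sup>2 * \<bar>k x\<bar> \<partial>M)"
    proof (rule order.trans[OF integral_norm_bound], rule integral_mono)
      fix x assume x: "x \<in> space M"
      have den: "d * d\<^sup>2 \<le> cmod (1 - a x * w) * (cmod (1 - a x * z))\<^sup>2"
        using lower[OF x, of w] lower[OF x, of z] wd d by (intro mult_mono power_mono) (auto simp: d_def)
      have num: "2 * (cmod (a x))\<^sup>2 * (cmod (w - z))\<^sup>2 \<le> 2 * 1 * (cmod (w - z))\<^sup>2"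
        using a[OF x] by (intro mult_mono) (auto simp: power_le_one)
      have "2 * (cmod (a x))\<^sup>2 * (cmod (w - z))\<^sup>2 / (cmod (1 - a x * w) * (cmod (1 - a x * z))\<^sup>2) \<le> 2 * 1 * (cmod (w - z))\<^sup>2 / (d * d\<^sup>2)"
        using d by (intro frac_le[OF _ num _ den]) auto
      from mult_left_mono[OF this, of "\<bar>k x\<bar>"]
      have "norm (R x) \<le> \<bar>k x\<bar> * (2 * 1 * (cmod (w - z))\<^sup>2 / (d * d\<^sup>2))"
        unfolding R_def by (simp only: norm_mult norm_divide norm_power norm_of_real norm_numeral abs_ge_zero simp_thms)
      also have "\<dots> = 2 / d^3 * (cmod (w - z))\<^sup>2 * \<bar>k x\<bar>"
        by (simp add: power3_eq_cube power2_eq_square mult.commute mult.left_commute)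
      finally show "norm (R x) \<le> 2 / d^3 * (cmod (w - z))\<^sup>2 * \<bar>k x\<bar>" .
    qed (use RI k in auto)
    also have "\<dots> = C * cmod (w - z) * cmod (w - z)" by (simp add: C_def power2_eq_square)
    finally have "cmod (G w - G z - (w - z) * G') / cmod (w - z) \<le> C * cmod (w - z)"
      using w by (simp add: field_simps)
    moreover have "(G w - G z) / (w - z) - G' = (G w - G z - (w - z) * G') / (w - z)"
      using w by (simp add: field_simps)
    ultimately show ?thesis by (simp add: norm_divide)
  qed
  have "((\<lambda>w. (G w - G z) / (w - z) - G') \<longlongrightarrow> 0) (at z)"
  proof (rule Lim_null_comparison)
    show "\<forall>\<^sub>F w in at z. norm ((G w - G z) / (w - z) - G') \<le> C * cmod (w - z)"
      unfolding eventually_at using d bound by auto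
    have "((\<lambda>w. C * cmod (w - z)) \<longlongrightarrow> C * cmod (z - z)) (at z)" by (intro tendsto_intros)
    then show "((\<lambda>w. C * cmod (w - z)) \<longlongrightarrow> 0) (at z)" by simp
  qed
  then show "((\<lambda>z. \<integral>x. of_real (k x) * ((1 + a x * z) / (1 - a x * z)) \<partial>M) has_field_derivative
     (\<integral>x. of_real (k x) * (2 * a x / (1 - a x * z)\<^sup>2) \<partial>M)) (at z)"
    unfolding has_field_derivative_iff G_def[symmetric] G'_def[symmetric] by (simp add: LIM_zero_iff)
qed

subsection \<open>The potential majorizing an analytic function\<close>

lemma integral_circ_has_integral:
  fixes f :: "real \<Rightarrow> 'a::euclidean_space"
  assumes f: "continuous_on UNIV f" and I: "(f has_integral I) {0..2*pi}"
  shows "integrable circ f" "(\<integral>t. f t \<partial>circ) = I"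
proof -
  have s: "set_integrable lborel {0..2*pi} f"
    by (rule borel_integrable_atLeastAtMost') (rule continuous_on_subset[OF f], simp)
  then show "integrable circ f"
    unfolding circ_def set_integrable_def by (subst integrable_restrict_space) auto
  have "(\<integral>t. f t \<partial>circ) = set_lebesgue_integral lborel {0..2*pi} f"
    unfolding circ_def set_lebesgue_integral_def by (subst integral_restrict_space) auto
  also have "\<dots> = I" using set_borel_integral_eq_integral(2)[OF s] I by (simp add: integral_unique)
  finally show "(\<integral>t. f t \<partial>circ) = I" .
qed

lemma nn_integral_unit_int_has_integral:
  assumes "(f has_integral I) {0..1}" "\<And>s. 0 \<le> s \<Longrightarrow> s \<le> 1 \<Longrightarrow> 0 \<le> f s"
  shows "(\<integral>\<^sup>+s. ennreal (f s) \<partial>unit_int) = ennreal I"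
proof -
  have "(\<integral>\<^sup>+s. ennreal (f s) \<partial>unit_int) = (\<integral>\<^sup>+s. ennreal (f s) * indicator {0..<1} s \<partial>lborel)"
    unfolding unit_int_def by (simp add: nn_integral_restrict_space)
  also have "\<dots> = (\<integral>\<^sup>+s. ennreal (f s) * indicator {0..1} s \<partial>lborel)"
    using AE_lborel_singleton[of "1::real"]
    by (intro nn_integral_cong_AE) (auto elim!: eventually_mono simp: indicator_def)
  also have "\<dots> = ennreal I" using assms by (intro nn_integral_has_integral_lebesgue') auto
  finally show ?thesis .
qed

abbreviation polar_disc :: "(real \<times> real) measure" where
  "polar_disc \<equiv> unit_int \<Otimes>\<^sub>M circ"

text \<open>The potential is studied for any majorant \<open>b\<close> of the means of f'.
  Positivity allows |f'| to be normalized by \<open>b\<close>, and integrability of \<open>b\<close>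
  makes the potential converge.\<close>

locale derivative_majorant =
  fixes f :: "complex \<Rightarrow> complex" and p :: real and b :: "real \<Rightarrow> real"
  assumes holo: "f holomorphic_on ball 0 1" and p: "1 \<le> p"
    and b_measurable [measurable]: "b \<in> borel_measurable unit_int"
    and b_pos: "\<And>s. 0 \<le> s \<Longrightarrow> s < 1 \<Longrightarrow> 0 < b s"
    and mean_le: "\<And>s. 0 \<le> s \<Longrightarrow> s < 1 \<Longrightarrow> integral_mean p s (deriv f) \<le> b s"
    and b_finite: "(\<integral>\<^sup>+s. ennreal (b s) \<partial>unit_int) < \<infinity>"
begin

text \<open>The extension by 0 is Borel on the whole plane, which keeps measurability on the product
  space automatic.\<close>

definition g :: "complex \<Rightarrow> complex" where "g z = (if z \<in> ball 0 1 then deriv f z else 0)"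

text \<open>The measure |f'| dA / pi in polar coordinates, \<open>fst x\<close> being the area
  element. \<open>node\<close> is the conjugate of the same point, so \<open>F\<close> below is the
  potential of the overview.\<close>

definition dens :: "real \<times> real \<Rightarrow> real" where
  "dens x = fst x / pi * cmod (g (of_real (fst x) * cis (snd x)))"

definition node :: "real \<times> real \<Rightarrow> complex" where
  "node x = of_real (fst x) * cis (- snd x)"

definition F :: "complex \<Rightarrow> complex" where
  "F z = of_real (cmod (f 0)) +
     (\<integral>x. of_real (dens x) * ((1 + node x * z) / (1 - node x * z)) \<partial>polar_disc)"

text \<open>The boundary values of Re F, written as an integral instead of a radial limit. At
  exceptional boundary points where the integrand is not integrable, the integral has the default
  value 0, so \<open>bdry\<close> remains non-negative on the whole circle.\<close>

definition bdry :: "complex \<Rightarrow> real" where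
  "bdry w = cmod (f 0) + (\<integral>x. dens x * Re ((1 + node x * w) / (1 - node x * w)) \<partial>polar_disc)"

lemma holo_deriv: "deriv f holomorphic_on ball 0 1"
  by (intro holomorphic_deriv holo) auto

lemma g_measurable [measurable]: "g \<in> borel_measurable borel"
proof -
  have "(\<lambda>z. if z \<in> ball 0 1 then deriv f z else 0) \<in> borel_measurable borel"
    by (intro borel_measurable_continuous_on_if holomorphic_on_imp_continuous_on holo_deriv continuous_on_const) auto
  then show ?thesis unfolding g_def[abs_def] .
qed

lemma g_eq: "0 \<le> s \<Longrightarrow> s < 1 \<Longrightarrow> g (of_real s * cis t) = deriv f (of_real s * cis t)"
  by (simp add: g_def norm_mult)

lemma dens_measurable [measurable]: "dens \<in> borel_measurable polar_disc"
  unfolding dens_def[abs_def] by measurable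

lemma node_measurable [measurable]: "node \<in> borel_measurable polar_disc"
  unfolding node_def[abs_def] by measurable

lemma space_polar_disc: "x \<in> space polar_disc \<longleftrightarrow> 0 \<le> fst x \<and> fst x < 1 \<and> 0 \<le> snd x \<and> snd x \<le> 2*pi"
  by (cases x) (auto simp: space_pair_measure)

lemma cmod_node: "x \<in> space polar_disc \<Longrightarrow> cmod (node x) = fst x"
  by (simp add: node_def norm_mult space_polar_disc)

lemma dens_nonneg: "x \<in> space polar_disc \<Longrightarrow> 0 \<le> dens x"
  by (simp add: dens_def space_polar_disc)

lemma cmod_one_minus_node: "cmod (1 - node x * z) = cmod (cis (snd x) - of_real (fst x) * z)"
proof -
  have "1 - node x * z = cis (- snd x) * (cis (snd x) - of_real (fst x) * z)"
    by (simp add: node_def algebra_simps cis_mult)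
  then show ?thesis by (simp add: norm_mult)
qed

lemma nn_integral_g_powr:
  assumes "0 \<le> s" "s < 1"
  shows "(\<integral>\<^sup>+t. ennreal (cmod (g (of_real s * cis t)) powr p) \<partial>circ) \<le> ennreal (2*pi * b s powr p)"
proof -
  have "(\<integral>\<^sup>+t. ennreal (cmod (g (of_real s * cis t)) powr p) \<partial>circ) = ennreal (2*pi * integral_mean p s (deriv f) powr p)"
    unfolding g_eq[OF assms] using p assms
    by (intro nn_integral_powr_eq_integral_mean continuous_on_circle_of_holomorphic holo_deriv) auto
  also have "\<dots> \<le> ennreal (2*pi * b s powr p)"
    using mean_le[OF assms] p by (intro ennreal_leI mult_left_mono powr_mono2 integral_mean_nonneg) auto
  finally show ?thesis .
qed

lemma nn_integral_ratio_powr: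
  assumes "0 \<le> s" "s < 1"
  shows "(\<integral>\<^sup>+t. ennreal ((cmod (g (of_real s * cis t)) / b s) powr p) \<partial>circ) \<le> ennreal (2*pi)"
proof -
  have "(\<integral>\<^sup>+t. ennreal ((cmod (g (of_real s * cis t)) / b s) powr p) \<partial>circ)
      = (\<integral>\<^sup>+t. ennreal (1 / b s powr p) * ennreal (cmod (g (of_real s * cis t)) powr p) \<partial>circ)"
    using b_pos[OF assms] by (intro nn_integral_cong) (simp add: powr_divide flip: ennreal_mult)
  also have "\<dots> = ennreal (1 / b s powr p) * (\<integral>\<^sup>+t. ennreal (cmod (g (of_real s * cis t)) powr p) \<partial>circ)"
    by (rule nn_integral_cmult) measurable
  also have "\<dots> \<le> ennreal (1 / b s powr p) * ennreal (2*pi * b s powr p)"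
    by (intro mult_left_mono nn_integral_g_powr assms) auto
  also have "\<dots> = ennreal (2*pi)" using b_pos[OF assms] by (simp flip: ennreal_mult)
  finally show ?thesis .
qed

text \<open>With u = |f'| / b, the bound u <= 1 + u^p replaces Hoelder's inequality: on each circle
  1 and u^p both integrate to at most 2 pi, which leaves 4 pi times the integral of
  \<open>b\<close>.\<close>

lemma dens_integrable: "integrable polar_disc dens"
proof (rule integrableI_bounded)
  define v where "v x = (cmod (g (of_real (fst x) * cis (snd x))) / b (fst x)) powr p" for x
  have [measurable]: "v \<in> borel_measurable polar_disc"
    unfolding v_def[abs_def] by (rule powr_real_measurable) measurable
  have "(\<integral>\<^sup>+x. ennreal (norm (dens x)) \<partial>polar_disc)
      \<le> (\<integral>\<^sup>+x. ennreal (b (fst x)) * (1 + ennreal (v x)) \<partial>polar_disc)"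
  proof (intro nn_integral_mono)
    fix x assume x: "x \<in> space polar_disc"
    then have s: "0 \<le> fst x" "fst x < 1" by (auto simp: space_polar_disc)
    define u where "u = cmod (g (of_real (fst x) * cis (snd x))) / b (fst x)"
    note b0 = b_pos[OF s]
    have u: "u \<ge> 0" using b0 by (simp add: u_def)
    have "u \<le> 1 + u powr p"
    proof (cases "u \<le> 1")
      case False
      then have "u powr 1 \<le> u powr p" using p by (intro powr_mono) auto
      then show ?thesis using False by simp
    qed (simp add: add_increasing2)
    moreover have "fst x / pi \<le> 1" using s pi_gt3 by simp
    then have "dens x \<le> 1 * cmod (g (of_real (fst x) * cis (snd x)))"
      unfolding dens_def by (intro mult_right_mono) auto
    moreover have "cmod (g (of_real (fst x) * cis (snd x))) = b (fst x) * u" using b0 by (simp add: u_def)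
    ultimately have "dens x \<le> b (fst x) * (1 + u powr p)"
      using order.trans[OF _ mult_left_mono[of u "1 + u powr p" "b (fst x)"]] b0 by simp
    then have "ennreal (norm (dens x)) \<le> ennreal (b (fst x) * (1 + u powr p))"
      using dens_nonneg[OF x] by (intro ennreal_leI) simp
    also have "\<dots> = ennreal (b (fst x)) * (1 + ennreal (u powr p))"
      using b0 by (simp add: ennreal_mult ennreal_plus flip: ennreal_1)
    finally show "ennreal (norm (dens x)) \<le> ennreal (b (fst x)) * (1 + ennreal (v x))"
      unfolding u_def v_def .
  qed
  also have "\<dots> = (\<integral>\<^sup>+s. \<integral>\<^sup>+t. ennreal (b s) * (1 + ennreal ((cmod (g (of_real s * cis t)) / b s) powr p)) \<partial>circ \<partial>unit_int)"
    by (rule trans[OF circ.nn_integral_fst[symmetric]]) (measurable, simp add: v_def)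
  also have "\<dots> \<le> (\<integral>\<^sup>+s. ennreal (4*pi) * ennreal (b s) \<partial>unit_int)"
  proof (intro nn_integral_mono)
    fix s assume "s \<in> space unit_int"
    then have s: "0 \<le> s" "s < 1" by auto
    have "(\<integral>\<^sup>+t. ennreal (b s) * (1 + ennreal ((cmod (g (of_real s * cis t)) / b s) powr p)) \<partial>circ)
      = ennreal (b s) * (\<integral>\<^sup>+t. 1 + ennreal ((cmod (g (of_real s * cis t)) / b s) powr p) \<partial>circ)"
      by (rule nn_integral_cmult) measurable
    also have "(\<integral>\<^sup>+t. 1 + ennreal ((cmod (g (of_real s * cis t)) / b s) powr p) \<partial>circ)
        = ennreal (2*pi) + (\<integral>\<^sup>+t. ennreal ((cmod (g (of_real s * cis t)) / b s) powr p) \<partial>circ)"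
      using emeasure_circ by (subst nn_integral_add) auto
    also have "ennreal (b s) * \<dots> \<le> ennreal (b s) * (ennreal (2*pi) + ennreal (2*pi))"
      by (intro mult_left_mono add_left_mono nn_integral_ratio_powr s) auto
    also have "\<dots> = ennreal (4*pi) * ennreal (b s)" by (simp add: mult.commute flip: ennreal_plus)
    finally show "(\<integral>\<^sup>+t. ennreal (b s) * (1 + ennreal ((cmod (g (of_real s * cis t)) / b s) powr p)) \<partial>circ) \<le> ennreal (4*pi) * ennreal (b s)" .
  qed
  also have "\<dots> = ennreal (4*pi) * (\<integral>\<^sup>+s. ennreal (b s) \<partial>unit_int)"
    by (rule nn_integral_cmult) measurable
  also have "\<dots> < \<infinity>" using b_finite by (simp add: ennreal_mult_less_top)
  finally show "(\<integral>\<^sup>+x. ennreal (norm (dens x)) \<partial>polar_disc) < \<infinity>" .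
qed measurable

lemma node_le: "x \<in> space polar_disc \<Longrightarrow> cmod (node x) \<le> 1"
  using cmod_node[of x] by (simp add: space_polar_disc)

lemma F_has_field_derivative:
  assumes "cmod z < 1"
  shows "(F has_field_derivative (\<integral>x. of_real (dens x) * (2 * node x / (1 - node x * z)\<^sup>2) \<partial>polar_disc)) (at z)"
  unfolding F_def[abs_def]
  using DERIV_add[OF DERIV_const has_field_derivative_Cayley_integral(1)[OF dens_integrable node_measurable node_le assms]]
  by simp

lemma F_holomorphic: "F holomorphic_on ball 0 1"
  unfolding holomorphic_on_open[OF open_ball]
proof
  fix z :: complex assume "z \<in> ball 0 1"
  then show "\<exists>f'. (F has_field_derivative f') (at z)"
    using F_has_field_derivative[of z] by (simp only: mem_ball_0) blast
qed

lemma Re_Cayley_node: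
  assumes "x \<in> space polar_disc" "cmod z \<le> 1"
  shows "Re ((1 + node x * z) / (1 - node x * z)) = (1 - (fst x * cmod z)\<^sup>2) / (cmod (cis (snd x) - of_real (fst x) * z))\<^sup>2"
    and "0 \<le> Re ((1 + node x * z) / (1 - node x * z))"
proof -
  have "cmod (node x) < 1" using assms cmod_node[of x] by (simp add: space_polar_disc)
  then have nz: "1 - node x * z \<noteq> 0"
    using one_minus_mult_nz[of z "node x"] assms(2) by (simp add: mult.commute)
  show e: "Re ((1 + node x * z) / (1 - node x * z)) = (1 - (fst x * cmod z)\<^sup>2) / (cmod (cis (snd x) - of_real (fst x) * z))\<^sup>2"
    unfolding Re_Cayley[OF nz] cmod_one_minus_node norm_mult cmod_node[OF assms(1)] ..
  have "fst x * cmod z \<le> 1" using assms by (intro mult_le_one) (auto simp: space_polar_disc)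
  then have "(fst x * cmod z)\<^sup>2 \<le> 1" using assms by (intro power_le_one) (auto simp: space_polar_disc)
  then show "0 \<le> Re ((1 + node x * z) / (1 - node x * z))"
    unfolding e by (intro divide_nonneg_nonneg) auto
qed

lemma cmod_le_Re_F:
  assumes z: "cmod z < 1"
  shows "cmod (f z) \<le> Re (F z)"
proof -
  have zz: "cmod (of_real (s\<^sup>2) * z) < 1" if "0 \<le> s" "s \<le> 1" for s :: real
  proof -
    have "s\<^sup>2 * cmod z \<le> 1 * cmod z" using that by (intro mult_right_mono power_le_one) auto
    then show ?thesis using z by (simp add: norm_mult norm_power)
  qed
  \<comment> \<open>The derivative of s -> f(s^2 z). Below, s^2 z is read as s (s z), the point s z
    of the unit disc scaled to the circle of radius s.\<close>
  define h where "h s = of_real (2 * s) * z * deriv f (of_real (s\<^sup>2) * z)" for s :: real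
  have "(h has_integral f (of_real (1\<^sup>2) * z) - f (of_real (0\<^sup>2) * z)) {0..1}"
  proof (rule fundamental_theorem_of_calculus)
    fix s :: real assume "s \<in> {0..1}"
    then have "cmod (of_real (s\<^sup>2) * z) < 1" using zz by auto
    then have df: "(f has_field_derivative deriv f (of_real (s\<^sup>2) * z)) (at (of_real (s\<^sup>2) * z))"
      by (intro holomorphic_derivI[OF holo]) auto
    have "((\<lambda>s. of_real (s\<^sup>2) * z) has_vector_derivative of_real (2 * s) * z) (at s within {0..1})"
      by (auto intro!: derivative_eq_intros has_vector_derivative_real_field simp: has_vector_derivative_def fun_eq_iff scaleR_conv_of_real)
    from field_vector_diff_chain_within[OF this DERIV_subset[OF df]]
    show "((\<lambda>s. f (of_real (s\<^sup>2) * z)) has_vector_derivative h s) (at s within {0..1})"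
      by (simp add: h_def o_def)
  qed simp
  then have hI: "(h has_integral f z - f 0) {0..1}" by simp
  have ch: "continuous_on {0..1} h" unfolding h_def
    by (intro continuous_intros continuous_on_compose2[OF holomorphic_on_imp_continuous_on[OF holo_deriv]])
      (use zz in auto)
  have "(\<lambda>s. cmod (h s)) integrable_on {0..1}" by (intro integrable_continuous_interval continuous_intros ch)
  then obtain J where J: "((\<lambda>s. cmod (h s)) has_integral J) {0..1}" by blast
  have "cmod (integral {0..1} h) \<le> integral {0..1} (\<lambda>s. cmod (h s))"
    using hI J by (intro Henstock_Kurzweil_Integration.integral_norm_bound_integral) auto
  then have le: "cmod (f z - f 0) \<le> J" using hI J by (simp add: integral_unique)
  define P where "P x = Re ((1 + node x * z) / (1 - node x * z))" for x
  have Re_mult: "Re (of_real c * w) = c * Re w" for c w by simp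
  have ReF: "Re (F z) = cmod (f 0) + (\<integral>x. dens x * P x \<partial>polar_disc)"
    using has_field_derivative_Cayley_integral(2)[OF dens_integrable node_measurable node_le z z]
    by (simp only: F_def P_def plus_complex.sel Re_complex_of_real integral_Re[symmetric] Re_mult)
  have intP: "integrable polar_disc (\<lambda>x. dens x * P x)"
    using integrable_Re[OF has_field_derivative_Cayley_integral(2)[OF dens_integrable node_measurable node_le z z]]
    by (simp only: P_def Re_mult)
  have [measurable]: "P \<in> borel_measurable polar_disc" unfolding P_def[abs_def] by measurable
  have Pn: "0 \<le> dens x * P x" if "x \<in> space polar_disc" for x
    using dens_nonneg[OF that] Re_Cayley_node(2)[OF that less_imp_le[OF z]] by (simp add: P_def)
  have "ennreal (cmod (f z - f 0)) \<le> ennreal J" using le by (rule ennreal_leI)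
  also have "\<dots> = (\<integral>\<^sup>+s. ennreal (cmod (h s)) \<partial>unit_int)"
    by (rule nn_integral_unit_int_has_integral[OF J, symmetric]) auto
  also have "\<dots> \<le> (\<integral>\<^sup>+s. \<integral>\<^sup>+t. ennreal (dens (s, t) * P (s, t)) \<partial>circ \<partial>unit_int)"
  proof (intro nn_integral_mono)
    fix s assume "s \<in> space unit_int"
    then have s: "0 \<le> s" "s < 1" by auto
    have sw: "s * cmod w < 1" if "cmod w \<le> 1" for w
      using mult_left_le[OF that, of s] s by linarith
    have hs: "(\<lambda>w. deriv f (of_real s * w)) holomorphic_on ball 0 1"
      by (intro holomorphic_on_compose_gen[OF _ holo_deriv, unfolded o_def] holomorphic_intros)
        (use s in \<open>auto simp: norm_mult sw\<close>)
    have cs: "continuous_on (cball 0 1) (\<lambda>w. deriv f (of_real s * w))"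
      by (intro continuous_on_compose2[OF holomorphic_on_imp_continuous_on[OF holo_deriv]] continuous_intros)
        (use s in \<open>auto simp: norm_mult sw\<close>)
    have sz: "cmod (of_real s * z) < 1" using sw[of z] z s by (simp add: norm_mult)
    have "cmod (h s) \<le> 2 * s * cmod (deriv f (of_real s * (of_real s * z)))"
    proof -
      have "cmod (h s) = 2 * s * cmod (deriv f (of_real s * (of_real s * z))) * cmod z"
        using s by (simp add: h_def norm_mult power2_eq_square mult_ac)
      also have "\<dots> \<le> 2 * s * cmod (deriv f (of_real s * (of_real s * z)))"
        using s z by (intro mult_left_le) auto
      finally show ?thesis .
    qed
    then have "ennreal (cmod (h s)) \<le> ennreal (2 * s) * ennreal (cmod (deriv f (of_real s * (of_real s * z))))"
      using s by (simp add: ennreal_leI flip: ennreal_mult)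
    also have "\<dots> \<le> ennreal (2 * s) * (\<integral>\<^sup>+t. ennreal ((1 - (cmod (of_real s * z))\<^sup>2) / (2*pi) / (cmod (cis t - of_real s * z))\<^sup>2) * ennreal (cmod (deriv f (of_real s * cis t))) \<partial>circ)"
      by (intro mult_left_mono norm_le_Poisson[OF cs hs sz]) auto
    also have "\<dots> = (\<integral>\<^sup>+t. ennreal (2 * s) * (ennreal ((1 - (cmod (of_real s * z))\<^sup>2) / (2*pi) / (cmod (cis t - of_real s * z))\<^sup>2) * ennreal (cmod (g (of_real s * cis t)))) \<partial>circ)"
      unfolding g_eq[OF s, symmetric] by (rule nn_integral_cmult[symmetric]) measurable
    also have "\<dots> = (\<integral>\<^sup>+t. ennreal (dens (s, t) * P (s, t)) \<partial>circ)"
    proof (intro nn_integral_cong)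
      fix t assume "t \<in> space circ"
      then have x: "(s, t) \<in> space polar_disc" using s by (simp add: space_polar_disc)
      have "(s * cmod z)\<^sup>2 \<le> 1" using sw[of z] z s by (intro power_le_one) auto
      define c where "c = (1 - (s * cmod z)\<^sup>2) / (2*pi) / (cmod (cis t - of_real s * z))\<^sup>2"
      have c: "0 \<le> c" using \<open>(s * cmod z)\<^sup>2 \<le> 1\<close> by (simp add: c_def)
      \<comment> \<open>The 2s of the chain rule and the 1 / (2 pi) of Poisson's formula combine to
        the factor s / pi in \<open>dens\<close>.\<close>
      have "dens (s, t) * P (s, t) = 2 * s * (c * cmod (g (of_real s * cis t)))"
        unfolding P_def Re_Cayley_node(1)[OF x less_imp_le[OF z]] by (simp add: dens_def c_def)
      moreover have "ennreal (2 * s * (c * cmod (g (of_real s * cis t)))) = ennreal (2 * s) * (ennreal c * ennreal (cmod (g (of_real s * cis t))))"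
        using s c by (simp add: ennreal_mult)
      moreover have "cmod (of_real s * z) = s * cmod z" using s by (simp add: norm_mult)
      ultimately show "ennreal (2 * s) * (ennreal ((1 - (cmod (of_real s * z))\<^sup>2) / (2*pi) / (cmod (cis t - of_real s * z))\<^sup>2) * ennreal (cmod (g (of_real s * cis t)))) = ennreal (dens (s, t) * P (s, t))"
        by (simp only: c_def)
    qed
    finally show "ennreal (cmod (h s)) \<le> (\<integral>\<^sup>+t. ennreal (dens (s, t) * P (s, t)) \<partial>circ)" .
  qed
  also have "\<dots> = (\<integral>\<^sup>+x. ennreal (dens x * P x) \<partial>polar_disc)"
    by (rule circ.nn_integral_fst) measurable
  also have "\<dots> = ennreal (\<integral>x. dens x * P x \<partial>polar_disc)"
    by (intro nn_integral_eq_integral intP AE_I2 Pn)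
  finally have "cmod (f z - f 0) \<le> (\<integral>x. dens x * P x \<partial>polar_disc)"
    by (subst (asm) ennreal_le_iff) (auto intro!: integral_nonneg_AE AE_I2 Pn)
  moreover have "cmod (f z) \<le> cmod (f 0) + cmod (f z - f 0)"
    using norm_triangle_ineq[of "f 0" "f z - f 0"] by simp
  ultimately show ?thesis unfolding ReF by simp
qed

text \<open>
  Normalizing \<open>\<bar>f'\<bar>\<close> by \<open>b\<close> lets a single application of Jensen's inequality replace Minkowski's integral
  inequality.
\<close>

lemma integral_mean_deriv_F:
  assumes r: "0 \<le> r" "r < 1" and A: "0 < A"
    and le: "(\<integral>\<^sup>+s. ennreal (4 * b s / (1 - s * r)) \<partial>unit_int) \<le> ennreal A"
  shows "integral_mean p r (deriv F) \<le> A"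
proof -
  \<comment> \<open>The modulus of the kernel of F' after writing |f'| = b u. The factor
    \<open>b\<close> goes into the kernel, and the Schur test acts on \<open>u\<close>, whose p-th
    mean on every circle is at most 1.\<close>
  define W where "W \<theta> x = ennreal (2 * (fst x)\<^sup>2 / pi * b (fst x) / (cmod (cis (snd x) - of_real (fst x * r) * cis \<theta>))\<^sup>2)"
    for \<theta> :: real and x :: "real \<times> real"
  define u where "u x = cmod (g (of_real (fst x) * cis (snd x))) / b (fst x)" for x :: "real \<times> real"
  define k where "k s = 4 * s\<^sup>2 * b s / (1 - (s * r)\<^sup>2)" for s
  have [measurable]: "u \<in> borel_measurable polar_disc" unfolding u_def[abs_def] by measurable
  have [measurable]: "k \<in> borel_measurable unit_int" unfolding k_def[abs_def] by measurable
  have Wm [measurable]: "case_prod W \<in> borel_measurable (circ \<Otimes>\<^sub>M polar_disc)"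
    unfolding W_def[abs_def] by measurable
  have sr: "s * r < 1" "0 \<le> s * r" "1 - (s * r)\<^sup>2 > 0" if s: "0 \<le> s" "s < 1" for s
  proof -
    show a: "s * r < 1" using mult_left_le[of r s] s r by linarith
    show b: "0 \<le> s * r" using s r by simp
    show "1 - (s * r)\<^sup>2 > 0" using a b by (simp add: power_less_one_iff)
  qed
  have kernel: "(\<integral>\<^sup>+t. ennreal (2 * s\<^sup>2 / pi * b s / (cmod (cis t - of_real (s * r) * cis \<theta>))\<^sup>2) \<partial>circ) = ennreal (k s)"
    if s: "0 \<le> s" "s < 1" for s \<theta>
  proof -
    have nrm: "cmod (of_real (s * r) * cis \<theta>) = s * r"
      by (simp only: norm_mult norm_of_real norm_cis abs_of_nonneg[OF sr(2)[OF s]] mult_1_right)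
    have "(\<integral>\<^sup>+t. ennreal (2 * s\<^sup>2 / pi * b s / (cmod (cis t - of_real (s * r) * cis \<theta>))\<^sup>2) \<partial>circ)
      = (\<integral>\<^sup>+t. ennreal (2 * s\<^sup>2 / pi * b s) * ennreal (1 / (cmod (cis t - of_real (s * r) * cis \<theta>))\<^sup>2) \<partial>circ)"
      using s b_pos[OF s] by (simp flip: ennreal_mult)
    also have "\<dots> = ennreal (2 * s\<^sup>2 / pi * b s) * (\<integral>\<^sup>+t. ennreal (1 / (cmod (cis t - of_real (s * r) * cis \<theta>))\<^sup>2) \<partial>circ)"
      by (rule nn_integral_cmult) measurable
    also have "(\<integral>\<^sup>+t. ennreal (1 / (cmod (cis t - of_real (s * r) * cis \<theta>))\<^sup>2) \<partial>circ) = ennreal (2*pi / (1 - (s * r)\<^sup>2))"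
      using nn_integral_Poisson_kernel[of "of_real (s * r) * cis \<theta>"] sr(1)[OF s] by (simp only: nrm)
    also have "ennreal (2 * s\<^sup>2 / pi * b s) * ennreal (2*pi / (1 - (s * r)\<^sup>2)) = ennreal (2 * s\<^sup>2 / pi * b s * (2*pi / (1 - (s * r)\<^sup>2)))"
      using s b_pos[OF s] sr[OF s] by (intro ennreal_mult[symmetric]) auto
    also have "2 * s\<^sup>2 / pi * b s * (2*pi / (1 - (s * r)\<^sup>2)) = k s" by (simp add: k_def)
    finally show ?thesis .
  qed
  have kA: "(\<integral>\<^sup>+s. ennreal (k s) \<partial>unit_int) \<le> ennreal A"
  proof (rule order.trans[OF nn_integral_mono le])
    fix s assume "s \<in> space unit_int"
    then have s: "0 \<le> s" "s < 1" by auto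
    have "4 * s\<^sup>2 * b s \<le> 4 * 1 * b s"
      using s b_pos[OF s] by (intro mult_right_mono mult_left_mono power_le_one) auto
    moreover have "1 - s * r \<le> 1 - (s * r)\<^sup>2"
      using sr[OF s] by (simp add: power2_eq_square mult_left_le)
    ultimately have "k s \<le> 4 * b s / (1 - s * r)"
      unfolding k_def using b_pos[OF s] sr[OF s] by (intro frac_le) auto
    then show "ennreal (k s) \<le> ennreal (4 * b s / (1 - s * r))" by (rule ennreal_leI)
  qed
  have "(\<integral>\<^sup>+\<theta>. ennreal (cmod (deriv F (of_real r * cis \<theta>)) powr p) \<partial>circ)
     \<le> ennreal (A powr (p - 1)) * (\<integral>\<^sup>+x. ennreal (u x powr p) * (\<integral>\<^sup>+\<theta>. W \<theta> x \<partial>circ) \<partial>polar_disc)"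
  proof (intro cu.Schur_test_powr p A Wm)
    fix x assume "x \<in> space polar_disc"
    then show "0 \<le> u x" using b_pos[of "fst x"] by (simp add: u_def space_polar_disc)
  next
    fix \<theta>
    have "(\<integral>\<^sup>+x. W \<theta> x \<partial>polar_disc) = (\<integral>\<^sup>+s. \<integral>\<^sup>+t. W \<theta> (s, t) \<partial>circ \<partial>unit_int)"
      unfolding W_def by (rule circ.nn_integral_fst[symmetric]) measurable
    also have "\<dots> = (\<integral>\<^sup>+s. ennreal (k s) \<partial>unit_int)"
      unfolding W_def fst_conv snd_conv by (intro nn_integral_cong kernel) auto
    finally show "(\<integral>\<^sup>+x. W \<theta> x \<partial>polar_disc) \<le> ennreal A" using kA by simp
    define z where "z = of_real r * cis \<theta>"
    have z: "cmod z < 1" using r by (simp add: z_def norm_mult)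
    have "ennreal (cmod (deriv F z)) = ennreal (cmod (\<integral>x. of_real (dens x) * (2 * node x / (1 - node x * z)\<^sup>2) \<partial>polar_disc))"
      using DERIV_imp_deriv[OF F_has_field_derivative[OF z]] by simp
    also have "\<dots> \<le> (\<integral>\<^sup>+x. ennreal (cmod (of_real (dens x) * (2 * node x / (1 - node x * z)\<^sup>2))) \<partial>polar_disc)"
      by (rule integral_norm_bound_ennreal)
        (rule has_field_derivative_Cayley_integral(3)[OF dens_integrable node_measurable node_le z])
    also have "\<dots> = (\<integral>\<^sup>+x. W \<theta> x * ennreal (u x) \<partial>polar_disc)"
    proof (intro nn_integral_cong)
      fix x assume x: "x \<in> space polar_disc"
      then have s: "0 \<le> fst x" "fst x < 1" by (auto simp: space_polar_disc)
      have "cmod (of_real (dens x) * (2 * node x / (1 - node x * z)\<^sup>2))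
          = dens x * (2 * fst x / (cmod (cis (snd x) - of_real (fst x) * z))\<^sup>2)"
        using dens_nonneg[OF x] cmod_node[OF x]
        by (simp add: norm_mult norm_divide norm_power cmod_one_minus_node)
      also have "\<dots> = 2 * (fst x)\<^sup>2 / pi * b (fst x) / (cmod (cis (snd x) - of_real (fst x * r) * cis \<theta>))\<^sup>2 * u x"
        using b_pos[OF s] by (simp add: dens_def u_def z_def power2_eq_square mult_ac)
      also have "ennreal \<dots> = W \<theta> x * ennreal (u x)"
        unfolding W_def using b_pos[OF s] by (intro ennreal_mult) (auto simp: u_def)
      finally show "ennreal (cmod (of_real (dens x) * (2 * node x / (1 - node x * z)\<^sup>2))) = W \<theta> x * ennreal (u x)" .
    qed
    finally show "ennreal (cmod (deriv F (of_real r * cis \<theta>))) \<le> (\<integral>\<^sup>+x. W \<theta> x * ennreal (u x) \<partial>polar_disc)"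
      by (simp add: z_def)
  qed auto
  \<comment> \<open>By symmetry in the angles the column mass is again \<open>k\<close> of the
    radius. So u^p can be integrated over each circle first, leaving 2 pi times the integral of
    \<open>k\<close>; together with A^(p-1) this makes 2 pi A^p.\<close>
  also have "(\<integral>\<^sup>+x. ennreal (u x powr p) * (\<integral>\<^sup>+\<theta>. W \<theta> x \<partial>circ) \<partial>polar_disc)
      = (\<integral>\<^sup>+x. ennreal (u x powr p) * ennreal (k (fst x)) \<partial>polar_disc)"
  proof (intro nn_integral_cong)
    fix x assume x: "x \<in> space polar_disc"
    then have s: "0 \<le> fst x" "fst x < 1" by (auto simp: space_polar_disc)
    have "(\<integral>\<^sup>+\<theta>. W \<theta> x \<partial>circ) = ennreal (k (fst x))"
      unfolding W_def by (subst cmod_cis_diff_swap) (rule kernel[OF s])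
    then show "ennreal (u x powr p) * (\<integral>\<^sup>+\<theta>. W \<theta> x \<partial>circ) = ennreal (u x powr p) * ennreal (k (fst x))" by simp
  qed
  also have "\<dots> = (\<integral>\<^sup>+s. \<integral>\<^sup>+t. ennreal (u (s, t) powr p) * ennreal (k s) \<partial>circ \<partial>unit_int)"
  proof (rule trans[OF circ.nn_integral_fst[symmetric]])
    have "(\<lambda>x. u x powr p) \<in> borel_measurable polar_disc" by (rule powr_real_measurable) measurable
    from measurable_compose[OF this measurable_ennreal]
    show "(\<lambda>x. ennreal (u x powr p) * ennreal (k (fst x))) \<in> borel_measurable polar_disc"
      by (rule borel_measurable_times_ennreal) measurable
  qed simp
  also have "\<dots> \<le> (\<integral>\<^sup>+s. ennreal (2*pi) * ennreal (k s) \<partial>unit_int)"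
  proof (intro nn_integral_mono)
    fix s assume "s \<in> space unit_int"
    then have s: "0 \<le> s" "s < 1" by auto
    have "(\<integral>\<^sup>+t. ennreal (u (s, t) powr p) * ennreal (k s) \<partial>circ) = (\<integral>\<^sup>+t. ennreal (u (s, t) powr p) \<partial>circ) * ennreal (k s)"
      unfolding u_def fst_conv snd_conv by (rule nn_integral_multc) measurable
    also have "\<dots> \<le> ennreal (2*pi) * ennreal (k s)"
      using nn_integral_ratio_powr[OF s] by (intro mult_right_mono) (auto simp: u_def)
    finally show "(\<integral>\<^sup>+t. ennreal (u (s, t) powr p) * ennreal (k s) \<partial>circ) \<le> ennreal (2*pi) * ennreal (k s)" .
  qed
  also have "\<dots> = ennreal (2*pi) * (\<integral>\<^sup>+s. ennreal (k s) \<partial>unit_int)"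
    by (rule nn_integral_cmult) measurable
  also have "\<dots> \<le> ennreal (2*pi) * ennreal A" by (intro mult_left_mono kA) auto
  finally have "(\<integral>\<^sup>+\<theta>. ennreal (cmod (deriv F (of_real r * cis \<theta>)) powr p) \<partial>circ)
     \<le> ennreal (A powr (p - 1)) * (ennreal (2*pi) * ennreal A)"
    by (simp add: mult_left_mono)
  also have "\<dots> = ennreal (2*pi * A powr p)"
    using A by (simp add: powr_diff flip: ennreal_mult)
  finally show ?thesis
    using p A r by (intro integral_mean_leI continuous_on_circle_of_holomorphic holomorphic_deriv F_holomorphic) auto
qed

lemma bdry_nonneg: "0 \<le> bdry (cis t)"
  unfolding bdry_def
  by (intro add_nonneg_nonneg integral_nonneg_AE AE_I2 mult_nonneg_nonneg dens_nonneg Re_Cayley_node(2)) auto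

lemma bdry_measurable [measurable]: "(\<lambda>t. bdry (cis t)) \<in> borel_measurable borel"
  unfolding bdry_def by measurable

text \<open>The case z = 0 of the Schwarz formula, in which the Schwarz kernel is 1.\<close>

lemma Poisson_node_integral:
  assumes x: "x \<in> space polar_disc"
  shows "(\<integral>\<^sup>+t. ennreal (Re ((1 + node x * cis t) / (1 - node x * cis t))) \<partial>circ) = ennreal (2*pi)"
proof -
  have a: "cmod (node x) < 1" using x cmod_node[of x] by (simp add: space_polar_disc)
  have "((\<lambda>t. (cis t + 0) / (cis t - 0) * of_real (Re ((1 + node x * cis t) / (1 - node x * cis t))))
           has_integral of_real (2*pi) * ((1 + node x * 0) / (1 - node x * 0))) {0..2*pi}"
    by (rule Schwarz_formula_Cayley[OF a]) simp
  from has_integral_Re[OF this]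
  have "((\<lambda>t. Re ((1 + node x * cis t) / (1 - node x * cis t))) has_integral 2*pi) {0..2*pi}" by simp
  then show ?thesis
    by (intro nn_integral_circ_has_integral Re_Cayley_node(2)[OF x]) auto
qed

text \<open>On the boundary the kernel is unbounded as the radius of \<open>x\<close> tends to 1.
  Integrating over the boundary angle first gives the mass 2 pi for each x, so integrability of
  \<open>dens\<close> suffices.\<close>

lemma bdry_kernel_integrable:
  "integrable (circ \<Otimes>\<^sub>M polar_disc) (\<lambda>(t, x). dens x * Re ((1 + node x * cis t) / (1 - node x * cis t)))"
proof (rule integrableI_bounded)
  define Q where "Q = (\<lambda>(t, x). dens x * Re ((1 + node x * cis t) / (1 - node x * cis t)))"
  have [measurable]: "Q \<in> borel_measurable (circ \<Otimes>\<^sub>M polar_disc)" unfolding Q_def by measurable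
  have "(\<integral>\<^sup>+y. ennreal (norm (Q y)) \<partial>(circ \<Otimes>\<^sub>M polar_disc)) = (\<integral>\<^sup>+x. \<integral>\<^sup>+t. ennreal (norm (Q (t, x))) \<partial>circ \<partial>polar_disc)"
    by (rule cu.nn_integral_snd[symmetric]) measurable
  also have "\<dots> = (\<integral>\<^sup>+x. ennreal (2*pi) * ennreal (dens x) \<partial>polar_disc)"
  proof (intro nn_integral_cong)
    fix x assume x: "x \<in> space polar_disc"
    have "(\<integral>\<^sup>+t. ennreal (norm (Q (t, x))) \<partial>circ)
      = (\<integral>\<^sup>+t. ennreal (dens x) * ennreal (Re ((1 + node x * cis t) / (1 - node x * cis t))) \<partial>circ)"
      using dens_nonneg[OF x] Re_Cayley_node(2)[OF x] by (intro nn_integral_cong) (simp add: Q_def abs_mult flip: ennreal_mult)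
    also have "\<dots> = ennreal (dens x) * (\<integral>\<^sup>+t. ennreal (Re ((1 + node x * cis t) / (1 - node x * cis t))) \<partial>circ)"
      by (rule nn_integral_cmult) measurable
    finally show "(\<integral>\<^sup>+t. ennreal (norm (Q (t, x))) \<partial>circ) = ennreal (2*pi) * ennreal (dens x)"
      unfolding Poisson_node_integral[OF x] by (simp add: mult.commute)
  qed
  also have "\<dots> = ennreal (2*pi) * (\<integral>\<^sup>+x. ennreal (dens x) \<partial>polar_disc)"
    by (rule nn_integral_cmult) measurable
  also have "(\<integral>\<^sup>+x. ennreal (dens x) \<partial>polar_disc) = ennreal (\<integral>x. dens x \<partial>polar_disc)"
    by (intro nn_integral_eq_integral dens_integrable AE_I2 dens_nonneg)
  finally have "(\<integral>\<^sup>+y. ennreal (norm (Q y)) \<partial>(circ \<Otimes>\<^sub>M polar_disc)) < \<infinity>"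
    by (simp add: ennreal_mult_less_top)
  then show "(\<integral>\<^sup>+y. ennreal (norm (case y of (t, x) \<Rightarrow> dens x * Re ((1 + node x * cis t) / (1 - node x * cis t)))) \<partial>(circ \<Otimes>\<^sub>M polar_disc)) < \<infinity>"
    unfolding Q_def .
qed measurable

lemma bdry_integrable: "integrable circ (\<lambda>t. bdry (cis t))"
  unfolding bdry_def using cu.integrable_fst'[OF bdry_kernel_integrable] by simp

lemma F_eq_Schwarz_integral:
  assumes z: "cmod z < 1"
  shows "of_real (2*pi) * F z = (\<integral>t. (cis t + z) / (cis t - z) * of_real (bdry (cis t)) \<partial>circ)"
proof -
  define K where "K t = (cis t + z) / (cis t - z)" for t
  define H where "H t x = dens x * Re ((1 + node x * cis t) / (1 - node x * cis t))" for t x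
  have cK: "continuous_on UNIV K" unfolding K_def using cis_diff_nz[OF z]
    by (intro continuous_intros) auto
  have [measurable]: "K \<in> borel_measurable borel" by (rule borel_measurable_continuous_onI[OF cK])
  have Hm [measurable]: "case_prod H \<in> borel_measurable (circ \<Otimes>\<^sub>M polar_disc)" unfolding H_def[abs_def] by measurable
  have Kb: "cmod (K t) \<le> 2 / (1 - cmod z)" for t
  proof -
    have "cmod (cis t + z) \<le> 2" using norm_triangle_ineq[of "cis t" z] z by simp
    moreover have "1 - cmod z \<le> cmod (cis t - z)" using norm_triangle_ineq2[of "cis t" z] by simp
    ultimately show ?thesis unfolding K_def norm_divide using z by (intro frac_le) auto
  qed
  have KH: "integrable (circ \<Otimes>\<^sub>M polar_disc) (\<lambda>(t, x). K t * of_real (H t x))"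
  proof (rule Bochner_Integration.integrable_bound)
    show "integrable (circ \<Otimes>\<^sub>M polar_disc) (\<lambda>y. 2 / (1 - cmod z) * case_prod H y)"
      using bdry_kernel_integrable by (intro integrable_mult_right) (simp add: H_def[abs_def])
    show "AE y in circ \<Otimes>\<^sub>M polar_disc. norm (case y of (t, x) \<Rightarrow> K t * of_real (H t x)) \<le> norm (2 / (1 - cmod z) * case_prod H y)"
    proof (rule AE_I2)
      fix y :: "real \<times> real \<times> real"
      obtain t x where y: "y = (t, x)" by (cases y)
      have "cmod (K t) * \<bar>H t x\<bar> \<le> 2 / (1 - cmod z) * \<bar>H t x\<bar>" using Kb by (rule mult_right_mono) simp
      then show "norm (case y of (t, x) \<Rightarrow> K t * of_real (H t x)) \<le> norm (2 / (1 - cmod z) * case_prod H y)"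
        using z by (simp add: y norm_mult abs_mult)
    qed
  qed measurable
  have inner: "(\<integral>t. K t * of_real (H t x) \<partial>circ) = of_real (2*pi) * (of_real (dens x) * ((1 + node x * z) / (1 - node x * z)))"
    if x: "x \<in> space polar_disc" for x
  proof -
    have a: "cmod (node x) < 1" using x cmod_node[of x] by (simp add: space_polar_disc)
    have nz: "1 - node x * cis t \<noteq> 0" for t
      using one_minus_mult_nz[of "cis t" "node x"] a by (simp add: mult.commute)
    define S where "S t = K t * of_real (Re ((1 + node x * cis t) / (1 - node x * cis t)))" for t
    have "(\<integral>t. S t \<partial>circ) = of_real (2*pi) * ((1 + node x * z) / (1 - node x * z))"
      unfolding S_def using nz
      by (intro integral_circ_has_integral continuous_intros cK Schwarz_formula_Cayley[OF a z, folded K_def]) auto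
    moreover have "(\<integral>t. K t * of_real (H t x) \<partial>circ) = (\<integral>t. of_real (dens x) * S t \<partial>circ)"
      by (intro Bochner_Integration.integral_cong refl) (simp add: H_def S_def mult_ac)
    ultimately show ?thesis by (simp add: mult_ac)
  qed
  \<comment> \<open>The case a = 0 of the Schwarz formula accounts for the constant |f(0)| in
    \<open>F\<close>.\<close>
  have K0: "(\<integral>t. K t \<partial>circ) = of_real (2*pi)" "integrable circ K"
    using integral_circ_has_integral[OF cK] Schwarz_formula_Cayley[OF _ z, of 0, folded K_def] by auto
  have "(\<integral>t. (\<integral>x. K t * of_real (H t x) \<partial>polar_disc) \<partial>circ) = (\<integral>x. (\<integral>t. K t * of_real (H t x) \<partial>circ) \<partial>polar_disc)"
    by (rule cu.Fubini_integral[OF KH, symmetric])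
  also have "\<dots> = (\<integral>x. of_real (2*pi) * (of_real (dens x) * ((1 + node x * z) / (1 - node x * z))) \<partial>polar_disc)"
    by (intro Bochner_Integration.integral_cong refl inner)
  also have "\<dots> = of_real (2*pi) * (F z - of_real (cmod (f 0)))"
    by (simp only: integral_mult_right_zero F_def add_diff_cancel_left')
  finally have 1: "(\<integral>t. (\<integral>x. K t * of_real (H t x) \<partial>polar_disc) \<partial>circ) = of_real (2*pi) * (F z - of_real (cmod (f 0)))" .
  have 2: "integrable circ (\<lambda>t. \<integral>x. K t * of_real (H t x) \<partial>polar_disc)"
    using cu.integrable_fst'[OF KH] by simp
  \<comment> \<open>Pulling out the scalar \<open>K t\<close> is valid at every t, including those
    where the inner integral takes its default value 0.\<close>
  have "K t * of_real (bdry (cis t)) = of_real (cmod (f 0)) * K t + (\<integral>x. K t * of_real (H t x) \<partial>polar_disc)" for t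
  proof -
    have "(\<integral>x. K t * complex_of_real (H t x) \<partial>polar_disc) = K t * of_real (\<integral>x. H t x \<partial>polar_disc)"
      by simp
    moreover have "bdry (cis t) = cmod (f 0) + (\<integral>x. H t x \<partial>polar_disc)" by (simp only: bdry_def H_def)
    ultimately show ?thesis by (simp add: algebra_simps)
  qed
  then have "(\<integral>t. K t * of_real (bdry (cis t)) \<partial>circ) = (\<integral>t. of_real (cmod (f 0)) * K t + (\<integral>x. K t * of_real (H t x) \<partial>polar_disc) \<partial>circ)"
    by simp
  also have "\<dots> = of_real (cmod (f 0)) * of_real (2*pi) + of_real (2*pi) * (F z - of_real (cmod (f 0)))"
    using K0 2 1 by (subst Bochner_Integration.integral_add) auto
  also have "\<dots> = of_real (2*pi) * F z" by (simp add: algebra_simps)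
  finally show ?thesis by (simp add: K_def)
qed

end

subsection \<open>Block estimates for the weights\<close>

text \<open>
  The profile \<open>s \<mapsto> \<nu> s\<close> of a radial weight is not known to be measurable on \<open>[0,1)\<close> (only \<open>\<nu>\<close> on the
  disc is), so the following facts treat \<open>nn_integral\<close> of arbitrary functions as a lower integral.
\<close>

lemma nn_integral_measurable_minorant:
  obtains g where "g \<in> borel_measurable M" "\<And>x. g x \<le> f x" "(\<integral>\<^sup>+x. g x \<partial>M) = (\<integral>\<^sup>+x. f x \<partial>M)"
proof -
  define A where "A = {g. simple_function M g \<and> g \<le> f}"
  have "(\<lambda>_. 0) \<in> A" by (auto simp: A_def le_fun_def)
  then have "A \<noteq> {}" by auto
  \<comment> \<open>The integral is a supremum over simple minorants, hence over countably many of
    them. The pointwise supremum of these is measurable and still below \<open>f\<close>.\<close>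
  from ennreal_SUP_countable_SUP[OF this, of "integral\<^sup>S M"]
  obtain \<phi> :: "nat \<Rightarrow> ennreal" where \<phi>: "range \<phi> \<subseteq> integral\<^sup>S M ` A" "(SUP g\<in>A. integral\<^sup>S M g) = (SUP i. \<phi> i)" by blast
  have "\<exists>g. \<forall>i. g i \<in> A \<and> integral\<^sup>S M (g i) = \<phi> i"
  proof (intro choice allI)
    fix i
    have "\<phi> i \<in> integral\<^sup>S M ` A" using \<phi>(1) by blast
    then show "\<exists>g. g \<in> A \<and> integral\<^sup>S M g = \<phi> i" by (auto simp: image_iff)
  qed
  then obtain G where G: "\<And>i. G i \<in> A" "\<And>i. integral\<^sup>S M (G i) = \<phi> i" by blast
  define g where "g x = (SUP i. G i x)" for x
  have sf: "simple_function M (G i)" and le: "G i x \<le> f x" for i x using G(1)[of i] by (auto simp: A_def le_fun_def)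
  have [measurable]: "G i \<in> borel_measurable M" for i by (rule borel_measurable_simple_function[OF sf])
  have gm: "g \<in> borel_measurable M" unfolding g_def[abs_def] by measurable
  have gf: "g x \<le> f x" for x unfolding g_def by (rule SUP_least) (rule le)
  have "(\<integral>\<^sup>+x. f x \<partial>M) = (SUP i. \<phi> i)" unfolding nn_integral_def A_def[symmetric] by (rule \<phi>(2))
  also have "\<dots> \<le> (\<integral>\<^sup>+x. g x \<partial>M)"
  proof (rule SUP_least)
    fix i
    have "\<phi> i = (\<integral>\<^sup>+x. G i x \<partial>M)" using G(2)[of i] nn_integral_eq_simple_integral[OF sf[of i]] by simp
    also have "\<dots> \<le> (\<integral>\<^sup>+x. g x \<partial>M)" by (intro nn_integral_mono) (unfold g_def, rule SUP_upper, simp)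
    finally show "\<phi> i \<le> (\<integral>\<^sup>+x. g x \<partial>M)" .
  qed
  finally have "(\<integral>\<^sup>+x. g x \<partial>M) = (\<integral>\<^sup>+x. f x \<partial>M)" using nn_integral_mono[of M g f] gf by (simp add: antisym)
  with gm gf show ?thesis by (rule that)
qed

lemma nn_integral_cmult_ge: "c * (\<integral>\<^sup>+x. f x \<partial>M) \<le> (\<integral>\<^sup>+x. c * f x \<partial>M)"
proof -
  obtain g where [measurable]: "g \<in> borel_measurable M" and g: "\<And>x. g x \<le> f x" "(\<integral>\<^sup>+x. g x \<partial>M) = (\<integral>\<^sup>+x. f x \<partial>M)"
    using nn_integral_measurable_minorant[of M f] by blast
  have "c * (\<integral>\<^sup>+x. f x \<partial>M) = (\<integral>\<^sup>+x. c * g x \<partial>M)" unfolding g(2)[symmetric] by (rule nn_integral_cmult[symmetric]) measurable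
  also have "\<dots> \<le> (\<integral>\<^sup>+x. c * f x \<partial>M)" by (intro nn_integral_mono mult_left_mono g) auto
  finally show ?thesis .
qed

text \<open>Applying the one-sided inequality to the factor 1 / c gives the reverse
  direction.\<close>

lemma nn_integral_cmult_real:
  assumes "0 \<le> c"
  shows "(\<integral>\<^sup>+x. ennreal c * f x \<partial>M) = ennreal c * (\<integral>\<^sup>+x. f x \<partial>M)"
proof (cases "c = 0")
  case False
  with assms have c: "c > 0" by simp
  have inv: "ennreal (1/c) * (ennreal c * y) = y" "ennreal c * (ennreal (1/c) * y) = y" for y
    using c by (simp_all add: mult.assoc[symmetric] flip: ennreal_mult)
  have "ennreal (1/c) * (\<integral>\<^sup>+x. ennreal c * f x \<partial>M) \<le> (\<integral>\<^sup>+x. f x \<partial>M)"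
    using nn_integral_cmult_ge[of "ennreal (1/c)" M "\<lambda>x. ennreal c * f x"] by (simp add: inv)
  from mult_left_mono[OF this, of "ennreal c"] show ?thesis
    by (intro antisym nn_integral_cmult_ge) (simp add: inv)
qed simp

text \<open>Measurable minorants of the pieces have disjoint supports, so their sum is a minorant of
  \<open>f\<close>: lower integrals are superadditive.\<close>

lemma sum_nn_integral_disjoint_le:
  assumes I: "finite I" and E: "disjoint_family_on E I"
  shows "(\<Sum>i\<in>I. \<integral>\<^sup>+x. f x * indicator (E i) x \<partial>M) \<le> (\<integral>\<^sup>+x. f x \<partial>M)"
proof -
  have "\<exists>g. \<forall>i. g i \<in> borel_measurable M \<and> (\<forall>x. g i x \<le> f x * indicator (E i) x) \<and> (\<integral>\<^sup>+x. g i x \<partial>M) = (\<integral>\<^sup>+x. f x * indicator (E i) x \<partial>M)"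
  proof (intro choice allI)
    fix i
    show "\<exists>g. g \<in> borel_measurable M \<and> (\<forall>x. g x \<le> f x * indicator (E i) x) \<and> (\<integral>\<^sup>+x. g x \<partial>M) = (\<integral>\<^sup>+x. f x * indicator (E i) x \<partial>M)"
      using nn_integral_measurable_minorant[of M "\<lambda>x. f x * indicator (E i) x"] by blast
  qed
  then obtain g where [measurable]: "\<And>i. g i \<in> borel_measurable M"
    and g: "\<And>i x. g i x \<le> f x * indicator (E i) x" "\<And>i. (\<integral>\<^sup>+x. g i x \<partial>M) = (\<integral>\<^sup>+x. f x * indicator (E i) x \<partial>M)" by blast
  have "(\<Sum>i\<in>I. \<integral>\<^sup>+x. f x * indicator (E i) x \<partial>M) = (\<integral>\<^sup>+x. (\<Sum>i\<in>I. g i x) \<partial>M)"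
    unfolding g(2)[symmetric] by (rule nn_integral_sum[symmetric]) measurable
  also have "\<dots> \<le> (\<integral>\<^sup>+x. f x \<partial>M)"
  proof (intro nn_integral_mono)
    fix x
    show "(\<Sum>i\<in>I. g i x) \<le> f x"
    proof (cases "\<exists>j\<in>I. x \<in> E j")
      case True
      then obtain j where j: "j \<in> I" "x \<in> E j" by blast
      have z: "g i x = 0" if "i \<in> I - {j}" for i
      proof -
        have "x \<notin> E i" using E that j unfolding disjoint_family_on_def by blast
        then show ?thesis using g(1)[of i x] by simp
      qed
      have "(\<Sum>i\<in>I. g i x) = g j x" using I j(1) z by (subst sum.remove[of I j]) auto
      also have "\<dots> \<le> f x" using g(1)[of j x] j by simp
      finally show ?thesis .
    next
      case False
      then have "g i x = 0" if "i \<in> I" for i using g(1)[of i x] that by (auto simp: indicator_def split: if_splits)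
      then show ?thesis by simp
    qed
  qed
  finally show ?thesis .
qed

lemma suminf_nn_integral_disjoint_le:
  fixes E :: "nat \<Rightarrow> 'a set"
  assumes "disjoint_family E"
  shows "(\<Sum>i. \<integral>\<^sup>+x. f x * indicator (E i) x \<partial>M) \<le> (\<integral>\<^sup>+x. f x \<partial>M)"
  using assms by (intro suminf_le_const summableI sum_nn_integral_disjoint_le)
    (auto simp: disjoint_family_on_def)

text \<open>Only a measurable minorant of \<open>f\<close> is cut up. Since the \<open>E i\<close>
  are measurable, each piece of it is measurable and lies below the corresponding piece of
  \<open>f\<close>.\<close>

lemma nn_integral_le_suminf_cover:
  fixes E :: "nat \<Rightarrow> 'a set"
  assumes [measurable]: "\<And>i. E i \<in> sets M" and cover: "\<And>x. x \<in> space M \<Longrightarrow> f x \<noteq> 0 \<Longrightarrow> \<exists>i. x \<in> E i"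
  shows "(\<integral>\<^sup>+x. f x \<partial>M) \<le> (\<Sum>i. \<integral>\<^sup>+x. f x * indicator (E i) x \<partial>M)"
proof -
  obtain g where [measurable]: "g \<in> borel_measurable M" and g: "\<And>x. g x \<le> f x" "(\<integral>\<^sup>+x. g x \<partial>M) = (\<integral>\<^sup>+x. f x \<partial>M)"
    using nn_integral_measurable_minorant[of M f] by blast
  have "(\<integral>\<^sup>+x. f x \<partial>M) \<le> (\<integral>\<^sup>+x. (\<Sum>i. g x * indicator (E i) x) \<partial>M)"
    unfolding g(2)[symmetric]
  proof (intro nn_integral_mono)
    fix x assume x: "x \<in> space M"
    show "g x \<le> (\<Sum>i. g x * indicator (E i) x)"
    proof (cases "f x = 0")
      case True
      then show ?thesis using g(1)[of x] by simp
    next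
      case False
      then obtain i where "x \<in> E i" using cover x by blast
      then have "g x = (\<Sum>j\<in>{i}. g x * indicator (E j) x)" by simp
      also have "\<dots> \<le> (\<Sum>i. g x * indicator (E i) x)" by (intro sum_le_suminf summableI) auto
      finally show ?thesis .
    qed
  qed
  also have "\<dots> = (\<Sum>i. \<integral>\<^sup>+x. g x * indicator (E i) x \<partial>M)" by (rule nn_integral_suminf) measurable
  also have "\<dots> \<le> (\<Sum>i. \<integral>\<^sup>+x. f x * indicator (E i) x \<partial>M)"
    by (intro suminf_le nn_integral_mono mult_right_mono g summableI) auto
  finally show ?thesis .
qed

lemma nn_integral_le_split:
  assumes [measurable]: "E \<in> sets M"
  shows "(\<integral>\<^sup>+x. f x \<partial>M) \<le> (\<integral>\<^sup>+x. f x * indicator E x \<partial>M) + (\<integral>\<^sup>+x. f x * indicator (- E) x \<partial>M)"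
proof -
  obtain g where [measurable]: "g \<in> borel_measurable M" and g: "\<And>x. g x \<le> f x" "(\<integral>\<^sup>+x. g x \<partial>M) = (\<integral>\<^sup>+x. f x \<partial>M)"
    using nn_integral_measurable_minorant[of M f] by blast
  have "(\<integral>\<^sup>+x. f x \<partial>M) = (\<integral>\<^sup>+x. g x * indicator E x + g x * indicator (space M - E) x \<partial>M)"
    unfolding g(2)[symmetric] by (intro nn_integral_cong) (auto simp: indicator_def)
  also have "\<dots> = (\<integral>\<^sup>+x. g x * indicator E x \<partial>M) + (\<integral>\<^sup>+x. g x * indicator (space M - E) x \<partial>M)"
    by (rule nn_integral_add) measurable
  also have "\<dots> \<le> (\<integral>\<^sup>+x. f x * indicator E x \<partial>M) + (\<integral>\<^sup>+x. f x * indicator (- E) x \<partial>M)"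
    using g(1) by (intro add_mono nn_integral_mono) (auto simp: indicator_def)
  finally show ?thesis .
qed

section \<open>Almost diagonal matrices and geometric growth of sequences\<close>

lemma sum_geometric_le:
  fixes \<theta> :: real
  assumes "0 \<le> \<theta>" "\<theta> < 1"
  shows "(\<Sum>k<m. \<theta> ^ k) \<le> 1 / (1 - \<theta>)"
  using sum_le_suminf[OF summable_geometric, of \<theta> "{..<m}"] assms by (simp add: suminf_geometric)

text \<open>With truncated subtraction, \<open>(N - k) + (k - N)\<close> is the distance of \<open>N\<close> and \<open>k\<close>.\<close>

lemma sum_geometric_dist_le:
  fixes \<theta> :: real
  assumes \<theta>: "0 \<le> \<theta>" "\<theta> < 1"
  shows "(\<Sum>k<m. \<theta> ^ ((N - k) + (k - N))) \<le> 2 / (1 - \<theta>)"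
proof -
  have "(\<Sum>k<m. \<theta> ^ ((N - k) + (k - N))) \<le> (\<Sum>k\<in>{..N} \<union> {N..<N+m}. \<theta> ^ ((N - k) + (k - N)))"
    using \<theta> by (intro sum_mono2) auto
  also have "\<dots> \<le> (\<Sum>k\<le>N. \<theta> ^ ((N - k) + (k - N))) + (\<Sum>k=N..<N+m. \<theta> ^ ((N - k) + (k - N)))"
    using \<theta> by (subst sum_Un) (auto intro!: sum_nonneg)
  also have "(\<Sum>k\<le>N. \<theta> ^ ((N - k) + (k - N))) = (\<Sum>k<Suc N. \<theta> ^ k)"
    unfolding lessThan_Suc_atMost by (rule sum.reindex_bij_witness[of _ "\<lambda>k. N - k" "\<lambda>k. N - k"]) auto
  also have "(\<Sum>k=N..<N+m. \<theta> ^ ((N - k) + (k - N))) = (\<Sum>k<m. \<theta> ^ k)"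
    by (rule sum.reindex_bij_witness[of _ "\<lambda>k. k + N" "\<lambda>k. k - N"]) auto
  finally show ?thesis using sum_geometric_le[OF \<theta>, of "Suc N"] sum_geometric_le[OF \<theta>, of m] by simp
qed

text \<open>A matrix with geometric off-diagonal decay acts on the weighted l^q space with weights
  \<open>n\<close>. Half of the decay is spent on the sum over \<open>k\<close>, the other half on
  the sum over \<open>N\<close>, so that no case distinction at q = 1 arises.\<close>

lemma almost_diagonal_bound:
  fixes n b :: "nat \<Rightarrow> real" and e :: "nat \<Rightarrow> nat \<Rightarrow> real" and q C \<mu> :: real
  assumes q: "0 < q" and C: "0 \<le> C" and \<mu>: "0 < \<mu>" "\<mu> < 1"
    and n: "\<And>k. 0 < n k" and b: "\<And>k. 0 \<le> b k" and e: "\<And>N k. 0 \<le> e N k"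
    and sb: "summable (\<lambda>k. n k * b k powr q)"
    and diag: "\<And>N k. n N * e N k powr q \<le> C * \<mu> ^ ((N - k) + (k - N)) * n k"
  shows "summable (\<lambda>k. e N k * b k)"
    and "summable (\<lambda>N. n N * (\<Sum>k. e N k * b k) powr q)"
proof -
  define d :: "nat \<Rightarrow> nat \<Rightarrow> nat" where "d N k = (N - k) + (k - N)" for N k
  \<comment> \<open>The two halves of the decay. After the q-th root the first becomes \<theta>; the
    second remains inside \<open>Y\<close>.\<close>
  define \<eta> where "\<eta> = sqrt \<mu>"
  have \<eta>: "0 < \<eta>" "\<eta> < 1" "\<mu> = \<eta> * \<eta>" using \<mu> by (auto simp: \<eta>_def)
  define \<theta> where "\<theta> = \<eta> powr (1 / q)"
  have \<theta>: "0 < \<theta>" "\<theta> < 1" using \<eta> q powr_less_mono2[of "1/q" \<eta> 1] by (auto simp: \<theta>_def)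
  define x where "x k = n k * b k powr q" for k
  have x: "0 \<le> x k" for k using n[of k] by (simp add: x_def)
  have sx: "summable x" using sb by (simp add: x_def[abs_def])
  have \<eta>1: "\<eta> ^ d N k \<le> 1" for N k using \<eta> by (intro power_le_one) auto
  have sY: "summable (\<lambda>k. \<eta> ^ d N k * x k)" for N
    using \<eta>1[of N] \<eta> x by (intro summable_comparison_test[OF _ sx] exI[of _ 0]) (auto simp: abs_mult intro!: mult_left_le_one_le)
  \<comment> \<open>\<open>Y\<close> is the sequence of terms n_k b_k^q smeared out around
    \<open>N\<close>. It dominates each of its summands, which gives the termwise bound
    \<open>tm\<close> with a common factor \<open>c N\<close>.\<close>
  define Y where "Y N = (\<Sum>k. \<eta> ^ d N k * x k)" for N
  have Y0: "0 \<le> Y N" for N unfolding Y_def using \<eta> x by (intro suminf_nonneg sY) auto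
  have Yk: "\<eta> ^ d N k * x k \<le> Y N" for N k
    unfolding Y_def using sum_le_suminf[OF sY[of N], of "{k}"] \<eta> x by auto
  define c where "c N = (C * Y N / n N) powr (1 / q)" for N
  have tm: "e N k * b k \<le> c N * \<theta> ^ d N k" for N k
  proof -
    have "n N * (e N k * b k) powr q = n N * e N k powr q * b k powr q"
      using e b by (simp add: powr_mult)
    also have "\<dots> \<le> C * \<mu> ^ d N k * n k * b k powr q"
      using diag[of N k] by (intro mult_right_mono) (auto simp: d_def)
    also have "\<dots> = C * \<eta> ^ d N k * (\<eta> ^ d N k * x k)"
      by (simp add: \<eta>(3) power_mult_distrib x_def)
    also have "\<dots> \<le> C * \<eta> ^ d N k * Y N"
      using C \<eta> Yk by (intro mult_left_mono) auto
    finally have "(e N k * b k) powr q \<le> C * Y N / n N * \<eta> ^ d N k"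
      using n[of N] by (simp add: field_simps)
    then have "((e N k * b k) powr q) powr (1 / q) \<le> (C * Y N / n N * \<eta> ^ d N k) powr (1 / q)"
      using q by (intro powr_mono2) auto
    also have "((e N k * b k) powr q) powr (1 / q) = e N k * b k"
      using q e b by (simp add: powr_powr)
    also have "(C * Y N / n N * \<eta> ^ d N k) powr (1 / q) = c N * (\<eta> ^ d N k) powr (1 / q)"
      unfolding c_def using C Y0[of N] n[of N] \<eta> by (subst powr_mult) auto
    also have "(\<eta> ^ d N k) powr (1 / q) = \<theta> ^ d N k"
      using \<eta> by (simp add: \<theta>_def powr_powr mult.commute flip: powr_realpow)
    finally show ?thesis .
  qed
  define S where "S = 2 / (1 - \<theta>)"
  have s\<theta>: "summable (\<lambda>k. \<theta> ^ d N k)" and S: "(\<Sum>k. \<theta> ^ d N k) \<le> S" for N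
  proof -
    have bd: "(\<Sum>k<m. \<theta> ^ d N k) \<le> S" for m
      unfolding d_def S_def using \<theta> by (intro sum_geometric_dist_le) auto
    show s: "summable (\<lambda>k. \<theta> ^ d N k)" using \<theta> by (intro summableI_nonneg_bounded[OF _ bd]) auto
    show "(\<Sum>k. \<theta> ^ d N k) \<le> S" by (intro suminf_le_const s bd)
  qed
  have S0: "0 \<le> S" using \<theta> by (simp add: S_def)
  have sc: "summable (\<lambda>k. c N * \<theta> ^ d N k)" for N by (intro summable_mult s\<theta>)
  show sB: "summable (\<lambda>k. e N k * b k)" for N
    using tm e b by (intro summable_comparison_test[OF _ sc] exI[of _ 0]) (auto simp: abs_mult)
  define S' where "S' = 2 / (1 - \<eta>)"
  \<comment> \<open>Summing over \<open>N\<close> first: the distance is symmetric, so each x_k is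
    counted with total weight at most S'.\<close>
  have sumY: "summable Y"
  proof (rule summableI_nonneg_bounded[OF Y0])
    fix m
    have "(\<Sum>N<m. Y N) = (\<Sum>k. \<Sum>N<m. \<eta> ^ d N k * x k)"
      unfolding Y_def by (rule suminf_sum[symmetric]) (rule sY)
    also have "\<dots> \<le> (\<Sum>k. S' * x k)"
    proof (intro suminf_le summable_sum sY summable_mult sx)
      fix k
      have "(\<Sum>N<m. \<eta> ^ d N k) \<le> S'"
        using sum_geometric_dist_le[of \<eta> k m] \<eta> by (simp add: d_def S'_def add.commute)
      then show "(\<Sum>N<m. \<eta> ^ d N k * x k) \<le> S' * x k"
        unfolding sum_distrib_right[symmetric] using x by (intro mult_right_mono) auto
    qed
    finally show "(\<Sum>N<m. Y N) \<le> (\<Sum>k. S' * x k)" .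
  qed
  show "summable (\<lambda>N. n N * (\<Sum>k. e N k * b k) powr q)"
  proof (rule summable_comparison_test[OF _ summable_mult[OF sumY, of "C * S powr q"]], intro exI allI impI)
    fix N
    have "(\<Sum>k. e N k * b k) \<le> (\<Sum>k. c N * \<theta> ^ d N k)"
      by (intro suminf_le tm sB sc)
    also have "\<dots> = c N * (\<Sum>k. \<theta> ^ d N k)" by (rule suminf_mult[OF s\<theta>])
    also have "\<dots> \<le> c N * S" using S by (intro mult_left_mono) (auto simp: c_def)
    finally have B: "(\<Sum>k. e N k * b k) \<le> c N * S" .
    have B0: "0 \<le> (\<Sum>k. e N k * b k)" using e b by (intro suminf_nonneg sB) auto
    have "(\<Sum>k. e N k * b k) powr q \<le> (c N * S) powr q"
      using q B B0 by (intro powr_mono2) auto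
    also have "\<dots> = C * Y N / n N * S powr q"
      using q C Y0[of N] n[of N] S0 by (simp add: c_def powr_mult powr_powr)
    finally have "n N * (\<Sum>k. e N k * b k) powr q \<le> n N * (C * Y N / n N * S powr q)"
      using n[of N] by (intro mult_left_mono) auto
    also have "\<dots> = C * S powr q * Y N" using n[of N] by simp
    finally show "norm (n N * (\<Sum>k. e N k * b k) powr q) \<le> C * S powr q * Y N"
      using n[of N] by simp
  qed
qed

text \<open>Self-improvement: the partial sums satisfy T_k <= C (T_{k+1} - T_k), hence T_k <= C / (C
  + 1) T_{k+1}. Iterating and comparing \<open>a\<close> with \<open>T\<close> at both ends gives
  the factor C + 1.\<close>

lemma geometric_growth_of_sum_bound:
  fixes a :: "nat \<Rightarrow> real"
  assumes a: "\<And>k. 0 \<le> a k" and C: "0 < C" and le: "\<And>k. (\<Sum>j<k. a j) \<le> C * a k" and jk: "j \<le> k"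
  shows "a j \<le> (C + 1) * (C / (C + 1)) ^ (k - j) * a k"
proof -
  define T where "T k = (\<Sum>j<Suc k. a j)" for k
  have step: "T k \<le> C / (C + 1) * T (Suc k)" for k
  proof -
    have "T k \<le> C * a (Suc k)" using le[of "Suc k"] by (simp add: T_def)
    moreover have "T (Suc k) = T k + a (Suc k)" by (simp add: T_def)
    ultimately show ?thesis using C by (simp add: field_simps)
  qed
  have "T j \<le> (C / (C + 1)) ^ (k - j) * T k" using jk
  proof (induction k rule: dec_induct)
    case (step k)
    have "T j \<le> (C / (C + 1)) ^ (k - j) * T k" by (rule step.IH)
    also have "\<dots> \<le> (C / (C + 1)) ^ (k - j) * (C / (C + 1) * T (Suc k))"
      using C \<open>\<And>k. T k \<le> C / (C + 1) * T (Suc k)\<close> by (intro mult_left_mono) auto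
    also have "\<dots> = (C / (C + 1)) ^ (Suc k - j) * T (Suc k)"
      using step.hyps by (simp add: Suc_diff_le)
    finally show ?case .
  qed simp
  also have "T k \<le> (C + 1) * a k" using le[of k] by (simp add: T_def algebra_simps)
  finally have "T j \<le> (C / (C + 1)) ^ (k - j) * ((C + 1) * a k)"
    using C by (simp add: mult_left_mono)
  moreover have "a j \<le> T j" using a by (simp add: T_def sum_nonneg)
  ultimately show ?thesis by (simp add: mult_ac)
qed

section \<open>Blocks and the tail masses of a weight\<close>

definition block :: "real \<Rightarrow> nat \<Rightarrow> real set" where
  "block K k = {1 - 1 / K ^ k ..< 1 - 1 / K ^ Suc k}"

lemma block_subset: "1 < K \<Longrightarrow> block K k \<subseteq> {0..<1}"
proof
  fix s assume K: "1 < K" and s: "s \<in> block K k"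
  have "1 / K ^ k \<le> 1" using K by (simp add: one_le_power)
  moreover have "0 < 1 / K ^ Suc k" using K by (intro divide_pos_pos zero_less_power) auto
  moreover have "1 - 1 / K ^ k \<le> s" "s < 1 - 1 / K ^ Suc k" using s unfolding block_def by auto
  ultimately show "s \<in> {0..<1}" unfolding atLeastLessThan_iff by linarith
qed

lemma block_mono: "1 < (K::real) \<Longrightarrow> i \<le> j \<Longrightarrow> 1 - 1 / K ^ i \<le> 1 - 1 / K ^ j"
  by (intro diff_left_mono frac_le power_increasing) auto

lemma disjoint_block: "1 < K \<Longrightarrow> disjoint_family (block K)"
proof -
  assume K: "1 < K"
  have "block K i \<inter> block K j = {}" if "i < j" for i j
    using block_mono[OF K, of "Suc i" j] that unfolding block_def by auto
  then show ?thesis unfolding disjoint_family_on_def by (metis inf_commute linorder_neqE_nat)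
qed

lemma block_cover:
  assumes K: "1 < K" and s: "0 \<le> s" "s < 1"
  shows "\<exists>k. s \<in> block K k"
proof -
  obtain m where "1 / (1 - s) < K ^ m" using real_arch_pow[OF K] by blast
  then have "s < 1 - 1 / K ^ m" using s K by (simp add: field_simps)
  define m0 where "m0 = (LEAST m. s < 1 - 1 / K ^ m)"
  have 1: "s < 1 - 1 / K ^ m0" unfolding m0_def by (rule LeastI) fact
  with s have "m0 \<noteq> 0" by (intro notI) simp
  then obtain k where k: "m0 = Suc k" by (cases m0) auto
  have "\<not> s < 1 - 1 / K ^ k" using not_less_Least[of k "\<lambda>m. s < 1 - 1 / K ^ m"] k by (simp add: m0_def)
  with 1 k have "s \<in> block K k" unfolding block_def atLeastLessThan_iff by simp
  then show ?thesis ..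
qed

lemma sets_block [measurable]: "block K k \<in> sets borel" "block K k \<in> sets lebesgue"
  by (simp_all add: block_def)

definition block_mass :: "(complex \<Rightarrow> real) \<Rightarrow> real \<Rightarrow> nat \<Rightarrow> ennreal" where
  "block_mass \<nu> K k = (\<integral>\<^sup>+s\<in>block K k. ennreal (\<nu> (of_real s)) \<partial>lebesgue)"

lemma weight_hat_antimono: "r \<le> s \<Longrightarrow> weight_hat \<nu> s \<le> weight_hat \<nu> r"
  unfolding weight_hat_def by (intro nn_integral_mono) (auto simp: indicator_def)

text \<open>The midpoint (1 + r) / 2 halves the distance to 1, so \<open>j\<close> steps divide it
  by 2^j. This lets the doubling condition reach across a whole block, or past any given
  radius.\<close>

lemma D_hat_iterate:
  assumes C: "0 < C" "\<And>r. r \<in> {0..<1} \<Longrightarrow> weight_hat \<nu> r \<le> ennreal C * weight_hat \<nu> ((1 + r) / 2)" and r: "r \<in> {0..<1}"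
  shows "weight_hat \<nu> r \<le> ennreal (C ^ j) * weight_hat \<nu> (1 - (1 - r) / 2 ^ j)"
proof (induction j)
  case (Suc j)
  have "(1 - r) / 2 ^ j \<le> 1" using r by (simp add: divide_le_eq order.trans[OF _ one_le_power])
  moreover have "0 < (1 - r) / 2 ^ j" using r by simp
  ultimately have mem: "1 - (1 - r) / 2 ^ j \<in> {0..<1}" by simp
  have "weight_hat \<nu> r \<le> ennreal (C ^ j) * weight_hat \<nu> (1 - (1 - r) / 2 ^ j)" by (rule Suc.IH)
  also have "\<dots> \<le> ennreal (C ^ j) * (ennreal C * weight_hat \<nu> ((1 + (1 - (1 - r) / 2 ^ j)) / 2))"
    by (intro mult_left_mono C mem) auto
  also have "(1 + (1 - (1 - r) / 2 ^ j)) / 2 = 1 - (1 - r) / 2 ^ Suc j" by (simp add: field_simps)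
  also have "ennreal (C ^ j) * (ennreal C * weight_hat \<nu> (1 - (1 - r) / 2 ^ Suc j)) = ennreal (C ^ Suc j) * weight_hat \<nu> (1 - (1 - r) / 2 ^ Suc j)"
    using C by (simp add: ennreal_mult mult_ac)
  finally show ?case .
qed simp

lemma weight_nonneg:
  assumes "radial_weight \<nu>" "s \<in> {0..<1}"
  shows "0 \<le> \<nu> (of_real s)"
proof -
  have "complex_of_real s \<in> ball 0 1" using assms(2) by simp
  with assms(1) show ?thesis unfolding radial_weight_def by blast
qed

text \<open>Reduces the weight to a sequence: n_k is the tail mass at the left endpoint of block k.
  \<open>K\<close> and \<rho> are the constants of \<open>D_check\<close>, C2 comes from
  \<open>D_hat\<close> and C3 from \<open>D_hat_sub q\<close>.\<close>

lemma weight_sequence: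
  assumes \<nu>: "\<nu> \<in> D_two_sided \<inter> D_hat_sub q" and q: "0 < q" and fin: "weight_hat \<nu> 0 < \<infinity>"
  obtains K \<rho> C2 C3 c :: real and n :: "nat \<Rightarrow> real" where "1 < K" "1 < \<rho>" "0 < C2" "0 < C3" "0 < c"
    "\<And>k. 0 < n k" "\<And>k. \<rho> * n (Suc k) \<le> n k" "\<And>k. n k \<le> C2 * n (Suc k)"
    "\<And>k. (\<Sum>j<k. n j * (K ^ j) powr q) \<le> C3 * (n k * (K ^ k) powr q)"
    "\<And>k. ennreal (c * n k) \<le> block_mass \<nu> K k" "\<And>k. block_mass \<nu> K k \<le> ennreal (n k)"
proof -
  have rad: "radial_weight \<nu>" using \<nu> by (auto simp: D_two_sided_def D_hat_def)
  obtain C where C: "0 < C" "\<And>r. r \<in> {0..<1} \<Longrightarrow> weight_hat \<nu> r \<le> ennreal C * weight_hat \<nu> ((1 + r) / 2)"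
    using \<nu> by (auto simp: D_two_sided_def D_hat_def)
  obtain K \<rho> where K: "1 < K" and \<rho>: "1 < \<rho>"
    and chk: "\<And>r. r \<in> {0..<1} \<Longrightarrow> ennreal \<rho> * weight_hat \<nu> (1 - (1 - r) / K) \<le> weight_hat \<nu> r"
    using \<nu> unfolding D_two_sided_def D_check_def by blast
  define r where "r k = 1 - 1 / K ^ k" for k :: nat
  have r: "r k \<in> {0..<1}" for k using K by (auto simp: r_def one_le_power)
  have rS: "1 - (1 - r k) / K = r (Suc k)" for k by (simp add: r_def)
  define n where "n k = enn2real (weight_hat \<nu> (r k))" for k
  have w: "weight_hat \<nu> (r k) = ennreal (n k)" for k
  proof -
    have "weight_hat \<nu> (r k) \<le> weight_hat \<nu> 0" using r[of k] by (intro weight_hat_antimono) auto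
    with fin show ?thesis unfolding n_def by (metis ennreal_enn2real_if infinity_ennreal_def leD)
  qed
  have n: "0 < n k" for k
  proof -
    have "0 < weight_hat \<nu> (r k)" using rad r[of k] unfolding radial_weight_def by blast
    then show ?thesis unfolding w by simp
  qed
  have n1: "\<rho> * n (Suc k) \<le> n k" for k
    using chk[OF r, of k] n[of "Suc k"] n[of k] \<rho> unfolding rS w by (simp flip: ennreal_mult)
  \<comment> \<open>Enough halvings to pass from one block endpoint to the next.\<close>
  obtain j where j: "K < 2 ^ j" using real_arch_pow[of 2 K] by auto
  have n2: "n k \<le> C ^ j * n (Suc k)" for k
  proof -
    have "(1 - r k) / 2 ^ j \<le> (1 - r k) / K" using j K r[of k] by (intro divide_left_mono) auto
    then have "r (Suc k) \<le> 1 - (1 - r k) / 2 ^ j" unfolding rS[symmetric] by simp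
    then have "weight_hat \<nu> (1 - (1 - r k) / 2 ^ j) \<le> weight_hat \<nu> (r (Suc k))" by (rule weight_hat_antimono)
    then have "weight_hat \<nu> (r k) \<le> ennreal (C ^ j) * weight_hat \<nu> (r (Suc k))"
      using D_hat_iterate[OF C r, of k j] by (meson mult_left_mono order.trans zero_le)
    then show ?thesis unfolding w using n[of k] n[of "Suc k"] C by (simp flip: ennreal_mult)
  qed
  \<comment> \<open>A block carries at least n_k - n_{k+1}, and n_{k+1} <= n_k / \<rho>. With lower
    integrals the first fact rests on splitting along the measurable block.\<close>
  define c where "c = 1 - 1 / \<rho>"
  have c: "0 < c" using \<rho> by (simp add: c_def)
  have blockr: "block K k = {r k..<r (Suc k)}" for k by (simp add: block_def r_def)
  have b1: "block_mass \<nu> K k \<le> ennreal (n k)" for k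
  proof -
    have "r (Suc k) < 1" using r[of "Suc k"] by simp
    then show ?thesis unfolding w[symmetric] weight_hat_def block_mass_def blockr
      by (intro nn_integral_mono) (auto simp: indicator_def)
  qed
  have b2: "ennreal (c * n k) \<le> block_mass \<nu> K k" for k
  proof -
    have rr: "r k \<le> r (Suc k)" "r (Suc k) < 1" using block_mono[OF K, of k "Suc k"] r[of "Suc k"] by (simp_all add: r_def)
    have "ennreal (n k) \<le> (\<integral>\<^sup>+s. (ennreal (\<nu> (of_real s)) * indicator {r k..<1} s) * indicator (block K k) s \<partial>lebesgue)
       + (\<integral>\<^sup>+s. (ennreal (\<nu> (of_real s)) * indicator {r k..<1} s) * indicator (- block K k) s \<partial>lebesgue)"
      unfolding w[symmetric] weight_hat_def by (rule nn_integral_le_split) measurable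
    also have "(\<lambda>s. (ennreal (\<nu> (of_real s)) * indicator {r k..<1} s) * indicator (block K k) s) = (\<lambda>s. ennreal (\<nu> (of_real s)) * indicator (block K k) s)"
      using rr by (auto simp: blockr indicator_def fun_eq_iff)
    also have "(\<lambda>s. (ennreal (\<nu> (of_real s)) * indicator {r k..<1} s) * indicator (- block K k) s) = (\<lambda>s. ennreal (\<nu> (of_real s)) * indicator {r (Suc k)..<1} s)"
      using rr by (auto simp: blockr indicator_def fun_eq_iff)
    also have "(\<integral>\<^sup>+s. ennreal (\<nu> (of_real s)) * indicator {r (Suc k)..<1} s \<partial>lebesgue) = ennreal (n (Suc k))"
      unfolding w[symmetric] weight_hat_def ..
    also have "(\<integral>\<^sup>+s. ennreal (\<nu> (of_real s)) * indicator (block K k) s \<partial>lebesgue) = block_mass \<nu> K k"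
      unfolding block_mass_def ..
    finally have le: "ennreal (n k) \<le> block_mass \<nu> K k + ennreal (n (Suc k))" .
    obtain m where m: "block_mass \<nu> K k = ennreal m" "0 \<le> m"
      using b1[of k] by (cases "block_mass \<nu> K k") (auto simp: top_unique)
    have "n k \<le> m + n (Suc k)" using le m n[of "Suc k"] by (simp add: m flip: ennreal_plus)
    moreover have "n (Suc k) \<le> n k / \<rho>" using n1[of k] \<rho> by (simp add: field_simps)
    ultimately have "c * n k \<le> m" by (simp add: c_def algebra_simps)
    then show ?thesis unfolding m by (rule ennreal_leI)
  qed
  have "(SUP r\<in>{0..<1}. ennreal ((1 - r) powr q) / weight_hat \<nu> r *
        (\<integral>\<^sup>+s\<in>{0..r}. ennreal (\<nu> (of_real s) / (1 - s) powr q) \<partial>lebesgue)) < \<infinity>"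
    using \<nu> by (auto simp: D_hat_sub_def)
  then obtain S where S: "0 \<le> S" "(SUP r\<in>{0..<1}. ennreal ((1 - r) powr q) / weight_hat \<nu> r *
        (\<integral>\<^sup>+s\<in>{0..r}. ennreal (\<nu> (of_real s) / (1 - s) powr q) \<partial>lebesgue)) = ennreal S"
    by (cases "SUP r\<in>{0..<1}. ennreal ((1 - r) powr q) / weight_hat \<nu> r *
        (\<integral>\<^sup>+s\<in>{0..r}. ennreal (\<nu> (of_real s) / (1 - s) powr q) \<partial>lebesgue)") auto
  have n3: "(\<Sum>j<k. n j * (K ^ j) powr q) \<le> (S / c + 1) * (n k * (K ^ k) powr q)" for k
  proof -
    define I where "I = (\<integral>\<^sup>+s\<in>{0..r k}. ennreal (\<nu> (of_real s) / (1 - s) powr q) \<partial>lebesgue)"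
    define x where "x = (1 - r k) powr q"
    have x: "0 < x" "1 / x = (K ^ k) powr q" using K by (simp_all add: x_def r_def powr_divide)
    \<comment> \<open>The supremum is evaluated at a block endpoint, where (1 - r_k)^q = K^(-k
      q).\<close>
    have "ennreal x / ennreal (n k) * I \<le> ennreal S"
      unfolding S(2)[symmetric] x_def I_def w[symmetric] by (rule SUP_upper) (rule r)
    then have "ennreal (x / n k) * I \<le> ennreal S" using x n[of k] by (simp add: divide_ennreal)
    from mult_left_mono[OF this, of "ennreal (n k / x)"]
    have I1: "I \<le> ennreal (S * (n k / x))"
      using x n[of k] S(1) by (simp add: mult.assoc[symmetric] mult.commute[of S] flip: ennreal_mult)
    have "(\<Sum>j<k. ennreal (c * n j * (K ^ j) powr q)) \<le> (\<Sum>j<k. \<integral>\<^sup>+s. (ennreal (\<nu> (of_real s) / (1 - s) powr q) * indicator {0..r k} s) * indicator (block K j) s \<partial>lebesgue)"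
    proof (intro sum_mono)
      fix j assume "j \<in> {..<k}"
      then have rjk: "r (Suc j) \<le> r k" using block_mono[OF K, of "Suc j" k] by (simp add: r_def)
      have "ennreal (c * n j * (K ^ j) powr q) = ennreal ((K ^ j) powr q) * ennreal (c * n j)"
        using c n[of j] by (simp add: mult.commute flip: ennreal_mult)
      also have "\<dots> \<le> ennreal ((K ^ j) powr q) * block_mass \<nu> K j" by (intro mult_left_mono b2) auto
      also have "\<dots> \<le> (\<integral>\<^sup>+s. ennreal ((K ^ j) powr q) * (ennreal (\<nu> (of_real s)) * indicator (block K j) s) \<partial>lebesgue)"
        unfolding block_mass_def by (rule nn_integral_cmult_ge)
      also have "\<dots> \<le> (\<integral>\<^sup>+s. (ennreal (\<nu> (of_real s) / (1 - s) powr q) * indicator {0..r k} s) * indicator (block K j) s \<partial>lebesgue)"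
      proof (intro nn_integral_mono)
        fix s
        show "ennreal ((K ^ j) powr q) * (ennreal (\<nu> (of_real s)) * indicator (block K j) s) \<le> (ennreal (\<nu> (of_real s) / (1 - s) powr q) * indicator {0..r k} s) * indicator (block K j) s"
        proof (cases "s \<in> block K j")
          case True
          then have s: "0 \<le> s" "s < 1" "s \<le> r k" "r j \<le> s" using block_subset[OF K, of j] rjk by (auto simp: blockr)
          \<comment> \<open>On block j the factor 1 / (1 - s)^q is thus at least K^(j q), which
            bounds the integral below by the weighted sum.\<close>
          have "1 - s \<le> 1 / K ^ j" using s by (simp add: r_def)
          then have "(1 - s) powr q \<le> (1 / K ^ j) powr q" using s q by (intro powr_mono2) auto
          then have "1 / (1 / K ^ j) powr q \<le> 1 / (1 - s) powr q" using s by (intro divide_left_mono) (use K in auto)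
          then have "(K ^ j) powr q \<le> 1 / (1 - s) powr q" using K by (simp add: powr_divide)
          from mult_right_mono[OF this weight_nonneg[OF rad, of s]]
          have "(K ^ j) powr q * \<nu> (of_real s) \<le> \<nu> (of_real s) / (1 - s) powr q" using s by simp
          then show ?thesis using True s weight_nonneg[OF rad, of s] by (simp add: ennreal_leI flip: ennreal_mult)
        qed simp
      qed
      finally show "ennreal (c * n j * (K ^ j) powr q) \<le> \<dots>" .
    qed
    also have "\<dots> \<le> I" unfolding I_def
      using disjoint_block[OF K] by (intro sum_nn_integral_disjoint_le) (auto simp: disjoint_family_on_def)
    also note I1
    finally have "(\<Sum>j<k. c * n j * (K ^ j) powr q) \<le> S * (n k / x)"
      using c n x S(1) by (simp add: sum_ennreal less_imp_le mult_nonneg_nonneg)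
    then have "c * (\<Sum>j<k. n j * (K ^ j) powr q) \<le> S * (n k * (K ^ k) powr q)"
      using x by (simp add: sum_distrib_left mult.assoc divide_inverse)
    then have "(\<Sum>j<k. n j * (K ^ j) powr q) \<le> S / c * (n k * (K ^ k) powr q)"
      using c by (simp add: field_simps)
    \<comment> \<open>The added 1 makes the constant strictly positive even when S = 0.\<close>
    also have "\<dots> \<le> (S / c + 1) * (n k * (K ^ k) powr q)"
      using n[of k] by (intro mult_right_mono) auto
    finally show ?thesis .
  qed
  show ?thesis
    using K \<rho> C(1) S(1) c n n1 n2 n3 b2 b1
    by (intro that[of K \<rho> "C ^ j" "S / c + 1" c n]) (auto simp: add_nonneg_pos)
qed

subsection \<open>Factorization\<close>

lemma powr_add_le:
  fixes x y q :: real
  assumes "0 \<le> x" "0 \<le> y" "0 < q"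
  shows "(x + y) powr q \<le> 2 powr q * (x powr q + y powr q)"
proof -
  have "(x + y) powr q \<le> (2 * max x y) powr q" using assms by (intro powr_mono2) auto
  also have "\<dots> = 2 powr q * max x y powr q" by (rule powr_mult)
  also have "max x y powr q \<le> x powr q + y powr q" by (simp add: max_def)
  finally show ?thesis by simp
qed

text \<open>Monotonicity bounds the norm on block k below by \<open>M\<close> at the left endpoint,
  while the conclusion has the right endpoint. That is the left endpoint of the next block, and the
  shift costs the doubling constant C2.\<close>

lemma summable_of_mixed_norm:
  fixes M :: "real \<Rightarrow> real" and n :: "nat \<Rightarrow> real"
  assumes K: "1 < K" and q: "0 < q" and rad: "radial_weight \<nu>"
    and M: "\<And>r s. 0 \<le> r \<Longrightarrow> r \<le> s \<Longrightarrow> s < 1 \<Longrightarrow> M r \<le> M s" "\<And>r. 0 \<le> M r"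
    and fin: "(\<integral>\<^sup>+r\<in>{0..<1}. ennreal (M r powr q * \<nu> (of_real r)) \<partial>lebesgue) < \<infinity>"
    and c: "0 < c" and \<rho>: "1 < \<rho>" and n: "\<And>k. 0 < n k" "\<And>k. \<rho> * n (Suc k) \<le> n k" "\<And>k. n k \<le> C2 * n (Suc k)"
    and bm: "\<And>k. ennreal (c * n k) \<le> block_mass \<nu> K k"
  shows "summable (\<lambda>k. n k * (M (1 - 1 / K ^ Suc k) + 1) powr q)"
proof -
  define r where "r k = 1 - 1 / K ^ k" for k :: nat
  have blockr: "block K k = {r k..<r (Suc k)}" for k by (simp add: block_def r_def)
  have r0: "0 \<le> r k" for k using K by (simp add: r_def one_le_power)
  have le: "ennreal (c * (n k * M (r k) powr q)) \<le> (\<integral>\<^sup>+s. (ennreal (M s powr q * \<nu> (of_real s)) * indicator {0..<1} s) * indicator (block K k) s \<partial>lebesgue)" for k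
  proof -
    have "ennreal (c * (n k * M (r k) powr q)) = ennreal (M (r k) powr q) * ennreal (c * n k)"
      using c n(1)[of k] by (simp add: mult_ac flip: ennreal_mult)
    also have "\<dots> \<le> ennreal (M (r k) powr q) * block_mass \<nu> K k" by (intro mult_left_mono bm) auto
    also have "\<dots> \<le> (\<integral>\<^sup>+s. ennreal (M (r k) powr q) * (ennreal (\<nu> (of_real s)) * indicator (block K k) s) \<partial>lebesgue)"
      unfolding block_mass_def by (rule nn_integral_cmult_ge)
    also have "\<dots> \<le> (\<integral>\<^sup>+s. (ennreal (M s powr q * \<nu> (of_real s)) * indicator {0..<1} s) * indicator (block K k) s \<partial>lebesgue)"
    proof (intro nn_integral_mono)
      fix s
      show "ennreal (M (r k) powr q) * (ennreal (\<nu> (of_real s)) * indicator (block K k) s) \<le> (ennreal (M s powr q * \<nu> (of_real s)) * indicator {0..<1} s) * indicator (block K k) s"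
      proof (cases "s \<in> block K k")
        case True
        then have s: "0 \<le> s" "s < 1" "r k \<le> s" using block_subset[OF K, of k] by (auto simp: blockr)
        have "M (r k) powr q \<le> M s powr q" using M q s r0 by (intro powr_mono2) auto
        then have "M (r k) powr q * \<nu> (of_real s) \<le> M s powr q * \<nu> (of_real s)"
          using weight_nonneg[OF rad, of s] s by (intro mult_right_mono) auto
        then show ?thesis using True s weight_nonneg[OF rad, of s] by (simp add: ennreal_leI flip: ennreal_mult)
      qed simp
    qed
    finally show ?thesis .
  qed
  have "(\<Sum>k. ennreal (c * (n k * M (r k) powr q))) \<le> (\<Sum>k. \<integral>\<^sup>+s. (ennreal (M s powr q * \<nu> (of_real s)) * indicator {0..<1} s) * indicator (block K k) s \<partial>lebesgue)"
    by (intro suminf_le le summableI)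
  also have "\<dots> \<le> (\<integral>\<^sup>+s. ennreal (M s powr q * \<nu> (of_real s)) * indicator {0..<1} s \<partial>lebesgue)"
    by (rule suminf_nn_integral_disjoint_le[OF disjoint_block[OF K]])
  finally have "(\<Sum>k. ennreal (c * (n k * M (r k) powr q))) < \<infinity>" using fin by (rule le_less_trans)
  then have "summable (\<lambda>k. c * (n k * M (r k) powr q))"
    using c n(1) by (intro summable_suminf_not_top) (auto simp: less_imp_le)
  then have "summable (\<lambda>k. n k * M (r k) powr q)" using c by (simp add: summable_cmult_iff)
  then have "summable (\<lambda>k. n (Suc k) * M (r (Suc k)) powr q)" by (subst summable_Suc_iff)
  \<comment> \<open>Index shift: n_k <= C2 n_{k+1} replaces the weight of the next block by that of
    the present one.\<close>
  from summable_mult[OF this, of C2]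
  have s1: "summable (\<lambda>k. n k * M (r (Suc k)) powr q)"
  proof (rule summable_comparison_test[rotated], intro exI allI impI)
    fix k
    show "norm (n k * M (r (Suc k)) powr q) \<le> C2 * (n (Suc k) * M (r (Suc k)) powr q)"
      using mult_right_mono[OF n(3)[of k], of "M (r (Suc k)) powr q"] n(1)[of k] by (simp add: mult.assoc)
  qed
  \<comment> \<open>Geometric decay makes \<open>n\<close> summable, which pays for the 1 added to
    \<open>M\<close>.\<close>
  have nk: "n k \<le> n 0 * (1 / \<rho>) ^ k" for k
  proof (induction k)
    case (Suc k)
    have "n (Suc k) \<le> n k / \<rho>" using n(2)[of k] \<rho> by (simp add: field_simps)
    also have "\<dots> \<le> n 0 * (1 / \<rho>) ^ k / \<rho>" using Suc.IH \<rho> by (intro divide_right_mono) auto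
    finally show ?case by simp
  qed simp
  have s2: "summable n"
    by (rule summable_comparison_test[OF _ summable_mult[OF summable_geometric]])
      (use nk n(1) \<rho> in \<open>auto intro!: exI[of _ 0] simp: less_imp_le\<close>)
  have s3: "summable (\<lambda>k. 2 powr q * (n k * M (r (Suc k)) powr q + n k))"
    by (intro summable_mult summable_add s1 s2)
  show ?thesis unfolding r_def[symmetric]
  proof (rule summable_comparison_test[OF _ s3], intro exI allI impI)
    fix k
    have "n k * (M (r (Suc k)) + 1) powr q \<le> n k * (2 powr q * (M (r (Suc k)) powr q + 1 powr q))"
      using M(2) q n(1)[of k] by (intro mult_left_mono powr_add_le) auto
    then show "norm (n k * (M (r (Suc k)) + 1) powr q) \<le> 2 powr q * (n k * M (r (Suc k)) powr q + n k)"
      using n(1)[of k] by (simp add: algebra_simps)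
  qed
qed

text \<open>For k <= N truncated subtraction makes the entry 1, and the decay comes from
  \<open>n\<close> itself. For k > N it comes from the geometric growth of n_j K^(j q), obtained
  from the sum bound.\<close>

lemma weight_sequence_diagonal:
  fixes n :: "nat \<Rightarrow> real"
  assumes K: "1 < K" and \<rho>: "1 < \<rho>" and C3: "0 < C3" and n: "\<And>k. 0 < n k" "\<And>k. \<rho> * n (Suc k) \<le> n k"
    and n3: "\<And>k. (\<Sum>j<k. n j * (K ^ j) powr q) \<le> C3 * (n k * (K ^ k) powr q)"
  obtains C \<mu> where "0 \<le> C" "0 < \<mu>" "\<mu> < 1"
    "\<And>N k. n N * (1 / K ^ (k - N)) powr q \<le> C * \<mu> ^ ((N - k) + (k - N)) * n k"
proof -
  \<comment> \<open>One ratio for both sides of the diagonal: 1 / \<rho> for k <= N and C3 / (C3 +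
    1) for k > N.\<close>
  define \<mu> where "\<mu> = max (1 / \<rho>) (C3 / (C3 + 1))"
  have \<mu>: "0 < \<mu>" "\<mu> < 1" "1 / \<rho> \<le> \<mu>" "C3 / (C3 + 1) \<le> \<mu>" using \<rho> C3 by (auto simp: \<mu>_def less_max_iff_disj)
  have up: "n (k + d) \<le> \<mu> ^ d * n k" for k d
  proof (induction d)
    case (Suc d)
    have "n (k + Suc d) \<le> 1 / \<rho> * n (k + d)" using n(2)[of "k + d"] \<rho> by (simp add: field_simps)
    also have "\<dots> \<le> \<mu> * (\<mu> ^ d * n k)"
      using Suc.IH \<mu> n(1) by (intro mult_mono) (auto simp: less_imp_le)
    finally show ?case by simp
  qed simp
  have "n N * (1 / K ^ (k - N)) powr q \<le> (C3 + 1) * \<mu> ^ ((N - k) + (k - N)) * n k" for N k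
  proof (cases "k \<le> N")
    case True
    have "n N \<le> \<mu> ^ (N - k) * n k" using up[of k "N - k"] True by simp
    also have "\<dots> \<le> (C3 + 1) * (\<mu> ^ (N - k) * n k)"
      using C3 \<mu> n(1)[of k] by (simp add: mult_le_cancel_right1 algebra_simps)
    finally show ?thesis using True by simp
  next
    case False
    then have Nk: "N \<le> k" by simp
    have "n N * (K ^ N) powr q \<le> (C3 + 1) * (C3 / (C3 + 1)) ^ (k - N) * (n k * (K ^ k) powr q)"
      using n(1) by (intro geometric_growth_of_sum_bound[of "\<lambda>j. n j * (K ^ j) powr q", OF _ C3 n3 Nk]) (auto simp: less_imp_le)
    also have "\<dots> \<le> (C3 + 1) * \<mu> ^ (k - N) * (n k * (K ^ k) powr q)"
      using \<mu> C3 n(1)[of k] by (intro mult_right_mono mult_left_mono power_mono) auto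
    finally have 1: "n N * (K ^ N) powr q \<le> (C3 + 1) * \<mu> ^ (k - N) * (n k * (K ^ k) powr q)" .
    have "K ^ k = K ^ N * K ^ (k - N)" using Nk by (simp flip: power_add)
    then have "1 / K ^ (k - N) = K ^ N / K ^ k" using K by simp
    then have e: "(1 / K ^ (k - N)) powr q = (K ^ N) powr q / (K ^ k) powr q" by (simp only: powr_divide)
    have Kk: "(K ^ k) powr q > 0" using K by simp
    have "n N * (1 / K ^ (k - N)) powr q = n N * (K ^ N) powr q / (K ^ k) powr q" unfolding e by simp
    also have "\<dots> \<le> (C3 + 1) * \<mu> ^ (k - N) * n k"
      using 1 Kk by (simp only: pos_divide_le_eq mult.assoc)
    finally show ?thesis using Nk by simp
  qed
  with \<mu> C3 show ?thesis by (intro that[of "C3 + 1" \<mu>]) auto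
qed

text \<open>Since 1 - s r is at least both 1 - s and 1 - r, the kernel is at most K^(min(k, N) + 1)
  for s in block k. The length of that block is at most K^(-k), so the product is K for k <= N and K
  / K^(k - N) otherwise.\<close>

lemma block_kernel_bound:
  fixes b :: "real \<Rightarrow> real" and \<beta> :: "nat \<Rightarrow> real"
  assumes K: "1 < K" and b: "\<And>k s. s \<in> block K k \<Longrightarrow> b s \<le> \<beta> k" and \<beta>: "\<And>k. 0 \<le> \<beta> k"
    and sm: "summable (\<lambda>k. 1 / K ^ (k - N) * \<beta> k)" and r: "r \<in> block K N"
  shows "(\<integral>\<^sup>+s. ennreal (4 * b s / (1 - s * r)) \<partial>unit_int) \<le> ennreal (4 * K * (\<Sum>k. 1 / K ^ (k - N) * \<beta> k))"
proof -
  have r01: "0 \<le> r" "r < 1" using r block_subset[OF K, of N] by auto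
  have em: "emeasure unit_int (block K k) = ennreal (1 / K ^ k - 1 / K ^ Suc k)" for k
  proof -
    have "emeasure unit_int (block K k) = emeasure lborel (block K k)"
      unfolding unit_int_def using block_subset[OF K, of k] by (subst emeasure_restrict_space) auto
    also have "\<dots> = ennreal (1 / K ^ k - 1 / K ^ Suc k)"
      using block_mono[OF K, of k "Suc k"] unfolding block_def by (subst emeasure_lborel_Ico) auto
    finally show ?thesis .
  qed
  have set: "block K k \<in> sets unit_int" for k
    using block_subset[OF K, of k] unfolding unit_int_def by (subst sets_restrict_space_iff) auto
  have "(\<integral>\<^sup>+s. ennreal (4 * b s / (1 - s * r)) \<partial>unit_int) \<le> (\<Sum>k. \<integral>\<^sup>+s. ennreal (4 * b s / (1 - s * r)) * indicator (block K k) s \<partial>unit_int)"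
    using block_cover[OF K] by (intro nn_integral_le_suminf_cover set) auto
  also have "\<dots> \<le> (\<Sum>k. ennreal (4 * K * (1 / K ^ (k - N) * \<beta> k)))"
  proof (intro suminf_le summableI)
    fix k
    define m where "m = min (K ^ Suc k) (K ^ Suc N)"
    have m0: "0 < m" using K by (simp add: m_def)
    have "(\<integral>\<^sup>+s. ennreal (4 * b s / (1 - s * r)) * indicator (block K k) s \<partial>unit_int)
        \<le> (\<integral>\<^sup>+s. ennreal (4 * \<beta> k * m) * indicator (block K k) s \<partial>unit_int)"
    proof (intro nn_integral_mono)
      fix s
      show "ennreal (4 * b s / (1 - s * r)) * indicator (block K k) s \<le> ennreal (4 * \<beta> k * m) * indicator (block K k) s"
      proof (cases "s \<in> block K k")
        case True
        then have s: "0 \<le> s" "s < 1" using block_subset[OF K, of k] by auto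
        have "s * r \<le> s" "s * r \<le> r" using s r01 by (auto intro: mult_left_le mult_left_le_one_le)
        moreover have "1 / K ^ Suc k < 1 - s" "1 / K ^ Suc N < 1 - r"
          using True r unfolding block_def atLeastLessThan_iff by linarith+
        ultimately have l: "1 / K ^ Suc k \<le> 1 - s * r" "1 / K ^ Suc N \<le> 1 - s * r" by linarith+
        have pos: "0 < 1 - s * r" using l(1) K by (smt (verit) divide_pos_pos zero_less_power)
        have "1 / (1 - s * r) \<le> K ^ Suc k" "1 / (1 - s * r) \<le> K ^ Suc N"
          using l pos K by (simp_all add: field_simps)
        then have m: "1 / (1 - s * r) \<le> m" by (simp add: m_def)
        have "4 * b s * (1 / (1 - s * r)) \<le> 4 * \<beta> k * (1 / (1 - s * r))"
          using b[OF True] pos by (intro mult_right_mono) auto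
        also have "\<dots> \<le> 4 * \<beta> k * m" using m \<beta>[of k] by (intro mult_left_mono) auto
        finally show ?thesis using True by (simp add: ennreal_leI)
      qed simp
    qed
    also have "\<dots> = ennreal (4 * \<beta> k * m) * emeasure unit_int (block K k)"
      by (rule nn_integral_cmult_indicator[OF set])
    also have "\<dots> \<le> ennreal (4 * \<beta> k * m) * ennreal (1 / K ^ k)"
      unfolding em using K by (intro mult_left_mono ennreal_leI) auto
    also have "\<dots> = ennreal (4 * \<beta> k * m * (1 / K ^ k))"
      using \<beta>[of k] m0 K by (intro ennreal_mult[symmetric]) auto
    also have "\<dots> \<le> ennreal (4 * K * (1 / K ^ (k - N) * \<beta> k))"
    proof (rule ennreal_leI)
      have "m * (1 / K ^ k) \<le> K * (1 / K ^ (k - N))"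
      proof (cases "k \<le> N")
        case True
        have "m * (1 / K ^ k) \<le> K ^ Suc k * (1 / K ^ k)" using K by (intro mult_right_mono) (auto simp: m_def)
        then show ?thesis using True K by simp
      next
        case False
        then have Nk: "K ^ k = K ^ N * K ^ (k - N)" by (simp flip: power_add)
        have "m * (1 / K ^ k) \<le> K ^ Suc N * (1 / K ^ k)" using K by (intro mult_right_mono) (auto simp: m_def)
        also have "\<dots> = K * (1 / K ^ (k - N))" using K unfolding Nk by simp
        finally show ?thesis .
      qed
      from mult_left_mono[OF this, of "4 * \<beta> k"] \<beta>[of k]
      show "4 * \<beta> k * m * (1 / K ^ k) \<le> 4 * K * (1 / K ^ (k - N) * \<beta> k)" by (simp add: mult_ac)
    qed
    finally show "(\<integral>\<^sup>+s. ennreal (4 * b s / (1 - s * r)) * indicator (block K k) s \<partial>unit_int) \<le> ennreal (4 * K * (1 / K ^ (k - N) * \<beta> k))" .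
  qed
  also have "\<dots> = ennreal (\<Sum>k. 4 * K * (1 / K ^ (k - N) * \<beta> k))"
    using K \<beta> by (intro suminf_ennreal2 summable_mult sm) (auto intro!: mult_nonneg_nonneg)
  also have "(\<Sum>k. 4 * K * (1 / K ^ (k - N) * \<beta> k)) = 4 * K * (\<Sum>k. 1 / K ^ (k - N) * \<beta> k)"
    by (rule suminf_mult[OF sm])
  finally show ?thesis .
qed

lemma mixed_norm_finite_of_blocks:
  fixes B n :: "nat \<Rightarrow> real" and \<Phi> :: "real \<Rightarrow> real"
  assumes K: "1 < K" and q: "0 < q" and rad: "radial_weight \<nu>" and n: "\<And>k. 0 < n k"
    and bm: "\<And>k. block_mass \<nu> K k \<le> ennreal (n k)" and \<Phi>: "\<And>r. 0 \<le> \<Phi> r"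
    and le: "\<And>N r. r \<in> block K N \<Longrightarrow> \<Phi> r \<le> a * B N" and a: "0 \<le> a" and B: "\<And>N. 0 \<le> B N"
    and sm: "summable (\<lambda>N. n N * B N powr q)"
  shows "(\<integral>\<^sup>+r\<in>{0..<1}. ennreal (\<Phi> r powr q * \<nu> (of_real r)) \<partial>lebesgue) < \<infinity>"
proof -
  have "(\<integral>\<^sup>+r\<in>{0..<1}. ennreal (\<Phi> r powr q * \<nu> (of_real r)) \<partial>lebesgue)
     \<le> (\<Sum>N. \<integral>\<^sup>+r. (ennreal (\<Phi> r powr q * \<nu> (of_real r)) * indicator {0..<1} r) * indicator (block K N) r \<partial>lebesgue)"
    using block_cover[OF K] by (intro nn_integral_le_suminf_cover) (auto simp: indicator_def split: if_splits)
  also have "\<dots> \<le> (\<Sum>N. ennreal (a powr q * (n N * B N powr q)))"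
  proof (intro suminf_le summableI)
    fix N
    have "(\<integral>\<^sup>+r. (ennreal (\<Phi> r powr q * \<nu> (of_real r)) * indicator {0..<1} r) * indicator (block K N) r \<partial>lebesgue)
      \<le> (\<integral>\<^sup>+r. ennreal ((a * B N) powr q) * (ennreal (\<nu> (of_real r)) * indicator (block K N) r) \<partial>lebesgue)"
    proof (intro nn_integral_mono)
      fix r
      show "(ennreal (\<Phi> r powr q * \<nu> (of_real r)) * indicator {0..<1} r) * indicator (block K N) r \<le> ennreal ((a * B N) powr q) * (ennreal (\<nu> (of_real r)) * indicator (block K N) r)"
      proof (cases "r \<in> block K N")
        case True
        then have r: "r \<in> {0..<1}" using block_subset[OF K, of N] by auto
        have "\<Phi> r powr q \<le> (a * B N) powr q" using le[OF True] \<Phi> q by (intro powr_mono2) auto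
        then have "\<Phi> r powr q * \<nu> (of_real r) \<le> (a * B N) powr q * \<nu> (of_real r)"
          using weight_nonneg[OF rad r] by (rule mult_right_mono)
        then show ?thesis using True r weight_nonneg[OF rad r] by (simp add: ennreal_leI flip: ennreal_mult)
      qed simp
    qed
    \<comment> \<open>An upper bound is wanted here, so the one-sided scaling of lower integrals is
      not enough; for a real constant equality holds.\<close>
    also have "\<dots> = ennreal ((a * B N) powr q) * block_mass \<nu> K N"
      unfolding block_mass_def by (rule nn_integral_cmult_real) simp
    also have "\<dots> \<le> ennreal ((a * B N) powr q) * ennreal (n N)" by (intro mult_left_mono bm) auto
    also have "\<dots> = ennreal (a powr q * (n N * B N powr q))"
      using n[of N] by (simp add: powr_mult mult_ac flip: ennreal_mult)
    finally show "(\<integral>\<^sup>+r. (ennreal (\<Phi> r powr q * \<nu> (of_real r)) * indicator {0..<1} r) * indicator (block K N) r \<partial>lebesgue) \<le> ennreal (a powr q * (n N * B N powr q))" .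
  qed
  also have "\<dots> = ennreal (\<Sum>N. a powr q * (n N * B N powr q))"
    using n by (intro suminf_ennreal2 summable_mult sm) (auto simp: less_imp_le)
  also have "\<dots> < \<infinity>" by simp
  finally show ?thesis .
qed

section \<open>Membership of the factors in the function classes\<close>

text \<open>A crude form of Minkowski's inequality: one factor 2 comes from
  \<open>powr_add_le\<close>, the other from U^p + V^p <= 2 (U + V)^p <= 2^p (U + V)^p.\<close>

lemma integral_mean_add_le:
  assumes p: "1 \<le> p" and r: "0 \<le> r" "r < 1"
    and h: "h holomorphic_on ball 0 1" "u holomorphic_on ball 0 1" "v holomorphic_on ball 0 1"
    and le: "\<And>z. cmod z < 1 \<Longrightarrow> cmod (h z) \<le> cmod (u z) + cmod (v z)"
  shows "integral_mean p r h \<le> 4 * (integral_mean p r u + integral_mean p r v)"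
proof -
  define U V where "U = integral_mean p r u" and "V = integral_mean p r v"
  have UV: "0 \<le> U" "0 \<le> V" by (auto simp: U_def V_def integral_mean_nonneg)
  have m: "(\<lambda>t. ennreal (cmod (w (of_real r * cis t)) powr p)) \<in> borel_measurable circ" if "w holomorphic_on ball 0 1" for w
  proof -
    have [measurable]: "(\<lambda>t. w (of_real r * cis t)) \<in> borel_measurable borel"
      by (intro borel_measurable_continuous_onI continuous_on_circle_of_holomorphic that r)
    then have "(\<lambda>t. w (of_real r * cis t)) \<in> borel_measurable circ"
      unfolding circ_def by (intro measurable_restrict_space1) simp
    then have "(\<lambda>t. cmod (w (of_real r * cis t))) \<in> borel_measurable circ" by simp
    then have "(\<lambda>t. cmod (w (of_real r * cis t)) powr p) \<in> borel_measurable circ"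
      by (rule powr_real_measurable) simp
    then show ?thesis by simp
  qed
  have "(\<integral>\<^sup>+t. ennreal (cmod (h (of_real r * cis t)) powr p) \<partial>circ)
    \<le> (\<integral>\<^sup>+t. ennreal (2 powr p) * (ennreal (cmod (u (of_real r * cis t)) powr p) + ennreal (cmod (v (of_real r * cis t)) powr p)) \<partial>circ)"
  proof (intro nn_integral_mono)
    fix t
    have "cmod (h (of_real r * cis t)) powr p \<le> (cmod (u (of_real r * cis t)) + cmod (v (of_real r * cis t))) powr p"
      using le[of "of_real r * cis t"] r p by (intro powr_mono2) (auto simp: norm_mult)
    also have "\<dots> \<le> 2 powr p * (cmod (u (of_real r * cis t)) powr p + cmod (v (of_real r * cis t)) powr p)"
      using p by (intro powr_add_le) auto
    finally show "ennreal (cmod (h (of_real r * cis t)) powr p) \<le> ennreal (2 powr p) * (ennreal (cmod (u (of_real r * cis t)) powr p) + ennreal (cmod (v (of_real r * cis t)) powr p))"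
      by (simp add: ennreal_leI flip: ennreal_mult ennreal_plus)
  qed
  also have "\<dots> = ennreal (2 powr p) * (ennreal (2*pi * U powr p) + ennreal (2*pi * V powr p))"
    using m[OF h(2)] m[OF h(3)] p r h
    by (simp add: nn_integral_cmult nn_integral_add U_def V_def nn_integral_powr_eq_integral_mean continuous_on_circle_of_holomorphic)
  also have "\<dots> = ennreal (2*pi * (2 powr p * (U powr p + V powr p)))"
    using UV by (simp add: algebra_simps flip: ennreal_mult ennreal_plus)
  also have "\<dots> \<le> ennreal (2*pi * (4 * (U + V)) powr p)"
  proof (intro ennreal_leI mult_left_mono)
    have "U powr p \<le> (U + V) powr p" "V powr p \<le> (U + V) powr p" using UV p by (auto intro!: powr_mono2)
    then have "U powr p + V powr p \<le> 2 powr 1 * (U + V) powr p" by simp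
    also have "\<dots> \<le> 2 powr p * (U + V) powr p" using p by (intro mult_right_mono powr_mono) auto
    finally have "2 powr p * (U powr p + V powr p) \<le> 2 powr p * (2 powr p * (U + V) powr p)" by (intro mult_left_mono) auto
    also have "\<dots> = (2 * (2 * (U + V))) powr p" by (simp only: powr_mult)
    finally show "2 powr p * (U powr p + V powr p) \<le> (4 * (U + V)) powr p" by simp
  qed simp
  finally show ?thesis
    unfolding U_def V_def using p integral_mean_nonneg
    by (intro integral_mean_leI continuous_on_circle_of_holomorphic h r) auto
qed

lemma bounded_imp_Hardy:
  assumes h: "h holomorphic_on ball 0 1" and p: "1 \<le> p" and B: "\<And>z. cmod z < 1 \<Longrightarrow> cmod (h z) \<le> B"
  shows "h \<in> Hardy p" "h \<in> Hardy_inf"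
proof -
  show "h \<in> Hardy_inf" unfolding Hardy_inf_def bounded_iff using h B by (auto intro!: exI[of _ B])
  have B0: "0 \<le> B" using B[of 0] norm_ge_zero[of "h 0"] by (simp del: norm_ge_zero)
  have "integral_mean p r h \<le> B" if r: "0 \<le> r" "r < 1" for r
  proof (rule integral_mean_leI)
    have "(\<integral>\<^sup>+t. ennreal (cmod (h (of_real r * cis t)) powr p) \<partial>circ) \<le> (\<integral>\<^sup>+t. ennreal (B powr p) \<partial>circ)"
      using B r p by (intro nn_integral_mono ennreal_leI powr_mono2) (auto simp: norm_mult)
    also have "\<dots> = ennreal (2*pi * B powr p)"
      using emeasure_circ by (simp add: mult.commute flip: ennreal_mult)
    finally show "(\<integral>\<^sup>+t. ennreal (cmod (h (of_real r * cis t)) powr p) \<partial>circ) \<le> ennreal (2*pi * B powr p)" .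
  qed (use p B0 r h in \<open>auto intro!: continuous_on_circle_of_holomorphic\<close>)
  then show "h \<in> Hardy p" unfolding Hardy_def using h by (auto intro!: bdd_aboveI2)
qed

text \<open>The witness is exp(- \<open>bdry\<close>). It is at most 1 because \<open>bdry\<close>
  is non-negative, and its logarithm is integrable because \<open>bdry\<close> is. The Schwarz
  representation of \<open>F\<close> gives the formula.\<close>

lemma (in derivative_majorant) outer_function_exp_minus_F: "outer_function \<infinity> (\<lambda>z. exp (- F z))"
proof -
  have bm: "(\<lambda>t. bdry (cis t)) \<in> borel_measurable lborel" using bdry_measurable by simp
  have m: "(\<lambda>t. exp (- bdry (cis t))) \<in> borel_measurable (lebesgue_on {0..2*pi})"
    by (intro measurable_restrict_space1 measurable_completion) (use bm in measurable)
  have "integrable lborel (\<lambda>t. indicator {0..2*pi} t *\<^sub>R (bdry (cis t)))"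
    using bdry_integrable unfolding circ_def by (subst (asm) integrable_restrict_space) auto
  then have "integrable lebesgue (\<lambda>t. indicator {0..2*pi} t *\<^sub>R (bdry (cis t)))"
    by (subst integrable_completion) auto
  then have i: "integrable (lebesgue_on {0..2*pi}) (\<lambda>t. bdry (cis t))"
    by (subst integrable_restrict_space) auto
  have e: "exp (- F z) = outer_integral (\<lambda>w. exp (- bdry w)) z" if z: "cmod z < 1" for z
  proof -
    have [measurable]: "(\<lambda>t. (cis t + z) / (cis t - z)) \<in> borel_measurable borel" by measurable
    have "(LINT t:{0..2*pi}|lebesgue. (cis t + z) / (cis t - z) * of_real (ln (exp (- bdry (cis t)))))
      = (\<integral>t. (cis t + z) / (cis t - z) * of_real (ln (exp (- bdry (cis t)))) \<partial>circ)"
      by (rule set_integral_lebesgue_eq_circ) measurable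
    also have "\<dots> = - (\<integral>t. (cis t + z) / (cis t - z) * of_real (bdry (cis t)) \<partial>circ)" by simp
    also have "\<dots> = - (of_real (2*pi) * F z)" unfolding F_eq_Schwarz_integral[OF z] ..
    finally show ?thesis unfolding outer_integral_def by simp
  qed
  show ?thesis unfolding outer_function_def Lp_circle_def
    using m i e bdry_nonneg
    by (intro exI[of _ "\<lambda>w. exp (- bdry w)"]) (auto intro!: exI[of _ 1])
qed

text \<open>
  This covers the degenerate weights whose tail integral at 0 is infinite without invoking
  polar coordinates to rule them out.
\<close>

lemma deriv_zero_of_infinite_weight:
  assumes \<nu>: "\<nu> \<in> D_hat" and inf: "weight_hat \<nu> 0 = \<infinity>" and q: "0 < q" and p: "1 \<le> p"
    and h: "h holomorphic_on ball 0 1" and fin: "mixed_norm_pow p q \<nu> h < \<infinity>" and z: "cmod z < 1"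
  shows "h z = 0"
proof -
  have rad: "radial_weight \<nu>" using \<nu> by (auto simp: D_hat_def)
  obtain C where C: "0 < C" "\<And>r. r \<in> {0..<1} \<Longrightarrow> weight_hat \<nu> r \<le> ennreal C * weight_hat \<nu> ((1 + r) / 2)"
    using \<nu> by (auto simp: D_hat_def)
  \<comment> \<open>A radius beyond |z|. Finitely many doublings carry the infinite tail mass from 0
    past it.\<close>
  define r where "r = (1 + cmod z) / 2"
  have r: "0 < r" "r < 1" "cmod z < r" using z by (auto simp: r_def add_pos_nonneg)
  obtain j where "1 / (1 - r) < 2 ^ j" using real_arch_pow[of 2 "1 / (1 - r)"] by auto
  then have "r \<le> 1 - (1 - 0) / 2 ^ j" using r by (simp add: field_simps)
  then have "weight_hat \<nu> (1 - (1 - 0) / 2 ^ j) \<le> weight_hat \<nu> r" by (rule weight_hat_antimono)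
  moreover have "weight_hat \<nu> (1 - (1 - 0) / 2 ^ j) = \<infinity>"
    using D_hat_iterate[OF C, of 0 j] inf by (auto simp: top_unique ennreal_mult_eq_top_iff)
  ultimately have w: "weight_hat \<nu> r = \<infinity>" by (simp add: top_unique)
  define M where "M = integral_mean p r h"
  \<comment> \<open>Means increase with the radius, so a nonzero \<open>M\<close> would make the
    norm at least M^q times an infinite tail mass.\<close>
  have M0: "M = 0"
  proof (rule ccontr)
    assume "M \<noteq> 0"
    then have "0 < M powr q" by simp
    then have "\<infinity> = ennreal (M powr q) * weight_hat \<nu> r" unfolding w by (simp add: ennreal_mult_top)
    also have "\<dots> \<le> (\<integral>\<^sup>+s. ennreal (M powr q) * (ennreal (\<nu> (of_real s)) * indicator {r..<1} s) \<partial>lebesgue)"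
      unfolding weight_hat_def by (rule nn_integral_cmult_ge)
    also have "\<dots> \<le> mixed_norm_pow p q \<nu> h"
      unfolding mixed_norm_pow_def
    proof (intro nn_integral_mono)
      fix s
      show "ennreal (M powr q) * (ennreal (\<nu> (of_real s)) * indicator {r..<1} s) \<le> ennreal (integral_mean p s h powr q * \<nu> (of_real s)) * indicator {0..<1} s"
      proof (cases "s \<in> {r..<1}")
        case True
        then have s: "s \<in> {0..<1}" using r by auto
        have "M powr q \<le> integral_mean p s h powr q"
          unfolding M_def using True r q by (intro powr_mono2 integral_mean_mono h p integral_mean_nonneg) auto
        then have "M powr q * \<nu> (of_real s) \<le> integral_mean p s h powr q * \<nu> (of_real s)"
          using weight_nonneg[OF rad s] by (rule mult_right_mono)
        then show ?thesis using True s weight_nonneg[OF rad s] by (simp add: ennreal_leI flip: ennreal_mult)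
      qed simp
    qed
    finally show False using fin by simp
  qed
  have ch: "continuous_on UNIV (\<lambda>t. h (of_real r * cis t))"
    using r by (intro continuous_on_circle_of_holomorphic h) auto
  then have hm: "(\<lambda>t. h (of_real r * cis t)) \<in> borel_measurable circ"
    unfolding circ_def by (intro measurable_restrict_space1) (simp add: borel_measurable_continuous_onI)
  have "(\<integral>\<^sup>+t. ennreal (cmod (h (of_real r * cis t)) powr p) \<partial>circ) = 0"
    using nn_integral_powr_eq_integral_mean[OF ch, of p] p M0 by (simp add: M_def)
  moreover have "(\<lambda>t. ennreal (cmod (h (of_real r * cis t)) powr p)) \<in> borel_measurable circ"
    by (intro measurable_compose[OF powr_real_measurable measurable_ennreal]) (use hm in simp_all)
  ultimately have ae: "AE t in circ. h (of_real r * cis t) = 0"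
    by (subst (asm) nn_integral_0_iff_AE) (auto simp: ennreal_eq_0_iff)
  have rw: "r * cmod w < 1" if "cmod w \<le> 1" for w
    using mult_left_le[OF that, of r] r by linarith
  have hs: "(\<lambda>w. h (of_real r * w)) holomorphic_on ball 0 1"
    by (intro holomorphic_on_compose_gen[OF _ h, unfolded o_def] holomorphic_intros)
      (use r in \<open>auto simp: norm_mult rw\<close>)
  have cs: "continuous_on (cball 0 1) (\<lambda>w. h (of_real r * w))"
    by (intro continuous_on_compose2[OF holomorphic_on_imp_continuous_on[OF h]] continuous_intros)
      (use r in \<open>auto simp: norm_mult rw\<close>)
  \<comment> \<open>\<open>h\<close> vanishes almost everywhere on the circle of radius r, and
    Poisson domination carries this inwards to \<open>z\<close>.\<close>
  have "cmod (z / of_real r) < 1" using r by (simp add: norm_divide)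
  from norm_le_Poisson[OF cs hs this]
  have "ennreal (cmod (h (of_real r * (z / of_real r)))) \<le> (\<integral>\<^sup>+t. 0 \<partial>circ)"
    by (rule order.trans) (intro nn_integral_mono_AE, use ae in \<open>auto elim!: eventually_mono\<close>)
  then show ?thesis using r by simp
qed

lemma Besov_quotient_finite_weight:
  fixes p q :: real and \<nu> :: "complex \<Rightarrow> real" and f :: "complex \<Rightarrow> complex"
  assumes p: "1 \<le> p" and q: "0 < q" and \<nu>: "\<nu> \<in> D_two_sided \<inter> D_hat_sub q"
    and f: "f \<in> Besov p q \<nu>" and fin: "weight_hat \<nu> 0 < \<infinity>"
  shows "\<exists>f1 f2. f1 \<in> Besov p q \<nu> \<inter> Hardy_inf \<and> f2 \<in> Besov p q \<nu> \<inter> Hardy_inf \<and>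
           (\<forall>z\<in>\<bbbD>. f z = f1 z / f2 z) \<and> outer_function \<infinity> f2"
proof -
  have rad: "radial_weight \<nu>" using \<nu> by (auto simp: D_two_sided_def D_hat_def)
  have holo: "f holomorphic_on ball 0 1" and mix: "mixed_norm_pow p q \<nu> (deriv f) < \<infinity>"
    using f by (auto simp: Besov_def Hardy_def)
  have holo': "deriv f holomorphic_on ball 0 1" by (intro holomorphic_deriv holo) auto
  define M where "M r = integral_mean p r (deriv f)" for r
  have M: "\<And>r s. 0 \<le> r \<Longrightarrow> r \<le> s \<Longrightarrow> s < 1 \<Longrightarrow> M r \<le> M s" "\<And>r. 0 \<le> M r"
    using integral_mean_mono[OF holo' p] by (auto simp: M_def integral_mean_nonneg)
  obtain K \<rho> C2 C3 c :: real and n :: "nat \<Rightarrow> real" where K: "1 < K" and \<rho>: "1 < \<rho>" and C: "0 < C2" "0 < C3" "0 < c"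
    and n: "\<And>k. 0 < n k" "\<And>k. \<rho> * n (Suc k) \<le> n k" "\<And>k. n k \<le> C2 * n (Suc k)"
    "\<And>k. (\<Sum>j<k. n j * (K ^ j) powr q) \<le> C3 * (n k * (K ^ k) powr q)"
    "\<And>k. ennreal (c * n k) \<le> block_mass \<nu> K k" "\<And>k. block_mass \<nu> K k \<le> ennreal (n k)"
    by (rule weight_sequence[OF \<nu> q fin]) blast
  obtain C \<mu> where C': "0 \<le> C" and \<mu>: "0 < \<mu>" "\<mu> < 1"
    and diag: "\<And>N k. n N * (1 / K ^ (k - N)) powr q \<le> C * \<mu> ^ ((N - k) + (k - N)) * n k"
    using weight_sequence_diagonal[OF K \<rho> C(2) n(1,2,4)] by blast
  \<comment> \<open>The value of M + 1 at the right endpoint, by monotonicity an upper bound for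
    \<open>b\<close> on the whole block.\<close>
  define \<beta> where "\<beta> k = M (1 - 1 / K ^ Suc k) + 1" for k
  have \<beta>: "1 \<le> \<beta> k" "0 \<le> \<beta> k" for k using M(2) by (auto simp: \<beta>_def add_nonneg_nonneg)
  have s\<beta>: "summable (\<lambda>k. n k * \<beta> k powr q)"
    unfolding \<beta>_def using mix unfolding mixed_norm_pow_def M_def[symmetric]
    by (intro summable_of_mixed_norm[OF K q rad M _ C(3) \<rho> n(1,2,3,5)])
  have e0: "0 \<le> 1 / K ^ (k - N)" for N k using K by simp
  note ad = almost_diagonal_bound[OF q C' \<mu> n(1) \<beta>(2) e0 s\<beta> diag]
  define B where "B N = (\<Sum>k. 1 / K ^ (k - N) * \<beta> k)" for N
  \<comment> \<open>The diagonal entry of the matrix is 1. Hence \<open>B\<close> controls the means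
    of f' as well as those of F'.\<close>
  have B\<beta>: "\<beta> N \<le> B N" for N
    unfolding B_def using sum_le_suminf[OF ad(1)[of N], of "{N}"] e0 \<beta>(2) by simp
  have B0: "0 < B N" for N using B\<beta>[of N] \<beta>(1)[of N] by simp
  have sB: "summable (\<lambda>N. n N * B N powr q)" unfolding B_def by (rule ad(2))
  define b where "b s = M s + 1" for s
  have b\<beta>: "b s \<le> \<beta> k" if s: "s \<in> block K k" for s k
  proof -
    have "s \<in> {0..<1}" using s block_subset[OF K] by blast
    moreover have "s \<le> 1 - 1 / K ^ Suc k" using s unfolding block_def by auto
    moreover have "1 - 1 / K ^ Suc k < 1" using K by (simp del: power_Suc)
    ultimately show ?thesis using M(1)[of s "1 - 1 / K ^ Suc k"] by (simp add: b_def \<beta>_def)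
  qed
  have kern: "(\<integral>\<^sup>+s. ennreal (4 * b s / (1 - s * r)) \<partial>unit_int) \<le> ennreal (4 * K * B N)" if "r \<in> block K N" for r N
    unfolding B_def by (rule block_kernel_bound[OF K b\<beta> \<beta>(2) ad(1) that])
  interpret derivative_majorant f p b
  proof
    \<comment> \<open>Monotonicity of the means in the radius is the source of
      measurability.\<close>
    have "mono_on {0..<1} b" using M(1) by (intro mono_onI) (auto simp: b_def)
    then have "b \<in> borel_measurable (restrict_space borel {0..<1})" by (rule borel_measurable_mono_on_fnc)
    then show "b \<in> borel_measurable unit_int" by (simp cong: measurable_cong_sets add: sets_unit_int)
    show "0 < b s" for s using M(2)[of s] by (simp add: b_def)
    show "integral_mean p s (deriv f) \<le> b s" for s by (simp add: b_def M_def)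
    \<comment> \<open>At r = 0 the kernel is the constant 4, so the block estimate already contains
      the integrability of \<open>b\<close>.\<close>
    have "(\<integral>\<^sup>+s. ennreal (b s) \<partial>unit_int) \<le> (\<integral>\<^sup>+s. ennreal (4 * b s / (1 - s * 0)) \<partial>unit_int)"
      using M(2) by (intro nn_integral_mono ennreal_leI) (simp add: b_def)
    also have "\<dots> \<le> ennreal (4 * K * B 0)" using K by (intro kern) (simp add: block_def)
    also have "\<dots> < \<infinity>" by simp
    finally show "(\<integral>\<^sup>+s. ennreal (b s) \<partial>unit_int) < \<infinity>" .
  qed (use holo p in auto)
  have hF': "deriv F holomorphic_on ball 0 1" by (intro holomorphic_deriv F_holomorphic) auto
  have dF: "(F has_field_derivative deriv F z) (at z)" if "cmod z < 1" for z
    using F_holomorphic that by (intro holomorphic_derivI[of F "ball 0 1"]) auto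
  have df: "(f has_field_derivative deriv f z) (at z)" if "cmod z < 1" for z
    using holo that by (intro holomorphic_derivI[of f "ball 0 1"]) auto
  have Besov: "h \<in> Besov p q \<nu> \<inter> Hardy_inf"
    if h: "h holomorphic_on ball 0 1" and h1: "\<And>z. cmod z < 1 \<Longrightarrow> cmod (h z) \<le> 1"
      and h': "\<And>z. cmod z < 1 \<Longrightarrow> cmod (deriv h z) \<le> cmod (deriv f z) + cmod (deriv F z)" for h
  proof -
    have hh: "deriv h holomorphic_on ball 0 1" by (intro holomorphic_deriv h) auto
    \<comment> \<open>The outer 4 is the constant of \<open>integral_mean_add_le\<close>; inside, 1
      stands for the means of f' and 4 K for those of F'.\<close>
    have "integral_mean p r (deriv h) \<le> (4 * (1 + 4 * K)) * B N" if r: "r \<in> block K N" for r N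
    proof -
      have r01: "0 \<le> r" "r < 1" using r block_subset[OF K, of N] by auto
      have "integral_mean p r (deriv h) \<le> 4 * (M r + integral_mean p r (deriv F))"
        unfolding M_def by (rule integral_mean_add_le[OF p r01 hh holo' hF' h'])
      moreover have "M r \<le> B N" using b\<beta>[OF r] B\<beta>[of N] by (simp add: b_def)
      moreover have "integral_mean p r (deriv F) \<le> 4 * K * B N"
        using K B0[of N] by (intro integral_mean_deriv_F r01 kern r) auto
      ultimately show ?thesis by (simp add: algebra_simps)
    qed
    then have "mixed_norm_pow p q \<nu> (deriv h) < \<infinity>"
      unfolding mixed_norm_pow_def using K B0
      by (intro mixed_norm_finite_of_blocks[OF K q rad n(1) n(6), where a = "4 * (1 + 4 * K)" and B = B] integral_mean_nonneg)
        (auto simp: less_imp_le intro: sB)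
    then show ?thesis using bounded_imp_Hardy[OF h p h1] by (simp add: Besov_def)
  qed
  have F0: "0 \<le> Re (F z)" if "cmod z < 1" for z
    using cmod_le_Re_F[OF that] norm_ge_zero[of "f z"] by linarith
  have fe: "cmod (f z) * exp (- Re (F z)) \<le> 1" if "cmod z < 1" for z
  proof -
    \<comment> \<open>The elementary x <= exp x turns the linear majorant |f| <= Re F into
      boundedness of f exp(-F).\<close>
    have "cmod (f z) \<le> exp (Re (F z))" using cmod_le_Re_F[OF that] exp_ge_add_one_self[of "Re (F z)"] by linarith
    then show ?thesis by (simp add: exp_minus field_simps)
  qed
  have d2: "((\<lambda>z. exp (- F z)) has_field_derivative - deriv F z * exp (- F z)) (at z)" if "cmod z < 1" for z
    by (rule derivative_eq_intros dF that refl)+ simp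
  have d1: "((\<lambda>z. f z * exp (- F z)) has_field_derivative deriv f z * exp (- F z) - deriv F z * (f z * exp (- F z))) (at z)" if "cmod z < 1" for z
    using DERIV_mult[OF df[OF that] d2[OF that]] by (simp add: algebra_simps)
  have f2: "(\<lambda>z. exp (- F z)) \<in> Besov p q \<nu> \<inter> Hardy_inf"
  proof (rule Besov)
    show "(\<lambda>z. exp (- F z)) holomorphic_on ball 0 1" by (intro holomorphic_intros F_holomorphic)
    fix z :: complex assume z: "cmod z < 1"
    show e: "cmod (exp (- F z)) \<le> 1" using F0[OF z] by simp
    show "cmod (deriv (\<lambda>z. exp (- F z)) z) \<le> cmod (deriv f z) + cmod (deriv F z)"
      unfolding DERIV_imp_deriv[OF d2[OF z]] norm_mult norm_minus_cancel
      using mult_left_le[OF e, of "cmod (deriv F z)"] by (simp add: add_increasing)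
  qed
  have f1: "(\<lambda>z. f z * exp (- F z)) \<in> Besov p q \<nu> \<inter> Hardy_inf"
  proof (rule Besov)
    show "(\<lambda>z. f z * exp (- F z)) holomorphic_on ball 0 1" by (intro holomorphic_intros F_holomorphic holo)
    fix z :: complex assume z: "cmod z < 1"
    show e1: "cmod (f z * exp (- F z)) \<le> 1" using fe[OF z] by (simp add: norm_mult)
    have e: "cmod (exp (- F z)) \<le> 1" using F0[OF z] by simp
    have "cmod (deriv f z * exp (- F z)) \<le> cmod (deriv f z)"
      unfolding norm_mult using e by (intro mult_left_le) auto
    moreover have "cmod (deriv F z * (f z * exp (- F z))) \<le> cmod (deriv F z)"
      unfolding norm_mult[of "deriv F z"] using e1 by (intro mult_left_le) auto
    ultimately show "cmod (deriv (\<lambda>z. f z * exp (- F z)) z) \<le> cmod (deriv f z) + cmod (deriv F z)"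
      unfolding DERIV_imp_deriv[OF d1[OF z]] by (intro order.trans[OF norm_triangle_ineq4] add_mono)
  qed
  show ?thesis
    using f1 f2 outer_function_exp_minus_F by (intro exI conjI) auto
qed

theorem theorem5:
  fixes p q :: real and \<nu> :: "complex \<Rightarrow> real" and f :: "complex \<Rightarrow> complex"
  assumes "1 \<le> p" and "0 < q"
    and "\<nu> \<in> D_two_sided \<inter> D_hat_sub q"
    and "f \<in> Besov p q \<nu>"
  shows "\<exists>f1 f2. f1 \<in> Besov p q \<nu> \<inter> Hardy_inf \<and> f2 \<in> Besov p q \<nu> \<inter> Hardy_inf \<and>
           (\<forall>z\<in>\<bbbD>. f z = f1 z / f2 z) \<and> outer_function \<infinity> f2"
proof (cases "weight_hat \<nu> 0 < \<infinity>")
  case True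
  with assms show ?thesis by (rule Besov_quotient_finite_weight)
next
  case False
  then have inf: "weight_hat \<nu> 0 = \<infinity>" by (simp add: not_less top_unique)
  have \<nu>: "\<nu> \<in> D_hat" using assms(3) by (simp add: D_two_sided_def)
  have holo: "f holomorphic_on ball 0 1" and mix: "mixed_norm_pow p q \<nu> (deriv f) < \<infinity>"
    using assms(4) by (auto simp: Besov_def Hardy_def)
  \<comment> \<open>An infinite tail mass forces f' = 0, so f is a constant. It serves as its own
    numerator over the denominator 1, which is outer with boundary modulus 1.\<close>
  have d0: "deriv f z = 0" if "cmod z < 1" for z
    by (rule deriv_zero_of_infinite_weight[OF \<nu> inf assms(2,1) _ mix that]) (intro holomorphic_deriv holo, auto)
  have const: "f z = f 0" if "cmod z < 1" for z
  proof (rule has_field_derivative_zero_constant[of "ball 0 1" f, THEN exE])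
    show "(f has_field_derivative 0) (at w within ball 0 1)" if "w \<in> ball 0 1" for w
      using holomorphic_derivI[OF holo open_ball that] d0[of w] that by (auto intro: DERIV_subset)
    fix c assume "\<forall>w\<in>ball 0 1. f w = c"
    then show ?thesis using that by auto
  qed auto
  have "f \<in> Hardy_inf"
    using const by (intro bounded_imp_Hardy(2)[OF holo assms(1), of "cmod (f 0)"]) (metis order_refl)
  moreover have "(\<lambda>_. 1) \<in> Besov p q \<nu> \<inter> Hardy_inf"
  proof -
    have "(\<lambda>_. 1) \<in> Hardy p" "(\<lambda>_. 1) \<in> Hardy_inf"
      using bounded_imp_Hardy[of "\<lambda>_. 1" p 1] assms(1) by auto
    moreover have "integral_mean p r (deriv (\<lambda>_. 1)) = 0" for r
      by (simp add: integral_mean_def set_lebesgue_integral_def)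
    ultimately show ?thesis using assms(2) by (simp add: Besov_def mixed_norm_pow_def)
  qed
  moreover have "outer_function \<infinity> (\<lambda>_. 1)"
    unfolding outer_function_def Lp_circle_def
    by (intro exI[of _ "\<lambda>_. 1"]) (auto simp: outer_integral_def set_lebesgue_integral_def intro!: exI[of _ 1])
  ultimately show ?thesis using assms(4) by (intro exI[of _ f] exI[of _ "\<lambda>_. 1"]) auto
qed

end
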